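(* Let $p=p_1+p_2$ with $p_1,p_2\in\mathbb{N}$ and write $$\Lambda_k=\begin{pmatrix}\Lambda_k^{11}&\Lambda_k^{12}\\\Lambda_k^{21}&\Lambda_k^{22}\end{pmatrix},\qquad\Lambda_k^{ij}\in\mathbb{C}^{p_i\times p_j},\ i,j\in\{1,2\}.$$ Let $\{d_k\}_{k=1}^\infty\in\ell^2(\mathbb{N})$ be a non-increasing sequence such that $d_kd_{k+2}\ge d_{k+1}^2$ for all $k\in\mathbb{N}$. Suppose that the matrices $\Lambda_k=\Lambda_k^*$ satisfy: (i) $\displaystyle\sum_{k=1}^\infty d_{k+1}\left\|\Lambda_k^{11}+\left(\frac1{d_k}+\frac1{d_{k+1}}\right)\mathrm{I}_{p_1}\right\|_{\mathbb{C}^{p_1}}<\infty$; (ii) $\|\Lambda_k^{12}\|_{\mathbb{C}^{p_1\times p_2}}=\mathcal{O}(d_k)$ as $k\to\infty$; (iii) $\Lambda_k^{22}=\widehat\Lambda_k^{22}+\widetilde\Lambda_k^{22}$, where $\|\widetilde\Lambda_k^{22}\|_{\mathbb{C}^{p_2\times p_2}}=\mathcal{O}(d_k)$ as $k\to\infty$ and $\widehat\Lambda_k^{22}=\operatorname{diag}(\alpha_{k,j})_{j=1}^{p_2}$ are diagonal matrices such that either $$\sum_{k=1}^\infty|\alpha_{k,j}|d_k^3=\infty\qquad\text{for all }j\in\{1,\dots,p_2\},$$ or there is a constant $M>0$ such that for all $k\in\mathbb{N}$ and $j\in\{1,\dots,p_2\}$ $$\frac4{d_{k+1}^2}+\frac{\alpha_{k,j}}{d_{k+1}}\le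 M.$$ Then $n_\pm(H_{X,\Lambda})=p_1$.
   Context: Let $p\in\mathbb{N}$, $\mathbb{R}_+=(0,\infty)$. Let $X=\{x_k\}_{k=0}^\infty$ be strictly increasing with $x_0=0$ and $\lim_{k\to\infty}x_k=\infty$; $d_k:=x_k-x_{k-1}$ for $k\in\mathbb{N}$, with $\sup_kd_k<\infty$. Let $\Lambda=\{\Lambda_k\}_{k=1}^\infty\subset\mathbb{C}^{p\times p}$ with $\Lambda_k=\Lambda_k^*$. $\mathrm{I}_{p_1}$ is the $p_1\times p_1$ identity matrix; norms are operator norms of matrices. In (iii) the diagonal matrices $\widehat\Lambda_k^{22}$ are Hermitian, i.e. $\alpha_{k,j}\in\mathbb{R}$. $H_{X,\Lambda}$ is the closure in $L^2(\mathbb{R}_+;\mathbb{C}^p)$ of the operator acting as $f\mapsto-f''$ (on each interval $(x_{k-1},x_k)$) on all $f$ with compact support in $[0,\infty)$, with restrictions in $W^{2,2}([x_{k-1},x_k];\mathbb{C}^p)$ for every $k$, and with $f'(0)=0$, $f(x_k+)=f(x_k-)$, $f'(x_k+)-f'(x_k-)=\Lambda_kf(x_k)$, $k\in\mathbb{N}$. For a densely defined closed symmetric operator $T$, $n_\pm(T):=\dim\ker(T^*\mp\mathrm{i})$ are its deficiency indices; $n_\pm(T)=p_1$ means both equal $p_1$. *)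

theory Defs
  imports "HOL-Analysis.Analysis" "HOL-Library.Landau_Symbols" "HOL-Library.Extended_Nat"
begin

section \<open>The complex Hilbert space \<open>L\<^sup>2(\<real>\<^sub>+; \<complex>\<^sup>p)\<close>\<close>

text \<open>
  The index type \<open>'n\<close> plays the role of \<open>{1,\<dots>,p}\<close>.  The inner products are linear in the first
  argument.
\<close>

definition cdot :: "complex ^ 'n \<Rightarrow> complex ^ 'n \<Rightarrow> complex"
  where "cdot u v = (\<Sum>i\<in>UNIV. u $ i * cnj (v $ i))"

definition square_integrable :: "real set \<Rightarrow> (real \<Rightarrow> complex ^ 'n) \<Rightarrow> bool"
  where "square_integrable S f \<longleftrightarrow>
    set_borel_measurable lborel S f \<and> set_integrable lborel S (\<lambda>t. (norm (f t))\<^sup>2)"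

lemma Re_cdot: "Re (cdot u v) = inner u v"
  by (simp add: cdot_def inner_vec_def inner_complex_def)

lemma cdot_commute: "cdot u v = cnj (cdot v u)"
  by (simp add: cdot_def mult.commute)

lemma cdot_add_left: "cdot (u + v) w = cdot u w + cdot v w"
  by (simp add: cdot_def sum.distrib algebra_simps)

lemma cdot_scale_left: "cdot (c *s u) w = c * cdot u w"
  by (simp add: cdot_def sum_distrib_left mult.assoc)

lemma cdot_scaleR_left: "cdot (r *\<^sub>R u) w = r *\<^sub>R cdot u w"
  by (simp add: cdot_def scaleR_sum_right)

lemma cdot_scaleR_right: "cdot u (r *\<^sub>R w) = r *\<^sub>R cdot u w"
  by (simp add: cdot_def scaleR_sum_right)

lemma norm_cdot_le: "norm (cdot u v) \<le> real CARD('n) * ((norm u)\<^sup>2 + (norm v)\<^sup>2)"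
  for u v :: "complex ^ 'n"
proof -
  have "norm (u $ i * cnj (v $ i)) \<le> (norm u)\<^sup>2 + (norm v)\<^sup>2" for i
  proof -
    have "norm (u $ i * cnj (v $ i)) \<le> norm u * norm v"
      by (simp add: norm_mult mult_mono Finite_Cartesian_Product.norm_nth_le)
    also have "\<dots> \<le> (norm u)\<^sup>2 + (norm v)\<^sup>2"
    proof -
      have "0 \<le> norm u * norm v"
        by simp
      thus ?thesis
        using sum_squares_bound[of "norm u" "norm v"] by linarith
    qed
    finally show ?thesis .
  qed
  hence "(\<Sum>i\<in>UNIV. norm (u $ i * cnj (v $ i))) \<le> (\<Sum>i\<in>(UNIV::'n set). (norm u)\<^sup>2 + (norm v)\<^sup>2)"
    by (intro sum_mono) auto
  thus ?thesis
    unfolding cdot_def by (intro order_trans[OF norm_sum]) simp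
qed

lemma borel_measurable_scale_vec [measurable]: "(\<lambda>u. c *s u) \<in> borel_measurable borel"
  for c :: complex
proof (rule borel_measurable_continuous_onI)
  have "continuous_on UNIV (\<lambda>u::complex ^ 'n. \<chi> i. c * u $ i)"
    by (intro continuous_intros)
  thus "continuous_on UNIV (\<lambda>u::complex ^ 'n. c *s u)"
    by (simp add: vector_scalar_mult_def)
qed

lemma borel_measurable_cdot [measurable (raw)]:
  fixes f g :: "'a \<Rightarrow> complex ^ 'n"
  assumes f: "f \<in> borel_measurable M" and g: "g \<in> borel_measurable M"
  shows "(\<lambda>x. cdot (f x) (g x)) \<in> borel_measurable M"
proof -
  have nth: "(\<lambda>u::complex ^ 'n. u $ i) \<in> borel_measurable borel" for i
    by (intro borel_measurable_continuous_onI continuous_intros)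
  have cnj: "cnj \<in> borel_measurable borel"
    by (intro borel_measurable_continuous_onI continuous_intros)
  have "(\<lambda>x. f x $ i) \<in> borel_measurable M" "(\<lambda>x. cnj (g x $ i)) \<in> borel_measurable M" for i
    using measurable_compose[OF f nth] measurable_compose[OF measurable_compose[OF g nth] cnj] by auto
  thus ?thesis
    unfolding cdot_def by (intro borel_measurable_sum borel_measurable_times)
qed

lemma square_integrable_0 [simp]: "square_integrable S (\<lambda>_. 0)"
  by (simp add: square_integrable_def set_borel_measurable_def set_integrable_def)

lemma norm_scale_vec: "norm (c *s u) = norm c * norm u" for c :: complex
  by (simp add: norm_vec_def norm_mult L2_set_right_distrib)

lemma square_integrable_scale:
  assumes "square_integrable S f"
  shows "square_integrable S (\<lambda>t. c *s f t)"
proof -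
  have eq: "indicator S t *\<^sub>R (c *s f t) = c *s (indicator S t *\<^sub>R f t)" for t
    by (simp add: vec_eq_iff)
  have [measurable]: "(\<lambda>t. indicator S t *\<^sub>R f t) \<in> borel_measurable lborel"
    using assms by (simp add: square_integrable_def set_borel_measurable_def)
  have "(\<lambda>t. indicator S t *\<^sub>R (c *s f t)) \<in> borel_measurable lborel"
    unfolding eq by measurable
  moreover have "set_integrable lborel S (\<lambda>t. (norm (c *s f t))\<^sup>2)"
    using assms by (simp add: square_integrable_def norm_scale_vec power_mult_distrib)
  ultimately show ?thesis
    by (simp add: square_integrable_def set_borel_measurable_def)
qed

lemma square_integrable_scaleR:
  assumes "square_integrable S f"
  shows "square_integrable S (\<lambda>t. r *\<^sub>R f t)"
proof -
  have "(\<lambda>t. r *\<^sub>R f t) = (\<lambda>t. complex_of_real r *s f t)"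
    by (simp add: vec_eq_iff fun_eq_iff scaleR_conv_of_real[where 'a = complex])
  thus ?thesis
    using square_integrable_scale[OF assms] by simp
qed

lemma square_integrable_add:
  fixes f g :: "real \<Rightarrow> complex ^ 'n"
  assumes "square_integrable S f" "square_integrable S g"
  shows "square_integrable S (\<lambda>t. f t + g t)"
proof -
  have [measurable]: "(\<lambda>t. indicator S t *\<^sub>R f t) \<in> borel_measurable lborel"
      "(\<lambda>t. indicator S t *\<^sub>R g t) \<in> borel_measurable lborel"
    using assms by (simp_all add: square_integrable_def set_borel_measurable_def)
  have m [measurable]: "(\<lambda>t. indicator S t *\<^sub>R (f t + g t)) \<in> borel_measurable lborel"
    unfolding scaleR_add_right by measurable
  have sq: "indicator S t *\<^sub>R (norm u)\<^sup>2 = (norm (indicator S t *\<^sub>R u))\<^sup>2"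
    for u :: "complex ^ 'n" and t
    by (auto simp: indicator_def)
  have "integrable lborel (\<lambda>t. 2 * (indicator S t *\<^sub>R (norm (f t))\<^sup>2 + indicator S t *\<^sub>R (norm (g t))\<^sup>2))"
    using assms unfolding square_integrable_def set_integrable_def
    by (intro integrable_mult_right Bochner_Integration.integrable_add) auto
  hence "integrable lborel (\<lambda>t. indicator S t *\<^sub>R (norm (f t + g t))\<^sup>2)"
  proof (rule Bochner_Integration.integrable_bound)
    show "(\<lambda>t. indicator S t *\<^sub>R (norm (f t + g t))\<^sup>2) \<in> borel_measurable lborel"
      unfolding sq by (intro borel_measurable_power measurable_compose[OF m]) simp
    have "(norm (u + v))\<^sup>2 \<le> 2 * ((norm u)\<^sup>2 + (norm v)\<^sup>2)" for u v :: "complex ^ 'n"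
    proof -
      have "(norm (u + v))\<^sup>2 \<le> (norm u + norm v)\<^sup>2"
        by (intro power_mono norm_triangle_ineq) auto
      also have "\<dots> \<le> 2 * ((norm u)\<^sup>2 + (norm v)\<^sup>2)"
        using sum_squares_bound[of "norm u" "norm v"] by (simp add: power2_sum)
      finally show ?thesis .
    qed
    thus "AE t in lborel. norm (indicator S t *\<^sub>R (norm (f t + g t))\<^sup>2)
        \<le> norm (2 * (indicator S t *\<^sub>R (norm (f t))\<^sup>2 + indicator S t *\<^sub>R (norm (g t))\<^sup>2))"
      by (intro AE_I2) (auto simp: indicator_def)
  qed
  thus ?thesis
    using m by (simp add: square_integrable_def set_borel_measurable_def set_integrable_def)
qed

lemma square_integrable_uminus:
  assumes "square_integrable S f"
  shows "square_integrable S (\<lambda>t. - f t)"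
  using square_integrable_scaleR[OF assms, of "-1"] by simp

lemma square_integrable_diff:
  assumes "square_integrable S f" "square_integrable S g"
  shows "square_integrable S (\<lambda>t. f t - g t)"
  using square_integrable_add[OF assms(1) square_integrable_uminus[OF assms(2)]] by simp

lemma set_integrable_cdot:
  assumes "square_integrable S f" "square_integrable S g"
  shows "set_integrable lborel S (\<lambda>t. cdot (f t) (g t))"
proof -
  have [measurable]: "(\<lambda>t. indicator S t *\<^sub>R f t) \<in> borel_measurable lborel"
      "(\<lambda>t. indicator S t *\<^sub>R g t) \<in> borel_measurable lborel"
    using assms by (simp_all add: square_integrable_def set_borel_measurable_def)
  have eq: "indicator S t *\<^sub>R cdot (f t) (g t) = cdot (indicator S t *\<^sub>R f t) (indicator S t *\<^sub>R g t)" for t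
    by (auto simp: indicator_def cdot_def)
  have "integrable lborel (\<lambda>t. real CARD('a) *
      (indicator S t *\<^sub>R (norm (f t))\<^sup>2 + indicator S t *\<^sub>R (norm (g t))\<^sup>2))"
    using assms unfolding square_integrable_def set_integrable_def
    by (intro integrable_mult_right Bochner_Integration.integrable_add) auto
  hence "integrable lborel (\<lambda>t. indicator S t *\<^sub>R cdot (f t) (g t))"
  proof (rule Bochner_Integration.integrable_bound)
    show "(\<lambda>t. indicator S t *\<^sub>R cdot (f t) (g t)) \<in> borel_measurable lborel"
      unfolding eq by measurable
    show "AE t in lborel. norm (indicator S t *\<^sub>R cdot (f t) (g t)) \<le> norm (real CARD('a) *
        (indicator S t *\<^sub>R (norm (f t))\<^sup>2 + indicator S t *\<^sub>R (norm (g t))\<^sup>2))"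
      using norm_cdot_le[where 'n = 'a] by (intro AE_I2) (auto simp: indicator_def)
  qed
  thus ?thesis
    by (simp add: set_integrable_def)
qed

definition L2_eq :: "(real \<Rightarrow> complex ^ 'n) \<Rightarrow> (real \<Rightarrow> complex ^ 'n) \<Rightarrow> bool"
  where "L2_eq f g \<longleftrightarrow> square_integrable {0<..} f \<and> square_integrable {0<..} g \<and>
    (AE t in lborel. t \<in> {0<..} \<longrightarrow> f t = g t)"

lemma part_equivp_L2_eq: "part_equivp L2_eq"
proof (rule part_equivpI)
  have "L2_eq (\<lambda>_. 0) (\<lambda>_. 0)"
    by (simp add: L2_eq_def)
  thus "\<exists>f. L2_eq f f"
    by blast
  show "symp L2_eq"
    by (auto simp: symp_def L2_eq_def)
  show "transp L2_eq"
    by (auto simp: transp_def L2_eq_def)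
qed

quotient_type (overloaded) 'n L2 = "real \<Rightarrow> complex ^ 'n" / partial: L2_eq
  morphisms L2_rep L2_class
  by (rule part_equivp_L2_eq)

lift_definition cinner_L2 :: "'n::finite L2 \<Rightarrow> 'n L2 \<Rightarrow> complex"
  is "\<lambda>f g. LINT t:{0<..}|lborel. cdot (f t) (g t)"
proof -
  fix f f' g g' :: "real \<Rightarrow> complex ^ 'n"
  assume f: "L2_eq f f'" and g: "L2_eq g g'"
  have "AE t in lborel. t \<in> {0<..} \<longrightarrow> f t = f' t" "AE t in lborel. t \<in> {0<..} \<longrightarrow> g t = g' t"
    using f g by (simp_all add: L2_eq_def)
  hence "AE t in lborel. indicator {0<..} t *\<^sub>R cdot (f t) (g t) =
      indicator {0<..} t *\<^sub>R cdot (f' t) (g' t)"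
    by eventually_elim (auto simp: indicator_def)
  moreover have "set_integrable lborel {0<..} (\<lambda>t. cdot (f t) (g t))"
    "set_integrable lborel {0<..} (\<lambda>t. cdot (f' t) (g' t))"
    using f g by (auto intro!: set_integrable_cdot simp: L2_eq_def)
  ultimately show "(LINT t:{0<..}|lborel. cdot (f t) (g t)) = (LINT t:{0<..}|lborel. cdot (f' t) (g' t))"
    unfolding set_lebesgue_integral_def set_integrable_def
    by (intro integral_cong_AE) auto
qed

lift_definition cscale_L2 :: "complex \<Rightarrow> 'n::finite L2 \<Rightarrow> 'n L2"
  is "\<lambda>c f t. c *s f t"
  by (auto simp: L2_eq_def intro: square_integrable_scale)

instantiation L2 :: (finite) real_vector
begin

lift_definition zero_L2 :: "'a L2" is "\<lambda>_. 0"
  by (simp add: L2_eq_def)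

lift_definition plus_L2 :: "'a L2 \<Rightarrow> 'a L2 \<Rightarrow> 'a L2" is "\<lambda>f g t. f t + g t"
  by (auto simp: L2_eq_def intro: square_integrable_add elim: eventually_elim2)

lift_definition scaleR_L2 :: "real \<Rightarrow> 'a L2 \<Rightarrow> 'a L2" is "\<lambda>r f t. r *\<^sub>R f t"
  by (auto simp: L2_eq_def intro: square_integrable_scaleR)

lift_definition uminus_L2 :: "'a L2 \<Rightarrow> 'a L2" is "\<lambda>f t. - f t"
  by (auto simp: L2_eq_def intro: square_integrable_uminus)

lift_definition minus_L2 :: "'a L2 \<Rightarrow> 'a L2 \<Rightarrow> 'a L2" is "\<lambda>f g t. f t - g t"
  by (auto simp: L2_eq_def intro: square_integrable_diff elim: eventually_elim2)

instance
proof
  fix F G H :: "'a L2" and r s :: real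
  show "F + G + H = F + (G + H)"
    by transfer (auto simp: L2_eq_def add.assoc intro!: square_integrable_add)
  show "F + G = G + F"
    by transfer (auto simp: L2_eq_def add.commute intro!: square_integrable_add)
  show "0 + F = F"
    by transfer (auto simp: L2_eq_def)
  show "- F + F = 0"
    by transfer (auto simp: L2_eq_def intro!: square_integrable_add square_integrable_uminus)
  show "F - G = F + - G"
    by transfer (auto simp: L2_eq_def intro!: square_integrable_diff square_integrable_add
        square_integrable_uminus)
  show "r *\<^sub>R (F + G) = r *\<^sub>R F + r *\<^sub>R G"
    by transfer (auto simp: L2_eq_def algebra_simps
        intro!: square_integrable_add square_integrable_scaleR)
  show "(r + s) *\<^sub>R F = r *\<^sub>R F + s *\<^sub>R F"
    by transfer (auto simp: L2_eq_def algebra_simps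
        intro!: square_integrable_add square_integrable_scaleR)
  show "r *\<^sub>R s *\<^sub>R F = (r * s) *\<^sub>R F"
    by transfer (auto simp: L2_eq_def intro!: square_integrable_scaleR)
  show "1 *\<^sub>R F = F"
    by transfer (auto simp: L2_eq_def)
qed

end

instantiation L2 :: (finite) real_inner
begin

definition inner_L2 :: "'a L2 \<Rightarrow> 'a L2 \<Rightarrow> real"
  where "inner_L2 F G = Re (cinner_L2 F G)"

definition norm_L2 :: "'a L2 \<Rightarrow> real"
  where "norm_L2 F = sqrt (inner F F)"

definition sgn_L2 :: "'a L2 \<Rightarrow> 'a L2"
  where "sgn_L2 F = F /\<^sub>R norm F"

definition dist_L2 :: "'a L2 \<Rightarrow> 'a L2 \<Rightarrow> real"
  where "dist_L2 F G = norm (F - G)"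

definition uniformity_L2 :: "('a L2 \<times> 'a L2) filter"
  where "uniformity_L2 = (INF e\<in>{0<..}. principal {(F, G). dist F G < e})"

definition open_L2 :: "'a L2 set \<Rightarrow> bool"
  where "open_L2 U \<longleftrightarrow> (\<forall>F\<in>U. eventually (\<lambda>(F', G). F' = F \<longrightarrow> G \<in> U) uniformity)"

instance
proof
  fix F G :: "'a L2"
  show "dist F G = norm (F - G)"
    by (simp add: dist_L2_def)
  show "sgn F = F /\<^sub>R norm F"
    by (simp add: sgn_L2_def)
  show "(uniformity :: ('a L2 \<times> 'a L2) filter) = (INF e\<in>{0<..}. principal {(F, G). dist F G < e})"
    by (simp add: uniformity_L2_def)
  show "norm F = sqrt (inner F F)"
    by (simp add: norm_L2_def)
next
  fix U :: "'a L2 set"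
  show "open U \<longleftrightarrow> (\<forall>F\<in>U. eventually (\<lambda>(F', G). F' = F \<longrightarrow> G \<in> U) uniformity)"
    by (simp add: open_L2_def)
next
  fix F G H :: "'a L2" and r :: real
  have Re_int: "Re (LINT t:{0<..}|lborel. cdot (f t) (g t)) = (LINT t:{0<..}|lborel. inner (f t) (g t))"
    if "square_integrable {0<..} f" "square_integrable {0<..} g" for f g :: "real \<Rightarrow> complex ^ 'a"
  proof -
    have "integrable lborel (\<lambda>t. indicator {0<..} t *\<^sub>R cdot (f t) (g t))"
      using set_integrable_cdot[OF that] by (simp add: set_integrable_def)
    from integral_Re[OF this] show ?thesis
      by (simp add: set_lebesgue_integral_def Re_cdot)
  qed
  show "inner F G = inner G F"
    unfolding inner_L2_def by transfer (simp add: Re_int L2_eq_def inner_commute)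
  show "inner (F + G) H = inner F H + inner G H"
    unfolding inner_L2_def plus_complex.sel(1)[symmetric]
    by transfer (simp add: L2_eq_def cdot_add_left set_integral_add(2) set_integrable_cdot)
  show "inner (r *\<^sub>R F) G = r * inner F G"
  proof -
    have "cinner_L2 (r *\<^sub>R F) G = r *\<^sub>R cinner_L2 F G"
      by transfer (simp add: cdot_scaleR_left set_lebesgue_integral_def scaleR_left_commute)
    thus ?thesis
      by (simp add: inner_L2_def)
  qed
  show "0 \<le> inner F F"
    unfolding inner_L2_def
    by transfer (simp add: Re_int L2_eq_def, simp add: set_lebesgue_integral_def)
  show "inner F F = 0 \<longleftrightarrow> F = 0"
    unfolding inner_L2_def
  proof transfer
    fix f :: "real \<Rightarrow> complex ^ 'a"
    assume "L2_eq f f"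
    hence f: "square_integrable {0<..} f"
      by (simp add: L2_eq_def)
    have eq: "Re (LINT t:{0<..}|lborel. cdot (f t) (f t)) =
        (LINT t|lborel. indicator {0<..} t *\<^sub>R (norm (f t))\<^sup>2)"
      by (subst Re_int[OF f f]) (simp add: set_lebesgue_integral_def dot_square_norm)
    have "integrable lborel (\<lambda>t. indicator {0<..} t *\<^sub>R (norm (f t))\<^sup>2)"
      using f by (simp add: square_integrable_def set_integrable_def)
    hence "(LINT t|lborel. indicator {0<..} t *\<^sub>R (norm (f t))\<^sup>2) = 0 \<longleftrightarrow>
        (AE t in lborel. indicator {0<..} t *\<^sub>R (norm (f t))\<^sup>2 = 0)"
      by (intro integral_nonneg_eq_0_iff_AE) auto
    also have "\<dots> \<longleftrightarrow> (AE t in lborel. t \<in> {0<..} \<longrightarrow> f t = 0)"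
      by (intro AE_cong) (auto simp: indicator_def)
    finally show "Re (LINT t:{0<..}|lborel. cdot (f t) (f t)) = 0 \<longleftrightarrow> L2_eq f (\<lambda>_. 0)"
      using f by (simp add: eq L2_eq_def)
  qed
qed

end

global_interpretation complex_L2: vector_space "cscale_L2 :: complex \<Rightarrow> 'n::finite L2 \<Rightarrow> 'n L2"
  defines cspan_L2 = complex_L2.span and cdim_L2 = complex_L2.dim
proof
  fix a b :: complex and F G :: "'n L2"
  show "cscale_L2 a (F + G) = cscale_L2 a F + cscale_L2 a G"
    by transfer (auto simp: L2_eq_def vector_add_ldistrib
        intro!: square_integrable_add square_integrable_scale)
  show "cscale_L2 (a + b) F = cscale_L2 a F + cscale_L2 b F"
    by transfer (auto simp: L2_eq_def vector_sadd_rdistrib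
        intro!: square_integrable_add square_integrable_scale)
  show "cscale_L2 a (cscale_L2 b F) = cscale_L2 (a * b) F"
    by transfer (auto simp: L2_eq_def intro!: square_integrable_scale)
  show "cscale_L2 1 F = F"
    by transfer (auto simp: L2_eq_def)
qed

section \<open>Operators, adjoints and deficiency indices\<close>

text \<open>
  Unbounded operators are identified with their graphs, so the closure of an operator is the
  topological closure of its graph.  The adjoint is taken as a linear relation; it is the graph
  of an operator exactly when the given operator is densely defined.
\<close>

definition adjoint_graph :: "('n::finite L2 \<times> 'n L2) set \<Rightarrow> ('n L2 \<times> 'n L2) set"
  where "adjoint_graph T = {(G, H). \<forall>(F, TF)\<in>T. cinner_L2 TF G = cinner_L2 F H}"

text \<open>The library dimension \<^const>\<open>cdim_L2\<close> is \<open>0\<close> on infinite-dimensional spaces.\<close>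

definition cdimension :: "'n::finite L2 set \<Rightarrow> enat"
  where "cdimension V =
    (if \<exists>B. finite B \<and> cspan_L2 B = cspan_L2 V then enat (cdim_L2 V) else \<infinity>)"

definition deficiency_plus :: "('n::finite L2 \<times> 'n L2) set \<Rightarrow> enat"
  where "deficiency_plus T = cdimension {G. (G, cscale_L2 \<i> G) \<in> adjoint_graph T}"

definition deficiency_minus :: "('n::finite L2 \<times> 'n L2) set \<Rightarrow> enat"
  where "deficiency_minus T = cdimension {G. (G, cscale_L2 (- \<i>) G) \<in> adjoint_graph T}"

section \<open>The Schroedinger operator with matrix point interactions\<close>

text \<open>Local absolute continuity of \<open>f\<close> on the interval \<open>S\<close> with \<open>f' = g\<close> almost everywhere.\<close>

definition ac_deriv_on :: "real set \<Rightarrow> (real \<Rightarrow> complex ^ 'n) \<Rightarrow> (real \<Rightarrow> complex ^ 'n) \<Rightarrow> bool"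
  where "ac_deriv_on S f g \<longleftrightarrow>
    (\<forall>s\<in>S. \<forall>t\<in>S. s \<le> t \<longrightarrow> set_integrable lborel {s..t} g \<and> f t - f s = (LINT u:{s..t}|lborel. g u))"

text \<open>
  \<open>f \<in> W\<^bsup>2,2\<^esup>([a,b])\<close> with \<open>f' = f1\<close> and \<open>f'' = f2\<close>.  Only the open interval is referred to: square
  integrability of \<open>f2\<close> yields one-sided limits of \<open>f\<close> and \<open>f1\<close> at both end points, and these are the
  boundary values of \<open>f\<close> and \<open>f'\<close>.
\<close>

definition W22_on ::
    "real \<Rightarrow> real \<Rightarrow> (real \<Rightarrow> complex ^ 'n) \<Rightarrow> (real \<Rightarrow> complex ^ 'n) \<Rightarrow> (real \<Rightarrow> complex ^ 'n) \<Rightarrow> bool"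
  where "W22_on a b f f1 f2 \<longleftrightarrow>
    ac_deriv_on {a<..<b} f f1 \<and> ac_deriv_on {a<..<b} f1 f2 \<and>
    square_integrable {a<..<b} f \<and> square_integrable {a<..<b} f1 \<and> square_integrable {a<..<b} f2"

definition jump_condition ::
    "complex ^ 'n ^ 'n \<Rightarrow> real \<Rightarrow> (real \<Rightarrow> complex ^ 'n) \<Rightarrow> (real \<Rightarrow> complex ^ 'n) \<Rightarrow> bool"
  where "jump_condition A c f f1 \<longleftrightarrow>
    (f \<longlongrightarrow> f c) (at_left c) \<and> (f \<longlongrightarrow> f c) (at_right c) \<and>
    (\<exists>l r. (f1 \<longlongrightarrow> l) (at_left c) \<and> (f1 \<longlongrightarrow> r) (at_right c) \<and> r - l = A *v f c)"

definition H_domain ::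
    "(nat \<Rightarrow> real) \<Rightarrow> (nat \<Rightarrow> complex ^ 'n ^ 'n) \<Rightarrow>
     (real \<Rightarrow> complex ^ 'n) \<Rightarrow> (real \<Rightarrow> complex ^ 'n) \<Rightarrow> (real \<Rightarrow> complex ^ 'n) \<Rightarrow> bool"
  where "H_domain x \<Lambda> f f1 f2 \<longleftrightarrow>
    (\<exists>R. \<forall>t>R. f t = 0) \<and>
    (\<forall>k\<ge>1. W22_on (x (k - 1)) (x k) f f1 f2) \<and>
    (f1 \<longlongrightarrow> 0) (at_right 0) \<and>
    (\<forall>k\<ge>1. jump_condition (\<Lambda> k) (x k) f f1)"

text \<open>
  Square integrability of \<open>f\<close> and \<open>f2\<close> on the half-line already follows from \<^const>\<open>H_domain\<close>
  when \<open>x\<close> increases from \<open>0\<close> to infinity; it is stated so that the two classes are visibly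
  meaningful.
\<close>

definition H_minimal :: "(nat \<Rightarrow> real) \<Rightarrow> (nat \<Rightarrow> complex ^ 'n ^ 'n) \<Rightarrow> ('n::finite L2 \<times> 'n L2) set"
  where "H_minimal x \<Lambda> = {(L2_class f, L2_class (\<lambda>t. - f2 t)) | f f1 f2.
    H_domain x \<Lambda> f f1 f2 \<and> square_integrable {0<..} f \<and> square_integrable {0<..} f2}"

definition H_operator :: "(nat \<Rightarrow> real) \<Rightarrow> (nat \<Rightarrow> complex ^ 'n ^ 'n) \<Rightarrow> ('n::finite L2 \<times> 'n L2) set"
  where "H_operator x \<Lambda> = closure (H_minimal x \<Lambda>)"

section \<open>Matrices\<close>

text \<open>Euclidean operator norm: \<^const>\<open>norm\<close> on matrices is the Hilbert--Schmidt norm instead.\<close>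

definition opnorm :: "complex ^ 'n ^ 'm \<Rightarrow> real"
  where "opnorm A = onorm ((*v) A)"

definition hermitian :: "complex ^ 'n ^ 'n \<Rightarrow> bool"
  where "hermitian A \<longleftrightarrow> map_matrix cnj (transpose A) = A"

definition block11 :: "complex ^ ('a::finite + 'b::finite) ^ ('a + 'b) \<Rightarrow> complex ^ 'a ^ 'a"
  where "block11 A = (\<chi> i j. A $ Inl i $ Inl j)"

definition block12 :: "complex ^ ('a::finite + 'b::finite) ^ ('a + 'b) \<Rightarrow> complex ^ 'b ^ 'a"
  where "block12 A = (\<chi> i j. A $ Inl i $ Inr j)"

definition block22 :: "complex ^ ('a::finite + 'b::finite) ^ ('a + 'b) \<Rightarrow> complex ^ 'b ^ 'b"
  where "block22 A = (\<chi> i j. A $ Inr i $ Inr j)"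

definition diag_real :: "('n \<Rightarrow> real) \<Rightarrow> complex ^ 'n ^ 'n"
  where "diag_real a = (\<chi> i j. if i = j then complex_of_real (a i) else 0)"

end

theory Submission
  imports Defs
begin

text \<open>
  The deficiency space for \<open>z = \<plusminus>\<i>\<close> consists of the square integrable solutions \<open>u\<close> of \<open>- u'' = z u\<close> with
  \<open>u' (0) = 0\<close> and the prescribed jumps; such a \<open>u\<close> is determined by \<open>u (0)\<close>, so one has to compute the
  dimension of the space \<open>D\<close> of admissible initial values.  Green's formula equates
  \<open>2 \<integral>\<^bsub>0\<^esub>\<^bsup>x N\<^esup> \<bar>u\<bar>\<^sup>2\<close> with the modulus of the boundary form of \<open>u\<close> at \<open>x N\<close>, which is a sum over the components.

  Upper bound.  On \<open>D\<close> the contribution of each lower component to the boundary form tends to \<open>0\<close>: the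
  limit exists because the couplings are \<open>O(d)\<close>, and it vanishes because either alternative on \<open>\<alpha>\<close> puts
  the scalar problem in the limit point case.  Hence for large \<open>N\<close> the upper block of \<open>u (x N)\<close>
  determines \<open>u \<in> D\<close>.

  Lower bound.  For every \<open>N\<close> the solutions whose lower block vanishes at \<open>x N\<close> form a space of dimension
  at least \<open>p\<^sub>1\<close>, and for them the boundary form involves only the upper block, whose growth is
  that of the recursion \<open>v (k+1) / d (k+1) = - v (k-1) / d k\<close> up to a small multiple of the energy.  So
  their energy on \<open>[0, x N]\<close> is bounded independently of \<open>N\<close>, and a limit of such solutions lies in \<open>D\<close>.
\<close>

text \<open>Every comparison of the differential equation with a difference equation is paid for by
  the energy. On an interval of length \<open>\<delta>\<close> with energy \<open>m\<close>,
  one-sided derivatives differ from the difference quotient by at most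
  \<open>sqrt (\<delta> * m)\<close>, and boundary values \<open>u\<close> satisfy
  \<open>\<delta> * |u|^2 \<le> K * m\<close>. For solutions in \<open>D\<close> all error terms are
  therefore square summable with weight \<open>1 / \<delta>\<close>.

  Log-convexity enters twice. It makes consecutive ratios of \<open>\<delta>\<close> increase, so
  that they are bounded below by the first one, and it makes the free solutions of the upper
  recursion of order \<open>sqrt \<delta>\<close>.

  The adjoint is known only through testing against the domain, so its eigenvectors come without any
  regularity. Duality replaces a regularity theory: a continuous function on
  \<open>(0, x_(N+1))\<close> orthogonal to all solutions is \<open>- f'' - cnj z f\<close> for some
  \<open>f\<close> in the domain.\<close>

lemma summable_cmult_bound:
  fixes f g :: "nat \<Rightarrow> real"
  assumes "summable g" "\<And>k. \<bar>f k\<bar> \<le> C * g k"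
  shows "summable f"
  by (rule summable_comparison_test'[where g = "\<lambda>k. C * g k" and N = 0])
    (use assms in \<open>auto intro: summable_mult\<close>)

lemma mult_le_half_squares: "a * b \<le> (a\<^sup>2 + b\<^sup>2) / 2" for a b :: real
  using sum_squares_bound[of a b] by simp

section \<open>Scalar Jacobi recursions: criteria for the Wronskian to vanish at infinity\<close>

locale mesh =
  fixes \<delta> :: "nat \<Rightarrow> real" and \<rho> :: real
  assumes pos: "\<And>k. 0 < \<delta> k"
    and decr: "\<And>k. \<delta> (Suc k) \<le> \<delta> k"
    and ratio_pos: "0 < \<rho>"
    and ratio: "\<And>k. \<rho> * \<delta> k \<le> \<delta> (Suc k)"
    and not_summable: "\<not> summable \<delta>"
    and square_summable: "summable (\<lambda>k. (\<delta> k)\<^sup>2)"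
begin

lemma nonneg [simp]: "0 \<le> \<delta> k" "\<delta> k \<noteq> 0"
  using pos[of k] by auto

lemma le_first: "\<delta> k \<le> \<delta> 0"
  by (induction k) (auto intro: order_trans[OF decr])

text \<open>\<open>A\<close> is the diagonal of the Jacobi matrix. Multiplying the Wronskian by it
  and inserting both recursions cancels the products at \<open>k+2\<close>; what remains is summable
  after multiplication by \<open>(\<delta> k)^2\<close>. With a nonzero limit the Wronskian can be
  divided out, so \<open>|A k| * (\<delta> k)^2 * \<delta> (k+1)\<close> is summable. Since
  \<open>\<alpha>\<close> differs from \<open>A\<close> by \<open>O(1 / \<delta>)\<close>, passing
  to \<open>\<alpha>\<close> costs only a multiple of the summable
  \<open>(\<delta> k)^2\<close>.\<close>

lemma jacobi_wronskian_limit_zero_large_diagonal: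
  fixes a b e e' :: "nat \<Rightarrow> complex" and \<alpha> :: "nat \<Rightarrow> real"
  assumes eqa: "\<And>k. (a (k+2) - a (k+1)) / \<delta> (k+1) - (a (k+1) - a k) / \<delta> k = \<alpha> k * a (k+1) + e k"
    and eqb: "\<And>k. (b (k+2) - b (k+1)) / \<delta> (k+1) - (b (k+1) - b k) / \<delta> k = \<alpha> k * b (k+1) + e' k"
    and suma: "summable (\<lambda>k. \<delta> k * (norm (a k))\<^sup>2)"
    and sumb: "summable (\<lambda>k. \<delta> k * (norm (b k))\<^sup>2)"
    and sume: "summable (\<lambda>k. (norm (e k))\<^sup>2 / \<delta> k)"
    and sume': "summable (\<lambda>k. (norm (e' k))\<^sup>2 / \<delta> k)"
    and lim: "(\<lambda>k. (a (k+1) * b k - a k * b (k+1)) / \<delta> k) \<longlonglongrightarrow> l"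
    and large: "\<not> summable (\<lambda>k. \<bar>\<alpha> k\<bar> * \<delta> k ^ 3)"
  shows "l = 0"
proof (rule ccontr)
  assume "l \<noteq> 0"
  define A where "A k = \<alpha> k + 1 / \<delta> k + 1 / \<delta> (k+1)" for k
  define W where "W k = (a (k+1) * b k - a k * b (k+1)) / \<delta> k" for k
  have eqa': "A k * a (k+1) = a (k+2) / \<delta> (k+1) + a k / \<delta> k - e k" for k
    using eqa[of k] unfolding A_def by (simp add: diff_divide_distrib algebra_simps)
  have eqb': "A k * b (k+1) = b (k+2) / \<delta> (k+1) + b k / \<delta> k - e' k" for k
    using eqb[of k] unfolding A_def by (simp add: diff_divide_distrib algebra_simps)
  have AW: "A k * (\<delta> (k+1) * W (k+1)) =
      (a (k+2) * b k - a k * b (k+2)) / \<delta> k - a (k+2) * e' k + b (k+2) * e k" for k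
  proof -
    have "\<delta> (k+1) * W (k+1) = a (k+2) * b (k+1) - a (k+1) * b (k+2)"
      by (simp add: W_def)
    hence "A k * (\<delta> (k+1) * W (k+1)) = a (k+2) * (A k * b (k+1)) - b (k+2) * (A k * a (k+1))"
      by (simp only:) (simp add: algebra_simps)
    also have "\<dots> = (a (k+2) * b k - a k * b (k+2)) / \<delta> k - a (k+2) * e' k + b (k+2) * e k"
      unfolding eqa' eqb' by (simp add: algebra_simps diff_divide_distrib)
    finally show ?thesis .
  qed
  define g where "g k = \<delta> (k+2) * (norm (a (k+2)))\<^sup>2 + \<delta> (k+2) * (norm (b (k+2)))\<^sup>2
    + \<delta> k * (norm (a k))\<^sup>2 + \<delta> k * (norm (b k))\<^sup>2 + (norm (e k))\<^sup>2 / \<delta> k + (norm (e' k))\<^sup>2 / \<delta> k" for k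
  have "summable g"
    unfolding g_def
    using summable_ignore_initial_segment[OF suma, of 2] summable_ignore_initial_segment[OF sumb, of 2]
    by (intro summable_add suma sumb sume sume') auto
  \<comment> \<open>The values at \<open>k+2\<close> appear below with weight
    \<open>\<delta> k\<close> but are known to be summable with weight
    \<open>\<delta> (k+2)\<close>.\<close>
  have r2: "\<delta> k \<le> \<delta> (k+2) / \<rho>\<^sup>2" for k
  proof -
    have "\<rho>\<^sup>2 * \<delta> k \<le> \<rho> * \<delta> (k+1)"
      using ratio[of k] ratio_pos by (simp add: power2_eq_square mult.assoc)
    also have "\<dots> \<le> \<delta> (k+2)" using ratio[of "k+1"] by simp
    finally show ?thesis using ratio_pos by (simp add: field_simps)
  qed
  define C where "C = (1 + (\<delta> 0)\<^sup>2) * (1 + 1 / \<rho>\<^sup>2)"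
  have C: "\<bar>A k\<bar> * (\<delta> k)\<^sup>2 * \<delta> (k+1) * norm (W (k+1)) \<le> C * g k" for k
  proof -
    let ?a2 = "norm (a (k+2))" and ?b2 = "norm (b (k+2))" and ?a = "norm (a k)" and ?b = "norm (b k)"
    let ?e = "norm (e k)" and ?e' = "norm (e' k)" and ?D = "\<delta> k"
    have "\<bar>A k\<bar> * \<delta> (k+1) * norm (W (k+1)) = norm (A k * (\<delta> (k+1) * W (k+1)))"
      using nonneg(1)[of "k+1"] by (simp add: norm_mult)
    also have "\<dots> \<le> (?a2 * ?b + ?a * ?b2) / ?D + ?a2 * ?e' + ?b2 * ?e"
    proof -
      have "norm ((a (k+2) * b k - a k * b (k+2)) / \<delta> k) \<le> (?a2 * ?b + ?a * ?b2) / ?D"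
        using norm_triangle_ineq4[of "a (k+2) * b k" "a k * b (k+2)"]
        by (simp add: norm_divide norm_mult divide_right_mono)
      thus ?thesis
        unfolding AW using norm_triangle_ineq[of "(a (k+2) * b k - a k * b (k+2)) / \<delta> k - a (k+2) * e' k" "b (k+2) * e k"]
          norm_triangle_ineq4[of "(a (k+2) * b k - a k * b (k+2)) / \<delta> k" "a (k+2) * e' k"]
        by (simp add: norm_mult)
    qed
    \<comment> \<open>The factor \<open>?D^2\<close> turns the quotient by \<open>\<delta> k\<close>
      in \<open>AW\<close> into the weight \<open>\<delta> k\<close> of the summability
      hypotheses.\<close>
    finally have "?D\<^sup>2 * (\<bar>A k\<bar> * \<delta> (k+1) * norm (W (k+1))) \<le>
      ?D\<^sup>2 * ((?a2 * ?b + ?a * ?b2) / ?D + ?a2 * ?e' + ?b2 * ?e)"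
      by (intro mult_left_mono) auto
    also have "\<dots> = ?D * (?a2 * ?b) + ?D * (?a * ?b2) + ?D\<^sup>2 * (?a2 * ?e') + ?D\<^sup>2 * (?b2 * ?e)"
      by (simp add: field_simps power2_eq_square)
    also have "\<dots> \<le> ?D * ((?a2\<^sup>2 + ?b\<^sup>2)/2) + ?D * ((?a\<^sup>2 + ?b2\<^sup>2)/2)
       + ?D\<^sup>2 * ((?D * ?a2\<^sup>2 + ?e'\<^sup>2 / ?D) / 2) + ?D\<^sup>2 * ((?D * ?b2\<^sup>2 + ?e\<^sup>2 / ?D) / 2)"
    proof -
      have *: "x * y \<le> (?D * x\<^sup>2 + y\<^sup>2 / ?D) / 2" for x y
      proof -
        have "(sqrt ?D * x) * (y / sqrt ?D) \<le> ((sqrt ?D * x)\<^sup>2 + (y / sqrt ?D)\<^sup>2) / 2"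
          by (rule mult_le_half_squares)
        thus ?thesis by (simp add: power_mult_distrib power_divide)
      qed
      show ?thesis
        by (intro add_mono mult_left_mono mult_le_half_squares * ) auto
    qed
    also have "\<dots> \<le> (1 + ?D\<^sup>2) * (?D * ?a2\<^sup>2 + ?D * ?b2\<^sup>2 + ?D * ?a\<^sup>2 + ?D * ?b\<^sup>2 + ?e\<^sup>2 / ?D + ?e'\<^sup>2 / ?D)"
    proof -
      have *: "(s + t) / 2 + (u + v) / 2 + ?D\<^sup>2 * ((s + w') / 2) + ?D\<^sup>2 * ((v + w) / 2)
          \<le> (1 + ?D\<^sup>2) * (s + v + u + t + w + w')"
        if "0 \<le> s" "0 \<le> t" "0 \<le> u" "0 \<le> v" "0 \<le> w" "0 \<le> w'" for s t u v w w'
      proof -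
        have "?D\<^sup>2 * ((s + w') / 2 + (v + w) / 2) \<le> ?D\<^sup>2 * (s + v + u + t + w + w')"
          using that by (intro mult_left_mono) (simp_all add: add_divide_distrib)
        thus ?thesis using that by (simp add: distrib_left distrib_right add_divide_distrib)
      qed
      have "?D * ((?a2\<^sup>2 + ?b\<^sup>2)/2) + ?D * ((?a\<^sup>2 + ?b2\<^sup>2)/2) =
          (?D * ?a2\<^sup>2 + ?D * ?b\<^sup>2) / 2 + (?D * ?a\<^sup>2 + ?D * ?b2\<^sup>2) / 2"
        by (simp add: distrib_left)
      thus ?thesis
        using *[of "?D * ?a2\<^sup>2" "?D * ?b\<^sup>2" "?D * ?a\<^sup>2" "?D * ?b2\<^sup>2" "?e\<^sup>2 / ?D" "?e'\<^sup>2 / ?D"]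
        by simp
    qed
    also have "\<dots> \<le> (1 + (\<delta> 0)\<^sup>2) * ((1 + 1 / \<rho>\<^sup>2) * g k)"
    proof (intro mult_mono)
      have h1: "?D * y \<le> (1 + 1 / \<rho>\<^sup>2) * (\<delta> (k+2) * y)" if "y \<ge> 0" for y
      proof -
        have "?D * y \<le> \<delta> (k+2) / \<rho>\<^sup>2 * y" using r2 that by (rule mult_right_mono)
        also have "\<dots> \<le> (1 + 1 / \<rho>\<^sup>2) * (\<delta> (k+2) * y)" using that by (simp add: algebra_simps)
        finally show ?thesis .
      qed
      have h2: "y \<le> (1 + 1 / \<rho>\<^sup>2) * y" if "y \<ge> 0" for y
      proof -
        have "0 \<le> 1 / \<rho>\<^sup>2 * y" using that by simp
        thus ?thesis unfolding distrib_right by linarith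
      qed
      show "?D * ?a2\<^sup>2 + ?D * ?b2\<^sup>2 + ?D * ?a\<^sup>2 + ?D * ?b\<^sup>2 + ?e\<^sup>2 / ?D + ?e'\<^sup>2 / ?D \<le> (1 + 1 / \<rho>\<^sup>2) * g k"
        unfolding g_def distrib_left[of "1 + 1 / \<rho>\<^sup>2"]
        by (intro add_mono; rule h1 h2) (simp_all add: zero_le_mult_iff)
    qed (auto simp: le_first)
    finally show ?thesis by (simp only: C_def mult_ac)
  qed
  define \<epsilon> where "\<epsilon> = norm l / 2"
  have "\<epsilon> > 0" using \<open>l \<noteq> 0\<close> by (simp add: \<epsilon>_def)
  have "(\<lambda>k. norm (W k)) \<longlonglongrightarrow> norm l"
    using lim unfolding W_def by (rule tendsto_norm)
  hence "eventually (\<lambda>k. norm (W k) > \<epsilon>) sequentially"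
    using \<open>l \<noteq> 0\<close> by (intro order_tendstoD(1)) (auto simp: \<epsilon>_def)
  then obtain N where "\<And>k. k \<ge> N \<Longrightarrow> norm (W k) > \<epsilon>"
    by (auto simp: eventually_sequentially)
  hence N: "\<And>k. k \<ge> N \<Longrightarrow> norm (W (k+1)) > \<epsilon>"
    by simp
  have "summable (\<lambda>k. \<bar>A k\<bar> * (\<delta> k)\<^sup>2 * \<delta> (k+1))"
  proof (rule summable_comparison_test'[where N = N and g = "\<lambda>k. C / \<epsilon> * g k"])
    show "summable (\<lambda>k. C / \<epsilon> * g k)" using \<open>summable g\<close> by (rule summable_mult)
    fix k assume "k \<ge> N"
    have "\<bar>A k\<bar> * (\<delta> k)\<^sup>2 * \<delta> (k+1) * \<epsilon> \<le> \<bar>A k\<bar> * (\<delta> k)\<^sup>2 * \<delta> (k+1) * norm (W (k+1))"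
      using N[OF \<open>k \<ge> N\<close>] by (intro mult_left_mono) auto
    also have "\<dots> \<le> C * g k" by (rule C)
    finally show "norm (\<bar>A k\<bar> * (\<delta> k)\<^sup>2 * \<delta> (k+1)) \<le> C / \<epsilon> * g k"
      using \<open>\<epsilon> > 0\<close> by (simp add: field_simps abs_mult)
  qed
  hence "summable (\<lambda>k. 1 / \<rho> * (\<bar>A k\<bar> * (\<delta> k)\<^sup>2 * \<delta> (k+1)) + 2 / \<rho> * (\<delta> k)\<^sup>2)"
    by (intro summable_add summable_mult square_summable)
  hence "summable (\<lambda>k. \<bar>\<alpha> k\<bar> * \<delta> k ^ 3)"
  proof (rule summable_comparison_test'[where N = 0])
    fix k
    have "\<bar>\<alpha> k\<bar> \<le> \<bar>A k\<bar> + (1 / \<delta> k + 1 / \<delta> (k+1))"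
    proof -
      have "\<alpha> k = A k - (1 / \<delta> k + 1 / \<delta> (k+1))" by (simp add: A_def)
      moreover have "0 \<le> 1 / \<delta> k + 1 / \<delta> (k+1)" by simp
      ultimately show ?thesis by linarith
    qed
    hence "\<bar>\<alpha> k\<bar> * ((\<delta> k)\<^sup>2 * \<delta> (k+1)) \<le> (\<bar>A k\<bar> + (1 / \<delta> k + 1 / \<delta> (k+1))) * ((\<delta> k)\<^sup>2 * \<delta> (k+1))"
      by (intro mult_right_mono) auto
    also have "\<dots> = \<bar>A k\<bar> * ((\<delta> k)\<^sup>2 * \<delta> (k+1)) + (\<delta> k * \<delta> (k+1) + (\<delta> k)\<^sup>2)"
      using pos[of k] pos[of "k+1"] by (simp add: field_simps power2_eq_square)
    also have "\<dots> \<le> \<bar>A k\<bar> * ((\<delta> k)\<^sup>2 * \<delta> (k+1)) + 2 * (\<delta> k)\<^sup>2"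
      using decr[of k] by (simp add: power2_eq_square mult_left_mono)
    finally have "\<bar>\<alpha> k\<bar> * ((\<delta> k)\<^sup>2 * \<delta> (k+1)) \<le> \<bar>A k\<bar> * ((\<delta> k)\<^sup>2 * \<delta> (k+1)) + 2 * (\<delta> k)\<^sup>2" .
    moreover have "\<bar>\<alpha> k\<bar> * \<delta> k ^ 3 * \<rho> \<le> \<bar>\<alpha> k\<bar> * ((\<delta> k)\<^sup>2 * \<delta> (k+1))"
      using mult_left_mono[OF ratio[of k], of "\<bar>\<alpha> k\<bar> * (\<delta> k)\<^sup>2"]
      by (simp add: power2_eq_square power3_eq_cube algebra_simps)
    ultimately show "norm (\<bar>\<alpha> k\<bar> * \<delta> k ^ 3) \<le> 1 / \<rho> * (\<bar>A k\<bar> * (\<delta> k)\<^sup>2 * \<delta> (k+1)) + 2 / \<rho> * (\<delta> k)\<^sup>2"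
      using ratio_pos by (simp add: abs_mult field_simps)
  qed
  with large show False by simp
qed

text \<open>Summation by parts of \<open>p * cnj y\<close>. If the gradient sum diverged,
  \<open>Re (p k * cnj (y k))\<close> would be positive from some index on, since \<open>Q\<close>
  is bounded below and the other terms are summable. Then \<open>norm (y k)\<close> would increase
  strictly, stay away from 0, and weighted summability of its square would make
  \<open>\<delta>\<close> summable.\<close>

lemma gradient_summable:
  fixes y p f :: "nat \<Rightarrow> complex" and Q :: "nat \<Rightarrow> real"
  assumes p: "\<And>k. p k = (y (k+1) - y k) / \<delta> k"
    and eq: "\<And>k. p (k+1) - p k = Q k * y (k+1) + f k"
    and Q: "\<And>k. - M * \<delta> (k+1) \<le> Q k" and "M \<ge> 0"
    and sumy: "summable (\<lambda>k. \<delta> k * (norm (y k))\<^sup>2)"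
    and sumf: "summable (\<lambda>k. (norm (f k))\<^sup>2 / \<delta> k)"
  shows "summable (\<lambda>k. \<delta> k * (norm (p k))\<^sup>2)"
proof (rule ccontr)
  assume contra: "\<not> ?thesis"
  define S where "S N = (\<Sum>k<N. \<delta> k * (norm (p k))\<^sup>2)" for N
  define h where "h k = (M + 1 / \<rho>) * (\<delta> (k+1) * (norm (y (k+1)))\<^sup>2) + (norm (f k))\<^sup>2 / \<delta> k" for k
  have sumh: "summable h"
    unfolding h_def
    by (intro summable_add summable_mult sumf summable_ignore_initial_segment[OF sumy, of 1])
  have step: "\<delta> k * (norm (p k))\<^sup>2 \<le> Re (p (k+1) * cnj (y (k+1))) - Re (p k * cnj (y k)) + h k" for k
  proof -
    have y: "y (k+1) = y k + \<delta> k * p k" by (simp add: p)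
    have "p (k+1) * cnj (y (k+1)) - p k * cnj (y k)
       = (p (k+1) - p k) * cnj (y (k+1)) + p k * cnj (y (k+1) - y k)"
      by (simp add: algebra_simps)
    also have "\<dots> = Q k * (y (k+1) * cnj (y (k+1))) + f k * cnj (y (k+1)) + \<delta> k * (p k * cnj (p k))"
      unfolding eq using y by (simp add: algebra_simps)
    finally have "Re (p (k+1) * cnj (y (k+1)) - p k * cnj (y k)) =
        Re (of_real (Q k) * of_real ((norm (y (k+1)))\<^sup>2) + f k * cnj (y (k+1)) + of_real (\<delta> k) * of_real ((norm (p k))\<^sup>2))"
      unfolding complex_norm_square[symmetric] by (rule arg_cong)
    hence "Re (p (k+1) * cnj (y (k+1))) - Re (p k * cnj (y k)) =
        Q k * (norm (y (k+1)))\<^sup>2 + Re (f k * cnj (y (k+1))) + \<delta> k * (norm (p k))\<^sup>2"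
      by (simp del: of_real_power)
    moreover have "- M * (\<delta> (k+1) * (norm (y (k+1)))\<^sup>2) \<le> Q k * (norm (y (k+1)))\<^sup>2"
      using mult_right_mono[OF Q[of k], of "(norm (y (k+1)))\<^sup>2"] by (simp add: mult.assoc)
    moreover have "\<bar>Re (f k * cnj (y (k+1)))\<bar> \<le> (norm (f k))\<^sup>2 / \<delta> k + 1 / \<rho> * (\<delta> (k+1) * (norm (y (k+1)))\<^sup>2)"
    proof -
      have "\<bar>Re (f k * cnj (y (k+1)))\<bar> \<le> norm (f k) * norm (y (k+1))"
        using abs_Re_le_cmod[of "f k * cnj (y (k+1))"] by (simp add: norm_mult)
      also have "\<dots> = (norm (f k) / sqrt (\<delta> k)) * (sqrt (\<delta> k) * norm (y (k+1)))"
        by simp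
      also have "\<dots> \<le> ((norm (f k) / sqrt (\<delta> k))\<^sup>2 + (sqrt (\<delta> k) * norm (y (k+1)))\<^sup>2) / 2"
        by (rule mult_le_half_squares)
      also have "\<dots> \<le> (norm (f k))\<^sup>2 / \<delta> k + \<delta> k * (norm (y (k+1)))\<^sup>2"
      proof -
        have "(s + t) / 2 \<le> s + t" if "0 \<le> s" "0 \<le> t" for s t :: real
          using that by (simp add: add_divide_distrib)
        from this[of "(norm (f k))\<^sup>2 / \<delta> k" "\<delta> k * (norm (y (k+1)))\<^sup>2"] show ?thesis
          by (simp add: power_mult_distrib power_divide)
      qed
      also have "\<delta> k * (norm (y (k+1)))\<^sup>2 \<le> 1 / \<rho> * (\<delta> (k+1) * (norm (y (k+1)))\<^sup>2)"
        using mult_right_mono[OF ratio[of k], of "(norm (y (k+1)))\<^sup>2"] ratio_pos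
        by (simp add: field_simps)
      finally show ?thesis by simp
    qed
    ultimately show ?thesis
      unfolding h_def distrib_right by linarith
  qed
  have S_le: "S N \<le> Re (p N * cnj (y N)) - Re (p 0 * cnj (y 0)) + suminf h" for N
  proof -
    have "S N \<le> (\<Sum>k<N. Re (p (Suc k) * cnj (y (Suc k))) - Re (p k * cnj (y k)) + h k)"
      unfolding S_def using step by (intro sum_mono) simp
    also have "\<dots> = Re (p N * cnj (y N)) - Re (p 0 * cnj (y 0)) + sum h {..<N}"
      unfolding sum.distrib using sum_lessThan_telescope[of "\<lambda>k. Re (p k * cnj (y k))" N] by simp
    also have "sum h {..<N} \<le> suminf h"
      using sumh \<open>M \<ge> 0\<close> ratio_pos by (intro sum_le_suminf) (auto simp: h_def)
    finally show ?thesis by simp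
  qed
  \<comment> \<open>Once the partial sum \<open>S N0\<close> exceeds this \<open>C\<close>,
    \<open>S_le\<close> leaves no choice but a positive \<open>Re (p N * cnj (y N))\<close> for all
    later \<open>N\<close>.\<close>
  define C where "C = \<bar>Re (p 0 * cnj (y 0))\<bar> + \<bar>suminf h\<bar>"
  have "\<exists>N0. S N0 > C"
  proof (rule ccontr)
    assume "\<not> ?thesis"
    hence "summable (\<lambda>k. \<delta> k * (norm (p k))\<^sup>2)"
      by (intro summableI_nonneg_bounded[where x = C]) (auto simp: S_def not_less)
    with contra show False by simp
  qed
  then obtain N0 where N0: "S N0 > C" by blast
  have pos_re: "Re (p N * cnj (y N)) > 0" if "N \<ge> N0" for N
  proof -
    have "S N0 \<le> S N" unfolding S_def using that by (intro sum_mono2) auto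
    thus ?thesis using S_le[of N] N0 by (simp add: C_def)
  qed
  have incr: "(norm (y N))\<^sup>2 < (norm (y (Suc N)))\<^sup>2" if "N \<ge> N0" for N
  proof -
    have y: "y (Suc N) = y N + \<delta> N * p N" using p[of N] by simp
    have "(norm (y (Suc N)))\<^sup>2 = (norm (y N))\<^sup>2 + 2 * \<delta> N * Re (p N * cnj (y N)) + (\<delta> N)\<^sup>2 * (norm (p N))\<^sup>2"
      unfolding y cmod_power2 by (simp add: power2_eq_square algebra_simps)
    moreover have "0 < 2 * \<delta> N * Re (p N * cnj (y N))" using pos_re[OF that] pos by simp
    moreover have "0 \<le> (\<delta> N)\<^sup>2 * (norm (p N))\<^sup>2" by simp
    ultimately show ?thesis by linarith
  qed
  define m where "m = (norm (y (Suc N0)))\<^sup>2"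
  have "m > 0" using incr[of N0] unfolding m_def by (meson le_less_trans order_refl zero_le_power2)
  have m: "m \<le> (norm (y N))\<^sup>2" if "N \<ge> Suc N0" for N
    using that
  proof (induction N rule: dec_induct)
    case (step N)
    thus ?case using incr[of N] by simp
  qed (simp add: m_def)
  have "summable \<delta>"
  proof (rule summable_comparison_test'[where N = "Suc N0"])
    show "summable (\<lambda>k. 1 / m * (\<delta> k * (norm (y k))\<^sup>2))" by (intro summable_mult sumy)
    fix k assume "k \<ge> Suc N0"
    from mult_left_mono[OF m[OF this], of "\<delta> k"]
    show "norm (\<delta> k) \<le> 1 / m * (\<delta> k * (norm (y k))\<^sup>2)"
      using \<open>m > 0\<close> by (simp add: field_simps)
  qed
  with not_summable show False by simp
qed

text \<open>Alternating the signs turns the recursion into a Schroedinger equation with a potential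
  \<open>Q\<close> bounded below by \<open>- M * \<delta> (k+1)\<close>. The gradients of both
  sequences are then weighted square summable, and the Wronskian is a combination of products of
  values and gradients. So \<open>\<delta> k * norm (W k)\<close> is summable, which excludes a
  nonzero limit because \<open>\<delta>\<close> is not.\<close>

lemma jacobi_wronskian_limit_zero_semibounded:
  fixes a b e e' :: "nat \<Rightarrow> complex" and \<alpha> :: "nat \<Rightarrow> real"
  assumes eqa: "\<And>k. (a (k+2) - a (k+1)) / \<delta> (k+1) - (a (k+1) - a k) / \<delta> k = \<alpha> k * a (k+1) + e k"
    and eqb: "\<And>k. (b (k+2) - b (k+1)) / \<delta> (k+1) - (b (k+1) - b k) / \<delta> k = \<alpha> k * b (k+1) + e' k"
    and suma: "summable (\<lambda>k. \<delta> k * (norm (a k))\<^sup>2)"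
    and sumb: "summable (\<lambda>k. \<delta> k * (norm (b k))\<^sup>2)"
    and sume: "summable (\<lambda>k. (norm (e k))\<^sup>2 / \<delta> k)"
    and sume': "summable (\<lambda>k. (norm (e' k))\<^sup>2 / \<delta> k)"
    and lim: "(\<lambda>k. (a (k+1) * b k - a k * b (k+1)) / \<delta> k) \<longlonglongrightarrow> l"
    and M: "M > 0" "\<And>k. 4 / (\<delta> (k+1))\<^sup>2 + \<alpha> k / \<delta> (k+1) \<le> M"
  shows "l = 0"
proof (rule ccontr)
  assume "l \<noteq> 0"
  \<comment> \<open>The potential left over when
    \<open>a (k+2) / \<delta> (k+1) + a k / \<delta> k\<close> is read, up to sign, as a second
    difference of the alternating sequence.\<close>
  define Q where "Q k = - (\<alpha> k + 2 / \<delta> k + 2 / \<delta> (k+1))" for k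
  have Q: "- M * \<delta> (k+1) \<le> Q k" for k
  proof -
    have "(4 / (\<delta> (k+1))\<^sup>2 + \<alpha> k / \<delta> (k+1)) * \<delta> (k+1) \<le> M * \<delta> (k+1)"
      using M(2) by (intro mult_right_mono) auto
    also have "(4 / (\<delta> (k+1))\<^sup>2 + \<alpha> k / \<delta> (k+1)) * \<delta> (k+1) = 4 / \<delta> (k+1) + \<alpha> k"
      by (simp add: distrib_right power2_eq_square)
    finally have "4 / \<delta> (k+1) + \<alpha> k \<le> M * \<delta> (k+1)" .
    moreover have "2 / \<delta> k \<le> 2 / \<delta> (k+1)"
      using decr[of k] pos[of "k+1"] by (intro divide_left_mono) auto
    ultimately show ?thesis by (simp add: Q_def)
  qed
  define alt where "alt c k = (-1) ^ k * c k" for c :: "nat \<Rightarrow> complex" and k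
  define grad where "grad c k = (alt c (k+1) - alt c k) / \<delta> k" for c k
  have grad: "summable (\<lambda>k. \<delta> k * (norm (grad c k))\<^sup>2)"
    if eq: "\<And>k. (c (k+2) - c (k+1)) / \<delta> (k+1) - (c (k+1) - c k) / \<delta> k = \<alpha> k * c (k+1) + g k"
      and sumc: "summable (\<lambda>k. \<delta> k * (norm (c k))\<^sup>2)"
      and sumg: "summable (\<lambda>k. (norm (g k))\<^sup>2 / \<delta> k)" for c g :: "nat \<Rightarrow> complex"
  proof (rule gradient_summable[where y = "alt c" and Q = Q and f = "alt g" and M = M])
    fix k
    have *: "c (k+2) / \<delta> (k+1) + c k / \<delta> k = (\<alpha> k + 1 / \<delta> k + 1 / \<delta> (k+1)) * c (k+1) + g k"
      using eq[of k] by (simp add: diff_divide_distrib algebra_simps)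
    have "grad c (k+1) - grad c k = (-1)^k * ((c (k+2) / \<delta> (k+1) + c k / \<delta> k)
        + c (k+1) * (1 / \<delta> k + 1 / \<delta> (k+1)))"
      by (simp add: grad_def alt_def diff_divide_distrib add_divide_distrib algebra_simps)
    also have "\<dots> = Q k * alt c (k+1) + alt g k"
      unfolding * by (simp add: Q_def alt_def algebra_simps)
    finally show "grad c (k+1) - grad c k = Q k * alt c (k+1) + alt g k" .
  qed (use Q M sumc sumg in \<open>auto simp: grad_def alt_def norm_mult norm_power\<close>)
  define W where "W k = (a (k+1) * b k - a k * b (k+1)) / \<delta> k" for k
  have W: "W k = alt a k * grad b k - grad a k * alt b k" for k
  proof -
    have "alt c (k+1) = alt c k + \<delta> k * grad c k" for c by (simp add: grad_def)
    moreover have "a (k+1) * b k - a k * b (k+1) = - (alt a (k+1) * alt b k - alt a k * alt b (k+1))"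
      by (simp add: alt_def algebra_simps flip: power_add mult_2)
    ultimately show ?thesis by (simp add: W_def field_simps)
  qed
  have sumW: "summable (\<lambda>k. \<delta> k * norm (W k))"
  proof (rule summable_comparison_test'[where N = 0])
    show "summable (\<lambda>k. (\<delta> k * (norm (a k))\<^sup>2 + \<delta> k * (norm (grad b k))\<^sup>2)
       + (\<delta> k * (norm (b k))\<^sup>2 + \<delta> k * (norm (grad a k))\<^sup>2))"
      by (intro summable_add suma sumb grad[OF eqa suma sume] grad[OF eqb sumb sume'])
    fix k
    have "norm (W k) \<le> norm (a k) * norm (grad b k) + norm (b k) * norm (grad a k)"
      unfolding W using norm_triangle_ineq4[of "alt a k * grad b k" "grad a k * alt b k"]
      by (simp add: norm_mult alt_def norm_power mult.commute)
    also have "\<dots> \<le> ((norm (a k))\<^sup>2 + (norm (grad b k))\<^sup>2) / 2 + ((norm (b k))\<^sup>2 + (norm (grad a k))\<^sup>2) / 2"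
      by (intro add_mono mult_le_half_squares)
    also have "\<dots> \<le> (norm (a k))\<^sup>2 + (norm (grad b k))\<^sup>2 + (norm (b k))\<^sup>2 + (norm (grad a k))\<^sup>2"
      using zero_le_power2[of "norm (a k)"] zero_le_power2[of "norm (grad b k)"]
        zero_le_power2[of "norm (b k)"] zero_le_power2[of "norm (grad a k)"]
      unfolding add_divide_distrib by linarith
    finally have "\<delta> k * norm (W k) \<le> \<delta> k * ((norm (a k))\<^sup>2 + (norm (grad b k))\<^sup>2 + (norm (b k))\<^sup>2 + (norm (grad a k))\<^sup>2)"
      by (intro mult_left_mono) auto
    thus "norm (\<delta> k * norm (W k)) \<le> (\<delta> k * (norm (a k))\<^sup>2 + \<delta> k * (norm (grad b k))\<^sup>2)
       + (\<delta> k * (norm (b k))\<^sup>2 + \<delta> k * (norm (grad a k))\<^sup>2)"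
      by (simp add: algebra_simps)
  qed
  have "(\<lambda>k. norm (W k)) \<longlonglongrightarrow> norm l"
    using lim unfolding W_def by (rule tendsto_norm)
  hence "eventually (\<lambda>k. norm (W k) > norm l / 2) sequentially"
    using \<open>l \<noteq> 0\<close> by (intro order_tendstoD(1)) auto
  then obtain N where N: "\<And>k. k \<ge> N \<Longrightarrow> norm (W k) > norm l / 2"
    by (auto simp: eventually_sequentially)
  have "summable \<delta>"
  proof (rule summable_comparison_test'[where N = N])
    show "summable (\<lambda>k. 2 / norm l * (\<delta> k * norm (W k)))" by (intro summable_mult sumW)
    fix k assume "k \<ge> N"
    have "\<delta> k * (norm l / 2) \<le> \<delta> k * norm (W k)"
      using N[OF \<open>k \<ge> N\<close>] by (intro mult_left_mono) auto
    thus "norm (\<delta> k) \<le> 2 / norm l * (\<delta> k * norm (W k))"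
      using \<open>l \<noteq> 0\<close> by (simp add: field_simps)
  qed
  with not_summable show False by simp
qed

end

section \<open>Growth of the upper recursion\<close>

locale log_convex_mesh = mesh +
  assumes log_convex: "\<And>k. (\<delta> (k+1))\<^sup>2 \<le> \<delta> k * \<delta> (k+2)"
begin

text \<open>
  The unperturbed recursion \<open>v (k+2) / \<delta> (k+1) = - v k / \<delta> k\<close> is solved by sequences with
  \<open>\<bar>v (k+1)\<bar> * \<bar>v k\<bar> = const * \<delta> k\<close>; this is the absolute value of the one with constant and initial value \<open>1\<close>.
\<close>

primrec free_growth :: "nat \<Rightarrow> real" where
  "free_growth 0 = 1"
| "free_growth (Suc k) = \<delta> k / free_growth k"

lemma free_growth_pos [simp]: "0 < free_growth k"
  by (induction k) (auto simp: pos)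

lemma free_growth_neq_0 [simp]: "free_growth k \<noteq> 0"
  using free_growth_pos[of k] by linarith

lemma free_growth_nonneg [simp]: "0 \<le> free_growth k"
  using free_growth_pos[of k] by linarith

text \<open>The two numbers are \<open>(free_growth k)^2 / \<delta> k\<close> at
  \<open>k = 0\<close> and \<open>k = 1\<close>.\<close>

definition growth_const :: real
  where "growth_const = max (1 / \<delta> 0) ((\<delta> 0)\<^sup>2 / \<delta> 1)"

lemma growth_const_pos: "0 < growth_const"
  by (simp add: growth_const_def pos less_max_iff_disj)

text \<open>By log-convexity the quotient \<open>(free_growth k)^2 / \<delta> k\<close> does not
  increase in steps of two, so the first two indices control all of them.\<close>

lemma free_growth_square_le: "(free_growth k)\<^sup>2 \<le> growth_const * \<delta> k"
proof -
  have "(free_growth k)\<^sup>2 / \<delta> k \<le> growth_const"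
  proof (induction k rule: induct_nat_012)
    case 0
    show ?case by (simp add: growth_const_def)
  next
    case 1
    show ?case by (simp add: growth_const_def)
  next
    case (ge2 k)
    have "(free_growth (k+2))\<^sup>2 / \<delta> (k+2) = (free_growth k)\<^sup>2 * (\<delta> (k+1))\<^sup>2 / ((\<delta> k)\<^sup>2 * \<delta> (k+2))"
      by (simp add: power_mult_distrib power_divide)
    also have "\<dots> \<le> (free_growth k)\<^sup>2 * (\<delta> k * \<delta> (k+2)) / ((\<delta> k)\<^sup>2 * \<delta> (k+2))"
      using log_convex[of k] by (intro divide_right_mono mult_left_mono) auto
    also have "\<dots> = (free_growth k)\<^sup>2 / \<delta> k"
      by (simp add: power2_eq_square)
    finally show ?case using ge2(1) by simp
  qed
  thus ?thesis using pos[of k] by (simp add: field_simps)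
qed

text \<open>A Gronwall estimate after division by the free solution. As
  \<open>free_growth k * free_growth (k+1) = \<delta> k\<close>, the term
  \<open>v k / \<delta> k\<close> is carried over with factor exactly 1, and \<open>r\<close> enters
  only with the summable coefficient \<open>growth_const * \<delta> (k+1) * r k\<close>. The maximum
  over two neighbours is needed because the recursion has order two.\<close>

lemma weighted_growth:
  fixes v err r :: "nat \<Rightarrow> real"
  assumes v: "\<And>k. 0 \<le> v k" and r: "\<And>k. 0 \<le> r k" and err: "\<And>k. 0 \<le> err k"
    and sumr: "summable (\<lambda>k. \<delta> (k+1) * r k)"
    and rec: "\<And>k. v (k+2) \<le> \<delta> (k+1) * (r k * v (k+1) + v k / \<delta> k + err k)"
    and "M \<le> N"
  defines "Y k \<equiv> max (v k / free_growth k) (v (k+1) / free_growth (k+1))"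
  shows "Y N \<le> exp (growth_const * (\<Sum>k. \<delta> (k+1) * r k)) * (Y M + (\<Sum>k=M..<N. free_growth (k+1) * err k))"
proof -
  define s where "s k = growth_const * (\<delta> (k+1) * r k)" for k
  have s: "0 \<le> s k" for k using growth_const_pos r by (simp add: s_def)
  have Y0: "0 \<le> Y k" for k using v by (simp add: Y_def le_max_iff_disj)
  have step: "Y (k+1) \<le> (1 + s k) * Y k + free_growth (k+1) * err k" for k
  proof -
    let ?b = free_growth
    have nn: "0 \<le> s k * Y k" "0 \<le> ?b (k+1) * err k" using s Y0 err by (auto intro!: mult_nonneg_nonneg)
    have "v (k+2) / ?b (k+2) \<le> \<delta> (k+1) * (r k * v (k+1) + v k / \<delta> k + err k) / ?b (k+2)"
      by (intro divide_right_mono rec) (use free_growth_nonneg in blast)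
    also have "\<dots> = ?b (k+1) * (r k * v (k+1) + v k / \<delta> k + err k)"
      by simp
    also have "\<dots> = r k * (?b (k+1))\<^sup>2 * (v (k+1) / ?b (k+1)) + v k / ?b k + ?b (k+1) * err k"
      by (simp add: field_simps power2_eq_square)
    also have "r k * (?b (k+1))\<^sup>2 * (v (k+1) / ?b (k+1)) \<le> s k * Y k"
    proof (intro mult_mono)
      show "r k * (?b (k+1))\<^sup>2 \<le> s k"
        using mult_left_mono[OF free_growth_square_le[of "k+1"] r[of k]] by (simp add: s_def mult_ac)
      show "v (k+1) / ?b (k+1) \<le> Y k" by (simp add: Y_def)
    qed (use s v in \<open>auto intro: divide_nonneg_nonneg simp del: free_growth.simps\<close>)
    also have "v k / ?b k \<le> Y k" by (simp add: Y_def)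
    finally have "v (k+2) / ?b (k+2) \<le> (1 + s k) * Y k + ?b (k+1) * err k"
      by (simp add: distrib_right)
    moreover have "v (k+1) / ?b (k+1) \<le> (1 + s k) * Y k + ?b (k+1) * err k"
    proof -
      have "v (k+1) / ?b (k+1) \<le> Y k" by (simp add: Y_def)
      thus ?thesis using nn by (simp add: distrib_right)
    qed
    ultimately show ?thesis by (simp add: Y_def del: free_growth.simps)
  qed
  define B where "B N = (\<Sum>k=M..<N. free_growth (k+1) * err k)" for N
  have B0: "0 \<le> B N" for N
    unfolding B_def by (intro sum_nonneg mult_nonneg_nonneg free_growth_nonneg err)
  have "Y N \<le> exp (sum s {M..<N}) * (Y M + B N)"
    using \<open>M \<le> N\<close>
  proof (induction N rule: dec_induct)
    case base
    show ?case by (simp add: B_def)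
  next
    case (step n)
    have "Y (Suc n) \<le> (1 + s n) * Y n + free_growth (n+1) * err n"
      using \<open>\<And>k. Y (k+1) \<le> _ k\<close>[of n] by simp
    also have "\<dots> \<le> exp (s n) * (exp (sum s {M..<n}) * (Y M + B n)) + exp (sum s {M..<Suc n}) * (free_growth (n+1) * err n)"
    proof (rule add_mono)
      show "(1 + s n) * Y n \<le> exp (s n) * (exp (sum s {M..<n}) * (Y M + B n))"
        using step.IH s Y0 B0 by (intro mult_mono) (auto simp: exp_ge_add_one_self)
      have "1 \<le> exp (sum s {M..<Suc n})" using s by (simp add: sum_nonneg del: sum.op_ivl_Suc)
      moreover have "0 \<le> free_growth (n+1) * err n"
        by (intro mult_nonneg_nonneg free_growth_nonneg err)
      ultimately show "free_growth (n+1) * err n \<le> exp (sum s {M..<Suc n}) * (free_growth (n+1) * err n)"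
        using mult_right_mono[of 1 "exp (sum s {M..<Suc n})" "free_growth (n+1) * err n"]
        by (simp only: mult_1)
    qed
    also have "\<dots> = exp (sum s {M..<Suc n}) * (Y M + B (Suc n))"
      using step.hyps by (simp add: B_def exp_add algebra_simps del: free_growth.simps)
    finally show ?case .
  qed
  also have "\<dots> \<le> exp (growth_const * (\<Sum>k. \<delta> (k+1) * r k)) * (Y M + B N)"
  proof (intro mult_right_mono)
    have "sum s {M..<N} \<le> suminf s"
      unfolding s_def by (intro sum_le_suminf summable_mult sumr) (use s s_def in auto)
    also have "\<dots> = growth_const * (\<Sum>k. \<delta> (k+1) * r k)"
      unfolding s_def by (rule suminf_mult[OF sumr])
    finally show "exp (sum s {M..<N}) \<le> exp (growth_const * (\<Sum>k. \<delta> (k+1) * r k))" by simp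
  qed (use Y0 B0 in auto)
  finally show ?thesis by (simp add: B_def)
qed

text \<open>Both the error terms and the boundary term are bounded by the energy sum itself; its
  coefficient becomes at most 1/2 if the recursion starts at a late index \<open>M\<close>. The
  quantifiers sit inside the conclusion because \<open>M\<close> and \<open>C\<close> have to be
  chosen before the sequences and before \<open>N\<close>.\<close>

lemma energy_bound:
  fixes r :: "nat \<Rightarrow> real"
  assumes r: "\<And>k. 0 \<le> r k" and sumr: "summable (\<lambda>k. \<delta> (k+1) * r k)" and "0 \<le> G"
  obtains M C where "0 \<le> C" and
    "\<forall>v err m N. (\<forall>k. 0 \<le> v k) \<longrightarrow> (\<forall>k. 0 \<le> err k) \<longrightarrow> (\<forall>k. 0 \<le> m k) \<longrightarrow>
      (\<forall>k. v (k+2) \<le> \<delta> (k+1) * (r k * v (k+1) + v k / \<delta> k + err k)) \<longrightarrow>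
      (\<forall>k. (err k)\<^sup>2 \<le> G * \<delta> k * (m k + m (k+1))) \<longrightarrow>
      M \<le> N \<longrightarrow> (\<Sum>k\<le>N. m k) \<le> v N * v (N+1) / \<delta> N + sqrt (\<delta> N * m N) * v (N+1) \<longrightarrow>
      (\<Sum>k\<le>N. m k) \<le> C * (v M + v (M+1))\<^sup>2"
proof -
  let ?b = free_growth and ?K = growth_const
  define E where "E = exp (?K * (\<Sum>k. \<delta> (k+1) * r k))"
  \<comment> \<open>\<open>H - 1\<close> is the total coefficient of \<open>q * S\<close> in the
    last estimate of \<open>S\<close>; the choice \<open>q = 1 / (2 * H)\<close> then leaves at most
    \<open>S / 2\<close> on the right.\<close>
  define H where "H = 6 * E\<^sup>2 * G * ?K + ?K / 2 + 1"
  have "E > 0" by (simp add: E_def)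
  have "H > 0" using growth_const_pos \<open>0 \<le> G\<close> by (simp add: H_def add_nonneg_pos)
  obtain M where M: "\<And>N. norm (\<Sum>k=M..<N. (\<delta> k)\<^sup>2) < 1 / (2 * H)"
    using square_summable \<open>H > 0\<close> unfolding summable_Cauchy by (meson half_gt_zero order_refl zero_less_divide_1_iff zero_less_mult_iff zero_less_numeral)
  define C where "C = 6 * E\<^sup>2 * (1 / ?b M + 1 / ?b (M+1))\<^sup>2"
  show thesis
  proof (rule that[of C M], goal_cases)
    case 1
    show "0 \<le> C" by (simp add: C_def)
  next
    case 2
    show ?case
    proof (intro allI impI)
      fix v err m :: "nat \<Rightarrow> real" and N
      assume "\<forall>k. 0 \<le> v k" "\<forall>k. 0 \<le> err k" "\<forall>k. 0 \<le> m k"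
        and "\<forall>k. v (k+2) \<le> \<delta> (k+1) * (r k * v (k+1) + v k / \<delta> k + err k)"
        and "\<forall>k. (err k)\<^sup>2 \<le> G * \<delta> k * (m k + m (k+1))"
        and "M \<le> N" and S_le: "(\<Sum>k\<le>N. m k) \<le> v N * v (N+1) / \<delta> N + sqrt (\<delta> N * m N) * v (N+1)"
      note v = \<open>\<forall>k. 0 \<le> v k\<close>[rule_format] and err = \<open>\<forall>k. 0 \<le> err k\<close>[rule_format]
        and m = \<open>\<forall>k. 0 \<le> m k\<close>[rule_format] and rec = \<open>\<forall>k. v (k+2) \<le> _ k\<close>[rule_format]
        and errm = \<open>\<forall>k. (err k)\<^sup>2 \<le> _ k\<close>[rule_format]
      define Y where "Y k = max (v k / ?b k) (v (k+1) / ?b (k+1))" for k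
      define B where "B = (\<Sum>k=M..<N. ?b (k+1) * err k)"
      define S where "S = (\<Sum>k\<le>N. m k)"
      define q where "q = 1 / (2 * H)"
      have "q > 0" using \<open>H > 0\<close> by (simp add: q_def)
      have Y0: "0 \<le> Y k" for k using v by (simp add: Y_def le_max_iff_disj)
      have "S \<ge> 0" using m by (simp add: S_def sum_nonneg)
      have "B \<ge> 0" unfolding B_def by (intro sum_nonneg mult_nonneg_nonneg free_growth_nonneg err)
      have Y: "Y N \<le> E * (Y M + B)"
        unfolding Y_def B_def E_def by (rule weighted_growth[OF v r err sumr rec \<open>M \<le> N\<close>])
      have bd: "(?b (k+1))\<^sup>2 * \<delta> k \<le> ?K * (\<delta> k)\<^sup>2" for k
      proof -
        have "(?b (k+1))\<^sup>2 * \<delta> k \<le> (?K * \<delta> (k+1)) * \<delta> k"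
          by (intro mult_right_mono free_growth_square_le) auto
        also have "\<dots> \<le> ?K * \<delta> k * \<delta> k"
          using decr[of k] growth_const_pos by (intro mult_right_mono mult_left_mono) auto
        finally show ?thesis by (simp add: power2_eq_square mult.assoc)
      qed
      \<comment> \<open>Cauchy-Schwarz separates the accumulated error into the tail of the squares
        of \<open>\<delta>\<close>, which is below \<open>q\<close>, and the energy, where each
        \<open>m k\<close> is counted at most twice.\<close>
      have B2: "B\<^sup>2 \<le> 2 * G * ?K * q * S"
      proof -
        have "B \<le> (\<Sum>k=M..<N. (?b (k+1) * sqrt (G * \<delta> k)) * sqrt (m k + m (k+1)))"
          unfolding B_def
        proof (intro sum_mono)
          fix k
          have "err k \<le> sqrt (G * \<delta> k) * sqrt (m k + m (k+1))"
            unfolding real_sqrt_mult[symmetric] by (rule real_le_rsqrt[OF errm])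
          thus "?b (k+1) * err k \<le> ?b (k+1) * sqrt (G * \<delta> k) * sqrt (m k + m (k+1))"
            unfolding mult.assoc by (intro mult_left_mono free_growth_nonneg)
        qed
        hence "B\<^sup>2 \<le> (\<Sum>k=M..<N. (?b (k+1) * sqrt (G * \<delta> k)) * sqrt (m k + m (k+1)))\<^sup>2"
          using \<open>B \<ge> 0\<close> by (intro power_mono)
        also have "\<dots> \<le> (\<Sum>k=M..<N. (?b (k+1) * sqrt (G * \<delta> k))\<^sup>2) * (\<Sum>k=M..<N. (sqrt (m k + m (k+1)))\<^sup>2)"
          by (rule Cauchy_Schwarz_ineq_sum)
        also have "\<dots> \<le> (G * ?K * q) * (2 * S)"
        proof (rule mult_mono)
          have "(\<Sum>k=M..<N. (?b (k+1) * sqrt (G * \<delta> k))\<^sup>2) = G * (\<Sum>k=M..<N. (?b (k+1))\<^sup>2 * \<delta> k)"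
            unfolding sum_distrib_left using \<open>0 \<le> G\<close>
            by (intro sum.cong refl) (simp add: power_mult_distrib mult_ac del: free_growth.simps)
          also have "\<dots> \<le> G * (\<Sum>k=M..<N. ?K * (\<delta> k)\<^sup>2)"
            using \<open>0 \<le> G\<close> by (intro mult_left_mono sum_mono bd)
          also have "\<dots> = G * ?K * (\<Sum>k=M..<N. (\<delta> k)\<^sup>2)"
            by (simp add: sum_distrib_left mult.assoc)
          also have "\<dots> \<le> G * ?K * q"
            using M[of N] \<open>0 \<le> G\<close> growth_const_pos by (intro mult_left_mono) (auto simp: q_def)
          finally show "(\<Sum>k=M..<N. (?b (k+1) * sqrt (G * \<delta> k))\<^sup>2) \<le> G * ?K * q" .
          have "(\<Sum>k=M..<N. (sqrt (m k + m (k+1)))\<^sup>2) = (\<Sum>k=M..<N. m k) + (\<Sum>k=M..<N. m (Suc k))"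
            using m by (simp add: sum.distrib)
          also have "(\<Sum>k=M..<N. m (Suc k)) = (\<Sum>k=Suc M..<Suc N. m k)"
            by (rule sum.shift_bounds_Suc_ivl[symmetric])
          also have "(\<Sum>k=M..<N. m k) \<le> S"
            unfolding S_def using m by (intro sum_mono2) auto
          also have "(\<Sum>k=Suc M..<Suc N. m k) \<le> S"
            unfolding S_def using m by (intro sum_mono2) auto
          finally show "(\<Sum>k=M..<N. (sqrt (m k + m (k+1)))\<^sup>2) \<le> 2 * S" by simp
        qed (use m \<open>0 \<le> G\<close> \<open>q > 0\<close> growth_const_pos in \<open>auto intro!: sum_nonneg\<close>)
        finally show ?thesis by simp
      qed
      have Y2: "(Y N)\<^sup>2 \<le> 2 * E\<^sup>2 * (Y M)\<^sup>2 + 4 * E\<^sup>2 * G * ?K * q * S"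
      proof -
        have "(Y N)\<^sup>2 \<le> (E * (Y M + B))\<^sup>2" using Y Y0 by (intro power_mono)
        also have "\<dots> = E\<^sup>2 * (Y M + B)\<^sup>2" by (simp add: power_mult_distrib)
        also have "\<dots> \<le> E\<^sup>2 * (2 * (Y M)\<^sup>2 + 2 * B\<^sup>2)"
          using sum_squares_bound[of "Y M" B] by (intro mult_left_mono) (auto simp: power2_sum)
        also have "\<dots> \<le> E\<^sup>2 * (2 * (Y M)\<^sup>2 + 2 * (2 * G * ?K * q * S))"
          using B2 by (intro mult_left_mono add_left_mono) auto
        finally show ?thesis by (simp add: algebra_simps)
      qed
      \<comment> \<open>The weights match the boundary term, since
        \<open>free_growth N * free_growth (N+1) = \<delta> N\<close>.\<close>
      have first: "v N * v (N+1) / \<delta> N \<le> (Y N)\<^sup>2"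
      proof -
        have "v N * v (N+1) / \<delta> N = (v N / ?b N) * (v (N+1) / ?b (N+1))"
          by simp
        also have "\<dots> \<le> Y N * Y N"
          using v Y0 by (intro mult_mono) (auto simp: Y_def simp del: free_growth.simps)
        finally show ?thesis by (simp add: power2_eq_square)
      qed
      have second: "sqrt (\<delta> N * m N) * v (N+1) \<le> (?K * q * S + (Y N)\<^sup>2) / 2"
      proof -
        have "v (N+1) / ?b (N+1) \<le> Y N" by (simp add: Y_def)
        hence vY: "v (N+1) \<le> ?b (N+1) * Y N"
          using free_growth_pos[of "N+1"] by (simp add: divide_le_eq mult.commute del: free_growth.simps)
        hence "sqrt (\<delta> N * m N) * v (N+1) \<le> sqrt (\<delta> N * m N) * (?b (N+1) * Y N)"
          using m by (intro mult_left_mono) auto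
        also have "\<dots> = (?b (N+1) * sqrt (\<delta> N * m N)) * Y N" by (simp only: mult_ac)
        also have "\<dots> \<le> ((?b (N+1) * sqrt (\<delta> N * m N))\<^sup>2 + (Y N)\<^sup>2) / 2"
          by (rule mult_le_half_squares)
        also have "(?b (N+1) * sqrt (\<delta> N * m N))\<^sup>2 = (?b (N+1))\<^sup>2 * \<delta> N * m N"
          using m[of N] by (simp add: power_mult_distrib mult_ac del: free_growth.simps)
        also have "\<dots> \<le> (?K * (\<delta> N)\<^sup>2) * m N" using m by (intro mult_right_mono bd)
        also have "\<dots> \<le> ?K * q * S"
        proof (intro mult_mono mult_left_mono)
          have "(\<delta> N)\<^sup>2 \<le> (\<Sum>k=M..<Suc N. (\<delta> k)\<^sup>2)"
            using \<open>M \<le> N\<close> by (intro member_le_sum) auto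
          also have "\<dots> \<le> q" using M[of "Suc N"] by (simp add: q_def)
          finally show "(\<delta> N)\<^sup>2 \<le> q" .
          show "m N \<le> S" unfolding S_def using m by (intro member_le_sum) auto
        qed (use growth_const_pos m \<open>q > 0\<close> in auto)
        finally show ?thesis by simp
      qed
      have "S \<le> 3 / 2 * (Y N)\<^sup>2 + ?K * q * S / 2"
        using S_le first second by (simp add: S_def add_divide_distrib)
      also have "\<dots> \<le> 3 / 2 * (2 * E\<^sup>2 * (Y M)\<^sup>2 + 4 * E\<^sup>2 * G * ?K * q * S) + ?K * q * S / 2"
        using Y2 by (intro add_right_mono mult_left_mono) auto
      also have "\<dots> = 3 * E\<^sup>2 * (Y M)\<^sup>2 + ((H - 1) * q) * S"
        by (simp add: H_def algebra_simps)
      also have "\<dots> \<le> 3 * E\<^sup>2 * (Y M)\<^sup>2 + 1 / 2 * S"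
      proof -
        have "(H - 1) * q \<le> 1 / 2" using \<open>H > 0\<close> by (simp add: q_def field_simps)
        thus ?thesis using \<open>S \<ge> 0\<close> by (intro add_left_mono mult_right_mono)
      qed
      finally have "S \<le> 6 * E\<^sup>2 * (Y M)\<^sup>2" by simp
      also have "\<dots> \<le> 6 * E\<^sup>2 * ((1 / ?b M + 1 / ?b (M+1)) * (v M + v (M+1)))\<^sup>2"
      proof (intro mult_left_mono power_mono)
        have "v M / ?b M \<le> (1 / ?b M + 1 / ?b (M+1)) * (v M + v (M+1))"
          "v (M+1) / ?b (M+1) \<le> (1 / ?b M + 1 / ?b (M+1)) * (v M + v (M+1))"
          using v[of M] v[of "M+1"] free_growth_pos[of M] free_growth_pos[of "M+1"]
          by (auto simp: distrib_left distrib_right simp del: free_growth.simps)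
        thus "Y M \<le> (1 / ?b M + 1 / ?b (M+1)) * (v M + v (M+1))" by (simp add: Y_def)
      qed (use Y0 in auto)
      also have "\<dots> = C * (v M + v (M+1))\<^sup>2" by (simp add: C_def power_mult_distrib)
      finally show "(\<Sum>k\<le>N. m k) \<le> C * (v M + v (M+1))\<^sup>2" by (simp add: S_def)
    qed
  qed
qed

end

subsection \<open>Block vectors\<close>

definition upper :: "complex ^ ('a::finite + 'b::finite) \<Rightarrow> complex ^ 'a"
  where "upper v = (\<chi> i. v $ Inl i)"

definition lower :: "complex ^ ('a::finite + 'b::finite) \<Rightarrow> complex ^ 'b"
  where "lower v = (\<chi> i. v $ Inr i)"

lemma upper_nth [simp]: "upper v $ i = v $ Inl i" and lower_nth [simp]: "lower v $ j = v $ Inr j"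
  by (simp_all add: upper_def lower_def)

lemma sum_UNIV_Plus:
  "(\<Sum>i\<in>(UNIV :: ('a::finite + 'b::finite) set). f i) = (\<Sum>i\<in>UNIV. f (Inl i)) + (\<Sum>j\<in>UNIV. f (Inr j))"
  unfolding UNIV_Plus_UNIV[symmetric] by (subst sum.Plus) auto

lemma norm_square_eq_upper_lower: "(norm v)\<^sup>2 = (norm (upper v))\<^sup>2 + (norm (lower v))\<^sup>2"
  by (simp add: norm_vec_def L2_set_def sum_UNIV_Plus real_sqrt_pow2 sum_nonneg)

lemma norm_upper_le: "norm (upper v) \<le> norm v" and norm_lower_le: "norm (lower v) \<le> norm v"
  by (rule power2_le_imp_le; simp add: norm_square_eq_upper_lower[of v])+

lemma cdot_eq_upper_lower: "cdot u v = cdot (upper u) (upper v) + cdot (lower u) (lower v)"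
  by (simp add: cdot_def sum_UNIV_Plus)

lemma norm_matrix_vector_le_opnorm: "norm (A *v v) \<le> opnorm A * norm v" for A :: "complex ^ 'n ^ 'm"
  unfolding opnorm_def by (rule onorm) simp

lemma norm_entry_le_opnorm: "norm (A $ i $ j) \<le> opnorm A" for A :: "complex ^ 'n ^ 'm"
proof -
  have "A *v axis j 1 = column j A"
    by (simp add: vec_eq_iff matrix_vector_mult_def axis_def column_def if_distrib[of "\<lambda>y. _ * y"] cong: if_cong)
  hence "norm (A $ i $ j) \<le> norm (A *v axis j 1)"
    using Finite_Cartesian_Product.norm_nth_le[of "column j A" i] by (simp add: column_def)
  also have "\<dots> \<le> opnorm A" using norm_matrix_vector_le_opnorm[of A "axis j 1"] by simp
  finally show ?thesis .
qed

lemma opnorm_nonneg: "0 \<le> opnorm A" for A :: "complex ^ 'n ^ 'm"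
  unfolding opnorm_def by (rule onorm_pos_le) simp

text \<open>The imaginary part is a real inner product with a rotated vector, so Cauchy-Schwarz
  holds with constant 1, free of the dimension factor in \<open>norm_cdot_le\<close>. The boundary
  hypothesis of \<open>energy_bound\<close> is stated with this constant.\<close>

lemma abs_Im_cdot_le: "\<bar>Im (cdot u v)\<bar> \<le> norm u * norm v"
proof -
  have "Im (cdot u v) = Re (cdot ((- \<i>) *s u) v)"
    by (simp only: cdot_scale_left) simp
  also have "\<dots> = inner ((- \<i>) *s u) v" by (rule Re_cdot)
  finally show ?thesis
    using Cauchy_Schwarz_ineq2[of "(- \<i>) *s u" v] norm_scale_vec[of "- \<i>" u] by simp
qed

lemma Im_cdot_self [simp]: "Im (cdot u u) = 0"
  by (simp add: cdot_def)

lemma hermitian_entry: "hermitian A \<Longrightarrow> A $ i $ j = cnj (A $ j $ i)"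
  by (simp add: hermitian_def vec_eq_iff transpose_def map_matrix_def)

lemma cdot_diff_left: "cdot (u - v) w = cdot u w - cdot v w"
  by (simp add: cdot_def sum_subtractf algebra_simps)

lemma cdot_hermitian:
  assumes "hermitian A"
  shows "cdot (A *v u) v = cdot u (A *v v)"
proof -
  have "cdot (A *v u) v = (\<Sum>i\<in>UNIV. \<Sum>j\<in>UNIV. A $ i $ j * u $ j * cnj (v $ i))"
    by (simp add: cdot_def matrix_vector_mult_def sum_distrib_right)
  also have "\<dots> = (\<Sum>j\<in>UNIV. \<Sum>i\<in>UNIV. A $ i $ j * u $ j * cnj (v $ i))"
    by (rule sum.swap)
  also have "\<dots> = (\<Sum>j\<in>UNIV. \<Sum>i\<in>UNIV. u $ j * cnj (A $ j $ i * v $ i))"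
  proof (intro sum.cong refl)
    fix i j
    show "A $ i $ j * u $ j * cnj (v $ i) = u $ j * cnj (A $ j $ i * v $ i)"
      by (subst hermitian_entry[OF assms, of i j]) simp
  qed
  also have "\<dots> = cdot u (A *v v)"
    by (simp add: cdot_def matrix_vector_mult_def sum_distrib_left)
  finally show ?thesis .
qed

lemma linear_vec_bounded:
  fixes f :: "complex ^ 'n \<Rightarrow> complex ^ 'm"
  assumes "Vector_Spaces.linear (*s) (*s) f"
  shows "\<exists>B\<ge>0. \<forall>c. norm (f c) \<le> B * norm c"
proof (intro exI conjI allI)
  have "f c = matrix f *v c" for c
    using matrix_works[OF assms] by simp
  thus "norm (f c) \<le> opnorm (matrix f) * norm c" for c
    by (metis norm_matrix_vector_le_opnorm)
qed (rule opnorm_nonneg)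

lemma linear_vec_continuous:
  fixes f :: "complex ^ 'n \<Rightarrow> complex ^ 'm"
  assumes "Vector_Spaces.linear (*s) (*s) f"
  shows "continuous_on S f"
proof -
  have "f = (*v) (matrix f)"
    using matrix_works[OF assms] by auto
  hence "bounded_linear f"
    using matrix_vector_mul_bounded_linear[of "matrix f"] by simp
  thus ?thesis
    by (rule linear_continuous_on)
qed

lemma square_sum3_le: "(a + b + c)\<^sup>2 \<le> 3 * (a\<^sup>2 + b\<^sup>2 + c\<^sup>2)" for a b c :: real
  using sum_squares_bound[of a b] sum_squares_bound[of a c] sum_squares_bound[of b c]
  by (simp add: power2_sum power2_eq_square algebra_simps)

subsection \<open>The discretised system\<close>

text \<open>
  \<open>U c k\<close> and \<open>P c k\<close> stand for \<open>u (x\<^sub>k)\<close> and \<open>u' (x\<^sub>k+)\<close>, where \<open>- u'' = z u\<close>, \<open>u (0) = c\<close> and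
  \<open>u' (0) = 0\<close>; \<open>m c k\<close> is the energy of \<open>u\<close> on the interval from \<open>x\<^sub>k\<close> to \<open>x\<^bsub>k+1\<^esub>\<close>, of length
  \<open>\<delta> k\<close>, and \<open>A k\<close> is the interaction at its right end point.
\<close>

locale solution_system = log_convex_mesh \<delta> \<rho>
  for \<delta> :: "nat \<Rightarrow> real" and \<rho> :: real +
  fixes z :: complex
    and A :: "nat \<Rightarrow> complex ^ ('p1::finite + 'p2::finite) ^ ('p1 + 'p2)"
    and U P :: "complex ^ ('p1 + 'p2) \<Rightarrow> nat \<Rightarrow> complex ^ ('p1 + 'p2)"
    and m :: "complex ^ ('p1 + 'p2) \<Rightarrow> nat \<Rightarrow> real"
    and I :: "complex ^ ('p1 + 'p2) \<Rightarrow> complex ^ ('p1 + 'p2) \<Rightarrow> nat \<Rightarrow> 'p1 + 'p2 \<Rightarrow> complex"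
    and K :: real and K' :: real
    and \<alpha> :: "nat \<Rightarrow> 'p2 \<Rightarrow> real" and A' :: "nat \<Rightarrow> complex ^ 'p2 ^ 'p2"
  assumes z: "\<bar>Im z\<bar> = 1"
    and herm: "\<And>k. hermitian (A k)"
    and linU: "\<And>k. Vector_Spaces.linear (*s) (*s) (\<lambda>c. U c k)"
    and linP: "\<And>k. Vector_Spaces.linear (*s) (*s) (\<lambda>c. P c k)"
    and U0: "\<And>c. U c 0 = c" and P0: "\<And>c. P c 0 = 0"
    and m_nonneg: "\<And>c k. 0 \<le> m c k"
    and m_add: "\<And>c c' k. m (c + c') k \<le> 2 * (m c k + m c' k)"
    and m_scale: "\<And>a c k. m (a *s c) k = (norm a)\<^sup>2 * m c k"
    and right_slope: "\<And>c k. (norm (P c k - (1 / \<delta> k) *\<^sub>R (U c (k+1) - U c k)))\<^sup>2 \<le> \<delta> k * m c k"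
    and left_slope: "\<And>c k. (norm (P c (k+1) - A k *v U c (k+1) - (1 / \<delta> k) *\<^sub>R (U c (k+1) - U c k)))\<^sup>2 \<le> \<delta> k * m c k"
    and K: "0 < K" and right_value: "\<And>c k. \<delta> k * (norm (U c k))\<^sup>2 \<le> K * m c k"
    and left_value: "\<And>c k. \<delta> k * (norm (U c (k+1)))\<^sup>2 \<le> K * m c k"
    and green: "\<And>c c' k j.
      (P c (k+1) - A k *v U c (k+1)) $ j * cnj (U c' (k+1) $ j)
      - U c (k+1) $ j * cnj ((P c' (k+1) - A k *v U c' (k+1)) $ j)
      - (P c k $ j * cnj (U c' k $ j) - U c k $ j * cnj (P c' k $ j)) = (cnj z - z) * I c c' k j"
    and I_le: "\<And>c c' k j. norm (I c c' k j) \<le> m c k + m c' k"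
    and I_sum: "\<And>c k. (\<Sum>j\<in>UNIV. I c c k j) = of_real (m c k)"
    and K': "0 \<le> K'"
    and block11: "summable (\<lambda>k. \<delta> (k+1) * opnorm (block11 (A k) + mat (complex_of_real (1 / \<delta> k + 1 / \<delta> (k+1)))))"
    and block12: "\<And>k. opnorm (block12 (A k)) \<le> K' * \<delta> k"
    and block22: "\<And>k. block22 (A k) = diag_real (\<alpha> k) + A' k"
    and A'_le: "\<And>k. opnorm (A' k) \<le> K' * \<delta> k"
    and \<alpha>: "(\<forall>j. \<not> summable (\<lambda>k. \<bar>\<alpha> k j\<bar> * \<delta> k ^ 3)) \<or>
         (\<exists>M>0. \<forall>k j. 4 / (\<delta> (k + 1))\<^sup>2 + \<alpha> k j / \<delta> (k + 1) \<le> M)"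
begin

section \<open>Upper bound for the dimension: decay of the lower boundary forms\<close>

definition D :: "(complex ^ ('p1 + 'p2)) set"
  where "D = {c. summable (m c)}"

lemma m_zero: "m 0 k = 0"
  using m_scale[of 0 0 k] by simp

lemma subspace_D: "vec.subspace D"
  unfolding vec.subspace_def D_def
proof (safe)
  have "m 0 = (\<lambda>_. 0)" by (simp add: fun_eq_iff m_zero)
  thus "summable (m 0)" by simp
  show "summable (m (c + c'))" if "summable (m c)" "summable (m c')" for c c'
    by (rule summable_cmult_bound[where C = 2, OF summable_add[OF that]]) (use m_add m_nonneg in auto)
  show "summable (m (a *s c))" if "summable (m c)" for a c
    unfolding m_scale using that by (rule summable_mult)
qed

lemma K'\<delta>: "0 \<le> K' * \<delta> k"
  using K' by simp

text \<open>What the interaction does to lower component \<open>j\<close> apart from its real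
  diagonal entry \<open>\<alpha> k j\<close>: the coupling to the upper block and the remainder
  \<open>A'\<close>.\<close>

definition \<theta> :: "complex ^ ('p1 + 'p2) \<Rightarrow> nat \<Rightarrow> 'p2 \<Rightarrow> complex"
  where "\<theta> c k j = (A k *v U c (k+1)) $ Inr j - \<alpha> k j * U c (k+1) $ Inr j"

definition K2 :: real
  where "K2 = CARD('p1) * K' + CARD('p2) * K'"

lemma K2: "0 \<le> K2"
  using K' by (simp add: K2_def)

lemma \<theta>_le: "norm (\<theta> c k j) \<le> K2 * \<delta> k * norm (U c (k+1))"
proof -
  let ?U = "U c (k+1)"
  \<comment> \<open>The bound is assumed for the block (1,2) only; hermitian symmetry transfers it
    to the block (2,1).\<close>
  have entry21: "norm (A k $ Inr j $ Inl i) \<le> K' * \<delta> k" for i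
    using norm_entry_le_opnorm[of "block12 (A k)" i j] block12[of k]
    by (subst hermitian_entry[OF herm]) (simp add: block12_def)
  have entry22: "norm (A' k $ j $ l) \<le> K' * \<delta> k" for l
    using norm_entry_le_opnorm[of "A' k" j l] A'_le[of k] by simp
  have "A k $ Inr j $ Inr l = (if j = l then of_real (\<alpha> k j) else 0) + A' k $ j $ l" for l
    using arg_cong[OF block22[of k], of "\<lambda>B. B $ j $ l"] by (simp add: block22_def diag_real_def)
  hence "(\<Sum>l\<in>UNIV. A k $ Inr j $ Inr l * ?U $ Inr l) =
      \<alpha> k j * ?U $ Inr j + (\<Sum>l\<in>UNIV. A' k $ j $ l * ?U $ Inr l)"
    by (simp add: distrib_right sum.distrib if_distrib[of "\<lambda>y. y * _"] sum.delta cong: if_cong)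
  hence "\<theta> c k j = (\<Sum>i\<in>UNIV. A k $ Inr j $ Inl i * ?U $ Inl i) + (\<Sum>l\<in>UNIV. A' k $ j $ l * ?U $ Inr l)"
    by (simp add: \<theta>_def matrix_vector_mult_def sum_UNIV_Plus)
  also have "norm \<dots> \<le> (\<Sum>i\<in>(UNIV::'p1 set). K' * \<delta> k * norm ?U) + (\<Sum>l\<in>(UNIV::'p2 set). K' * \<delta> k * norm ?U)"
    by (intro norm_triangle_mono sum_norm_le)
      (auto simp: norm_mult K'\<delta> intro!: mult_mono entry21 entry22 Finite_Cartesian_Product.norm_nth_le)
  finally show ?thesis by (simp add: K2_def algebra_simps)
qed

definition slope :: "complex ^ ('p1 + 'p2) \<Rightarrow> nat \<Rightarrow> complex ^ ('p1 + 'p2)"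
  where "slope c k = (1 / \<delta> k) *\<^sub>R (U c (k+1) - U c k)"

text \<open>\<open>rerr\<close> and \<open>lerr\<close> measure how far the derivatives at the two
  ends of an interval, right of \<open>x_k\<close> and left of \<open>x_(k+1)\<close>, are from the
  difference quotient \<open>slope\<close>.\<close>

definition rerr :: "complex ^ ('p1 + 'p2) \<Rightarrow> nat \<Rightarrow> complex ^ ('p1 + 'p2)"
  where "rerr c k = P c k - slope c k"

definition lerr :: "complex ^ ('p1 + 'p2) \<Rightarrow> nat \<Rightarrow> complex ^ ('p1 + 'p2)"
  where "lerr c k = P c (k+1) - A k *v U c (k+1) - slope c k"

lemma rerr_le: "(norm (rerr c k))\<^sup>2 \<le> \<delta> k * m c k"
  and lerr_le: "(norm (lerr c k))\<^sup>2 \<le> \<delta> k * m c k"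
  using right_slope[of c k] left_slope[of c k] by (simp_all add: rerr_def lerr_def slope_def)

text \<open>The jump condition at \<open>x_(k+1)\<close> read as a second-order difference equation:
  the derivative there is eliminated between the interval on its left and the one on its
  right.\<close>

lemma slope_step: "slope c (k+1) - slope c k = A k *v U c (k+1) - rerr c (k+1) + lerr c k"
  by (simp add: rerr_def lerr_def)

lemma slope_nth: "slope c k $ j = (U c (k+1) $ j - U c k $ j) / \<delta> k"
  by (simp add: slope_def scaleR_conv_of_real[where 'a = complex])

definition residual :: "complex ^ ('p1 + 'p2) \<Rightarrow> nat \<Rightarrow> 'p2 \<Rightarrow> complex"
  where "residual c k j = \<theta> c k j - rerr c (k+1) $ Inr j + lerr c k $ Inr j"

lemma lower_equation:
  "(U c (k+2) $ Inr j - U c (k+1) $ Inr j) / \<delta> (k+1) - (U c (k+1) $ Inr j - U c k $ Inr j) / \<delta> k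
     = \<alpha> k j * U c (k+1) $ Inr j + residual c k j"
  using arg_cong[OF slope_step[of c k], of "\<lambda>v. v $ Inr j"]
  by (simp add: slope_nth residual_def \<theta>_def)

text \<open>Stated for arbitrary normed vectors so that it serves the scalar residual of a lower
  component as well as the vector-valued error of the upper block. The values cost
  \<open>\<delta> * m\<close> only because the coupling is itself
  \<open>O(\<delta>)\<close>.\<close>

lemma residual_le:
  fixes a b d :: "'v::real_normed_vector"
  assumes "norm a \<le> L * \<delta> k * norm (U c (k+1))" "norm b \<le> norm (rerr c (k+1))" "norm d \<le> norm (lerr c k)"
  shows "(norm (a - b + d))\<^sup>2 \<le> 3 * (L\<^sup>2 * K + 1) * \<delta> k * (m c k + m c (k+1))"
proof -
  have "norm (a - b + d) \<le> norm a + norm b + norm d"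
    using norm_triangle_ineq[of "a - b" d] norm_triangle_ineq4[of a b] by linarith
  also have "\<dots> \<le> L * \<delta> k * norm (U c (k+1)) + norm (rerr c (k+1)) + norm (lerr c k)"
    using assms by simp
  finally have "(norm (a - b + d))\<^sup>2 \<le> (L * \<delta> k * norm (U c (k+1)) + norm (rerr c (k+1)) + norm (lerr c k))\<^sup>2"
    by (intro power_mono) auto
  also have "\<dots> \<le> 3 * ((L * \<delta> k * norm (U c (k+1)))\<^sup>2 + (norm (rerr c (k+1)))\<^sup>2 + (norm (lerr c k))\<^sup>2)"
    by (rule square_sum3_le)
  also have "\<dots> \<le> 3 * (L\<^sup>2 * \<delta> k * (K * m c k) + \<delta> k * m c (k+1) + \<delta> k * m c k)"
  proof (intro mult_left_mono add_mono)
    have "(L * \<delta> k * norm (U c (k+1)))\<^sup>2 = L\<^sup>2 * \<delta> k * (\<delta> k * (norm (U c (k+1)))\<^sup>2)"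
      by (simp add: power2_eq_square algebra_simps)
    also have "\<dots> \<le> L\<^sup>2 * \<delta> k * (K * m c k)"
      using left_value by (intro mult_left_mono) auto
    finally show "(L * \<delta> k * norm (U c (k+1)))\<^sup>2 \<le> L\<^sup>2 * \<delta> k * (K * m c k)" .
    show "(norm (rerr c (k+1)))\<^sup>2 \<le> \<delta> k * m c (k+1)"
      using rerr_le[of c "k+1"] mult_right_mono[OF decr[of k] m_nonneg[of c "k+1"]] by simp
  qed (use lerr_le in auto)
  also have "\<dots> \<le> 3 * ((L\<^sup>2 * K + 1) * \<delta> k * (m c k + m c (k+1)))"
  proof -
    have "0 \<le> L\<^sup>2 * K * \<delta> k * m c (k+1)" using K m_nonneg by simp
    thus ?thesis by (simp add: algebra_simps)
  qed
  finally show ?thesis by (simp only: mult.assoc)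
qed

lemma summable_residual:
  assumes "c \<in> D"
  shows "summable (\<lambda>k. (norm (residual c k j))\<^sup>2 / \<delta> k)"
proof -
  have "summable (\<lambda>k. m c k + m c (k+1))"
    using assms summable_ignore_initial_segment[of "m c" 1] unfolding D_def by (intro summable_add) auto
  thus ?thesis
  proof (rule summable_cmult_bound)
    fix k
    have "(norm (residual c k j))\<^sup>2 \<le> 3 * (K2\<^sup>2 * K + 1) * \<delta> k * (m c k + m c (k+1))"
      unfolding residual_def
      by (rule residual_le[OF \<theta>_le]) (auto simp: Finite_Cartesian_Product.norm_nth_le)
    hence "(norm (residual c k j))\<^sup>2 / \<delta> k \<le> 3 * (K2\<^sup>2 * K + 1) * (m c k + m c (k+1))"
      using pos[of k] by (simp add: divide_le_eq mult_ac)
    thus "\<bar>(norm (residual c k j))\<^sup>2 / \<delta> k\<bar> \<le> 3 * (K2\<^sup>2 * K + 1) * (m c k + m c (k+1))" by simp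
  qed
qed

lemma summable_values:
  assumes "c \<in> D"
  shows "summable (\<lambda>k. \<delta> k * (norm (U c k $ j))\<^sup>2)"
proof (rule summable_cmult_bound[where C = K])
  show "summable (m c)" using assms by (simp add: D_def)
  fix k
  have "(norm (U c k $ j))\<^sup>2 \<le> (norm (U c k))\<^sup>2"
    by (intro power_mono Finite_Cartesian_Product.norm_nth_le) auto
  hence "\<delta> k * (norm (U c k $ j))\<^sup>2 \<le> \<delta> k * (norm (U c k))\<^sup>2"
    by (intro mult_left_mono) auto
  also have "\<dots> \<le> K * m c k" by (rule right_value)
  finally show "\<bar>\<delta> k * (norm (U c k $ j))\<^sup>2\<bar> \<le> K * m c k" by simp
qed

definition w :: "complex ^ ('p1 + 'p2) \<Rightarrow> complex ^ ('p1 + 'p2) \<Rightarrow> nat \<Rightarrow> 'p1 + 'p2 \<Rightarrow> complex"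
  where "w c c' k j = P c k $ j * cnj (U c' k $ j) - U c k $ j * cnj (P c' k $ j)"

text \<open>The diagonal entries drop out because they are real; this is why only
  \<open>\<theta>\<close> has to be small.\<close>

lemma w_step:
  "w c c' (k+1) (Inr j) - w c c' k (Inr j) = (cnj z - z) * I c c' k (Inr j)
     + (\<theta> c k j * cnj (U c' (k+1) $ Inr j) - U c (k+1) $ Inr j * cnj (\<theta> c' k j))"
  using green[of c k "Inr j" c'] by (simp add: w_def \<theta>_def algebra_simps)

text \<open>By Cauchy-Schwarz type bounds each increment is at most a multiple of the energies of
  both solutions on one interval, where \<open>\<theta>\<close> contributes through
  \<open>\<delta> k * norm (U c (k+1))^2 \<le> K * m c k\<close>. These energies are summable on
  \<open>D\<close>.\<close>

lemma w_convergent: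
  assumes "c \<in> D" "c' \<in> D"
  shows "convergent (\<lambda>k. w c c' k (Inr j))"
proof -
  have "summable (\<lambda>k. w c c' (k+1) (Inr j) - w c c' k (Inr j))"
  proof (rule summable_comparison_test'[where N = 0])
    show "summable (\<lambda>k. (2 + K2 * K) * (m c k + m c' k))"
      using assms unfolding D_def by (intro summable_mult summable_add) auto
    fix k
    let ?u = "norm (U c (k+1))" and ?u' = "norm (U c' (k+1))"
    have "norm (\<theta> c k j * cnj (U c' (k+1) $ Inr j) - U c (k+1) $ Inr j * cnj (\<theta> c' k j))
      \<le> norm (\<theta> c k j) * norm (U c' (k+1) $ Inr j) + norm (U c (k+1) $ Inr j) * norm (\<theta> c' k j)"
      by (rule order_trans[OF norm_triangle_ineq4]) (simp add: norm_mult)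
    also have "\<dots> \<le> (K2 * \<delta> k * ?u) * ?u' + ?u * (K2 * \<delta> k * ?u')"
      by (intro add_mono mult_mono \<theta>_le Finite_Cartesian_Product.norm_nth_le) (auto simp: K2)
    also have "\<dots> = K2 * \<delta> k * (2 * ?u * ?u')" by simp
    also have "\<dots> \<le> K2 * \<delta> k * (?u\<^sup>2 + ?u'\<^sup>2)"
      by (intro mult_left_mono sum_squares_bound) (auto simp: K2)
    also have "\<dots> = K2 * (\<delta> k * ?u\<^sup>2 + \<delta> k * ?u'\<^sup>2)" by (simp add: algebra_simps)
    also have "\<dots> \<le> K2 * (K * m c k + K * m c' k)"
      by (intro mult_left_mono add_mono left_value K2)
    finally have 1: "norm (\<theta> c k j * cnj (U c' (k+1) $ Inr j) - U c (k+1) $ Inr j * cnj (\<theta> c' k j))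
        \<le> K2 * K * (m c k + m c' k)" by (simp add: algebra_simps)
    have "norm ((cnj z - z) * I c c' k (Inr j)) \<le> 2 * (m c k + m c' k)"
    proof -
      have "cnj z - z = - (2 * Im z) * \<i>" by (simp add: complex_eq_iff)
      hence "norm (cnj z - z) = 2" using z by (simp add: norm_mult)
      thus ?thesis using I_le[of c c' k "Inr j"] by (simp add: norm_mult)
    qed
    with 1 show "norm (w c c' (k+1) (Inr j) - w c c' k (Inr j)) \<le> (2 + K2 * K) * (m c k + m c' k)"
      unfolding w_step distrib_right by (intro order_trans[OF norm_triangle_ineq] add_mono)
  qed
  hence "convergent (\<lambda>n. \<Sum>k<n. w c c' (Suc k) (Inr j) - w c c' k (Inr j))"
    by (simp add: summable_iff_convergent)
  hence "convergent (\<lambda>n. w c c' n (Inr j) - w c c' 0 (Inr j))"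
    by (subst (asm) sum_lessThan_telescope)
  hence "convergent (\<lambda>n. (w c c' n (Inr j) - w c c' 0 (Inr j)) + w c c' 0 (Inr j))"
    by (intro convergent_add convergent_const)
  thus ?thesis by simp
qed

text \<open>Replacing derivatives by difference quotients changes the boundary form by no more than
  a multiple of the energy on one interval. Hence the scalar criteria, which speak of the discrete
  Wronskian, decide the limit of \<open>w\<close>.\<close>

lemma w_minus_discrete:
  assumes "c \<in> D" "c' \<in> D"
  shows "(\<lambda>k. w c c' k j - (U c (k+1) $ j * cnj (U c' k $ j) - U c k $ j * cnj (U c' (k+1) $ j)) / \<delta> k) \<longlonglongrightarrow> 0"
proof (rule Lim_null_comparison)
  show "(\<lambda>k. (1 + K) * (m c k + m c' k)) \<longlonglongrightarrow> 0"
    using assms unfolding D_def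
    by (intro summable_LIMSEQ_zero summable_mult summable_add) auto
  have "norm (w c c' k j - (U c (k+1) $ j * cnj (U c' k $ j) - U c k $ j * cnj (U c' (k+1) $ j)) / \<delta> k)
      \<le> (1 + K) * (m c k + m c' k)" for k
  proof -
    have P: "P c k = slope c k + rerr c k" for c by (simp add: rerr_def)
    have "w c c' k j - (U c (k+1) $ j * cnj (U c' k $ j) - U c k $ j * cnj (U c' (k+1) $ j)) / \<delta> k
       = rerr c k $ j * cnj (U c' k $ j) - U c k $ j * cnj (rerr c' k $ j)"
      by (simp add: w_def P slope_nth diff_divide_distrib algebra_simps)
    also have "norm \<dots> \<le> norm (rerr c k $ j) * norm (U c' k $ j) + norm (U c k $ j) * norm (rerr c' k $ j)"
      by (rule order_trans[OF norm_triangle_ineq4]) (simp add: norm_mult)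
    also have "\<dots> \<le> norm (rerr c k) * norm (U c' k) + norm (rerr c' k) * norm (U c k)"
      by (subst (2) mult.commute) (intro add_mono mult_mono Finite_Cartesian_Product.norm_nth_le; simp)
    also have "\<dots> \<le> (m c k + K * m c' k) + (m c' k + K * m c k)"
    proof -
      have *: "norm (rerr c k) * norm (U c' k) \<le> m c k + K * m c' k" for c c'
      proof -
        have "norm (rerr c k) * norm (U c' k) = (norm (rerr c k) / sqrt (\<delta> k)) * (sqrt (\<delta> k) * norm (U c' k))"
          by simp
        also have "\<dots> \<le> ((norm (rerr c k) / sqrt (\<delta> k))\<^sup>2 + (sqrt (\<delta> k) * norm (U c' k))\<^sup>2) / 2"
          by (rule mult_le_half_squares)
        also have "\<dots> = ((norm (rerr c k))\<^sup>2 / \<delta> k + \<delta> k * (norm (U c' k))\<^sup>2) / 2"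
          by (simp add: power_mult_distrib power_divide)
        also have "\<dots> \<le> (m c k + K * m c' k) / 2"
          using rerr_le[of c k] right_value[of k c'] pos[of k]
          by (intro divide_right_mono add_mono) (auto simp: divide_le_eq mult.commute)
        also have "\<dots> \<le> m c k + K * m c' k"
          using m_nonneg[of c k] m_nonneg[of c' k] K by (simp add: add_divide_distrib add_mono)
        finally show ?thesis .
      qed
      show ?thesis by (intro add_mono * )
    qed
    finally show ?thesis by (simp add: algebra_simps)
  qed
  thus "\<forall>\<^sub>F k in sequentially. norm (w c c' k j - (U c (k+1) $ j * cnj (U c' k $ j) - U c k $ j * cnj (U c' (k+1) $ j)) / \<delta> k)
      \<le> (1 + K) * (m c k + m c' k)" by (rule always_eventually[OF allI])
qed

lemma w_tendsto_zero:
  assumes "c \<in> D" "c' \<in> D"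
  shows "(\<lambda>k. w c c' k (Inr j)) \<longlonglongrightarrow> 0"
proof -
  obtain l where l: "(\<lambda>k. w c c' k (Inr j)) \<longlonglongrightarrow> l"
    using w_convergent[OF assms] unfolding convergent_def by blast
  define a where "a k = U c k $ Inr j" for k
  \<comment> \<open>The conjugate of a solution satisfies the same scalar recursion, with conjugated
    residual, because \<open>\<alpha>\<close> is real; so \<open>w\<close> becomes a Wronskian of
    two solutions of one recursion.\<close>
  define b where "b k = cnj (U c' k $ Inr j)" for k
  define e' where "e' k = cnj (residual c' k j)" for k
  have lim: "(\<lambda>k. (a (k+1) * b k - a k * b (k+1)) / \<delta> k) \<longlonglongrightarrow> l"
    using tendsto_diff[OF l w_minus_discrete[OF assms, of "Inr j"]] unfolding a_def b_def by simp
  have eqa: "(a (k+2) - a (k+1)) / \<delta> (k+1) - (a (k+1) - a k) / \<delta> k = \<alpha> k j * a (k+1) + residual c k j" for k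
    unfolding a_def by (rule lower_equation)
  have eqb: "(b (k+2) - b (k+1)) / \<delta> (k+1) - (b (k+1) - b k) / \<delta> k = \<alpha> k j * b (k+1) + e' k" for k
    unfolding b_def e'_def using arg_cong[OF lower_equation[of c' k j], of cnj] by simp
  have suma: "summable (\<lambda>k. \<delta> k * (norm (a k))\<^sup>2)"
    unfolding a_def by (rule summable_values[OF assms(1)])
  have sumb: "summable (\<lambda>k. \<delta> k * (norm (b k))\<^sup>2)"
    using summable_values[OF assms(2)] by (simp add: b_def)
  have sume': "summable (\<lambda>k. (norm (e' k))\<^sup>2 / \<delta> k)"
    using summable_residual[OF assms(2)] by (simp add: e'_def)
  from \<alpha> have "l = 0"
  proof
    assume "\<forall>j. \<not> summable (\<lambda>k. \<bar>\<alpha> k j\<bar> * \<delta> k ^ 3)"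
    thus ?thesis
      using jacobi_wronskian_limit_zero_large_diagonal[OF eqa eqb suma sumb summable_residual[OF assms(1)] sume' lim]
      by blast
  next
    assume "\<exists>M>0. \<forall>k j. 4 / (\<delta> (k + 1))\<^sup>2 + \<alpha> k j / \<delta> (k + 1) \<le> M"
    thus ?thesis
      using jacobi_wronskian_limit_zero_semibounded[OF eqa eqb suma sumb summable_residual[OF assms(1)] sume' lim]
      by blast
  qed
  with l show ?thesis by simp
qed

text \<open>Single components exchange boundary form at an interaction, but the total is unchanged
  there since the interaction is hermitian. It starts at 0 because the derivative vanishes at the
  origin.\<close>

lemma total_wronskian:
  "(\<Sum>j\<in>UNIV. w c c k j) = (cnj z - z) * of_real (\<Sum>i<k. m c i)"
proof (induction k)
  case 0
  show ?case by (simp add: w_def P0)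
next
  case (Suc k)
  let ?U = "U c (k+1)"
  have "(\<Sum>j\<in>UNIV. (A k *v ?U) $ j * cnj (?U $ j) - ?U $ j * cnj ((A k *v ?U) $ j)) = 0"
    using cdot_hermitian[OF herm[of k], of ?U ?U] by (simp add: cdot_def sum_subtractf)
  moreover have "w c c (Suc k) j = w c c k j + (cnj z - z) * I c c k j
      + ((A k *v ?U) $ j * cnj (?U $ j) - ?U $ j * cnj ((A k *v ?U) $ j))" for j
    using green[of c k j c] by (simp add: w_def algebra_simps)
  ultimately have "(\<Sum>j\<in>UNIV. w c c (Suc k) j) = (\<Sum>j\<in>UNIV. w c c k j) + (cnj z - z) * (\<Sum>j\<in>UNIV. I c c k j)"
    by (simp add: sum.distrib sum_distrib_left)
  thus ?case using Suc.IH by (simp add: I_sum algebra_simps)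
qed

lemma norm_total_wronskian: "norm (\<Sum>j\<in>UNIV. w c c k j) = 2 * (\<Sum>i<k. m c i)"
proof -
  have "cnj z - z = - (2 * Im z) * \<i>" by (simp add: complex_eq_iff)
  hence "norm (cnj z - z) = 2" using z by (simp add: norm_mult)
  moreover have "0 \<le> (\<Sum>i<k. m c i)" using m_nonneg by (simp add: sum_nonneg)
  ultimately show ?thesis
    unfolding total_wronskian norm_mult by (simp only: norm_of_real abs_of_nonneg)
qed

lemma w_sum_scale:
  "w (\<Sum>i\<in>S. a i *s f i) (\<Sum>l\<in>S. a l *s f l) k j = (\<Sum>i\<in>S. \<Sum>l\<in>S. a i * cnj (a l) * w (f i) (f l) k j)"
proof -
  have U: "U (\<Sum>i\<in>S. a i *s f i) k $ j = (\<Sum>i\<in>S. a i * U (f i) k $ j)"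
    by (simp add: vec.linear_sum[OF linU] vec.linear_scale[OF linU])
  have P: "P (\<Sum>i\<in>S. a i *s f i) k $ j = (\<Sum>i\<in>S. a i * P (f i) k $ j)"
    by (simp add: vec.linear_sum[OF linP] vec.linear_scale[OF linP])
  show ?thesis
    unfolding w_def U P by (simp add: sum_product sum_subtractf[symmetric] algebra_simps)
qed

text \<open>Since \<open>D\<close> has finite dimension, the pointwise decay of the lower boundary
  forms is uniform on it. If the upper block of \<open>U c N\<close> vanishes, the whole boundary
  form at \<open>x_N\<close> is lower, hence smaller than the energy which \<open>c\<close> already
  has on the first interval.\<close>

lemma upper_injective_on_D:
  obtains N where "inj_on (\<lambda>c. upper (U c N)) D"
proof -
  \<comment> \<open>\<open>g\<close> is a linear projection onto \<open>D\<close>; the images of the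
    unit vectors generate \<open>D\<close>, with the coordinates of \<open>c\<close> itself as
    coefficients.\<close>
  obtain g where g: "range g \<subseteq> D" "Vector_Spaces.linear (*s) (*s) g" "\<And>c. c \<in> D \<Longrightarrow> g c = c"
    using vec.linear_exists_left_inverse_on[OF vec.linear_id subspace_D] by auto
  define f where "f i = g (axis i 1)" for i
  have f: "f i \<in> D" for i using g(1) by (auto simp: f_def)
  have expand: "c = (\<Sum>i\<in>UNIV. c $ i *s f i)" if "c \<in> D" for c
  proof -
    have "c = g (\<Sum>i\<in>UNIV. c $ i *s axis i 1)" using g(3)[OF that] by (simp add: basis_expansion)
    also have "\<dots> = (\<Sum>i\<in>UNIV. c $ i *s f i)"
      by (simp add: f_def vec.linear_sum[OF g(2)] vec.linear_scale[OF g(2)])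
    finally show ?thesis .
  qed
  define \<eta> where "\<eta> k = (\<Sum>i\<in>UNIV. \<Sum>l\<in>UNIV. \<Sum>j\<in>UNIV. norm (w (f i) (f l) k (Inr j)))" for k
  have "\<eta> \<longlonglongrightarrow> 0"
    unfolding \<eta>_def by (intro tendsto_null_sum tendsto_norm_zero w_tendsto_zero f)
  \<comment> \<open>Twice the energy on the first interval is at least
    \<open>2 * \<delta> 0 / K * (norm c)^2\<close>, by \<open>right_value\<close> at
    \<open>k = 0\<close>.\<close>
  moreover have "0 < 2 * \<delta> 0 / K" using pos K by simp
  ultimately have "\<forall>\<^sub>F k in sequentially. \<eta> k < 2 * \<delta> 0 / K"
    by (rule order_tendstoD(2))
  hence "\<forall>\<^sub>F k in sequentially. \<eta> k < 2 * \<delta> 0 / K \<and> k \<ge> 1"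
    by (intro eventually_conj eventually_ge_at_top)
  then obtain N where N: "\<eta> N < 2 * \<delta> 0 / K" "N \<ge> 1"
    by (auto simp: eventually_sequentially)
  have zero: "c = 0" if "c \<in> D" "upper (U c N) = 0" for c
  proof (rule ccontr)
    assume "c \<noteq> 0"
    have UN: "U c N $ Inl i = 0" for i using arg_cong[OF that(2), of "\<lambda>v. v $ i"] by simp
    have "2 * (\<delta> 0 * (norm c)\<^sup>2) / K \<le> 2 * m c 0"
      using right_value[of 0 c] K by (simp add: U0 field_simps)
    also have "m c 0 \<le> (\<Sum>i<N. m c i)"
      using N(2) m_nonneg by (intro member_le_sum) auto
    also have "2 * (\<Sum>i<N. m c i) = norm (\<Sum>j\<in>UNIV. w c c N j)"
      by (simp add: norm_total_wronskian)
    also have "(\<Sum>j\<in>UNIV. w c c N j) = (\<Sum>j\<in>UNIV. w c c N (Inr j))"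
      by (simp add: sum_UNIV_Plus w_def UN)
    also have "\<dots> = (\<Sum>j\<in>UNIV. \<Sum>i\<in>UNIV. \<Sum>l\<in>UNIV. c $ i * cnj (c $ l) * w (f i) (f l) N (Inr j))"
      by (subst (1 2) expand[OF that(1)]) (simp add: w_sum_scale)
    also have "norm \<dots> \<le> (\<Sum>j\<in>UNIV. \<Sum>i\<in>UNIV. \<Sum>l\<in>UNIV. (norm c)\<^sup>2 * norm (w (f i) (f l) N (Inr j)))"
      by (intro sum_norm_le) (auto simp: norm_mult power2_eq_square
          intro!: mult_right_mono mult_mono Finite_Cartesian_Product.norm_nth_le)
    also have "\<dots> = (norm c)\<^sup>2 * \<eta> N"
      unfolding \<eta>_def sum_distrib_left
      by (subst sum.swap, rule sum.cong[OF refl], rule sum.swap)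
    finally have "(norm c)\<^sup>2 * (2 * \<delta> 0 / K) \<le> (norm c)\<^sup>2 * \<eta> N" by (simp add: mult_ac)
    moreover have "0 < (norm c)\<^sup>2" using \<open>c \<noteq> 0\<close> by simp
    ultimately have "2 * \<delta> 0 / K \<le> \<eta> N" by (rule mult_le_cancel_left_pos[THEN iffD1, rotated])
    thus False using N(1) by simp
  qed
  have "inj_on (\<lambda>c. upper (U c N)) D"
  proof (rule inj_onI)
    fix c c' assume c: "c \<in> D" "c' \<in> D" and eq: "upper (U c N) = upper (U c' N)"
    have "upper (U (c - c') N) = 0"
      using eq by (simp add: vec.linear_diff[OF linU] vec_eq_iff)
    thus "c = c'" using zero[OF vec.subspace_diff[OF subspace_D c]] by simp
  qed
  thus thesis by (rule that)
qed

lemma linear_upper: "Vector_Spaces.linear (*s) (*s) upper"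
  by unfold_locales (simp_all add: vec_eq_iff algebra_simps)

lemma dim_D_le: "vec.dim D \<le> CARD('p1)"
proof -
  obtain N where N: "inj_on (\<lambda>c. upper (U c N)) D" by (rule upper_injective_on_D)
  have lin: "Vector_Spaces.linear (*s) (*s) (\<lambda>c. upper (U c N))"
    using Vector_Spaces.linear_compose[OF linU linear_upper] by (simp add: o_def)
  have "vec.span D = D" using subspace_D by (rule vec.span_eq_iff[THEN iffD2])
  hence "inj_on (\<lambda>c. upper (U c N)) (vec.span D)" using N by (simp only:)
  hence "vec.dim ((\<lambda>c. upper (U c N)) ` D) = vec.dim D"
    by (rule vec.dim_image_eq[OF lin])
  thus ?thesis using dim_subset_UNIV_cart_gen[of "(\<lambda>c. upper (U c N)) ` D"] by simp
qed

subsection \<open>The upper block is in the limit circle case\<close>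

text \<open>The coefficient of the middle value when the second difference is multiplied out; the
  free recursion is the case in which it vanishes, and the first summability hypothesis bounds the
  deviation from it.\<close>

definition r11 :: "nat \<Rightarrow> complex ^ 'p1 ^ 'p1"
  where "r11 k = block11 (A k) + mat (complex_of_real (1 / \<delta> k + 1 / \<delta> (k+1)))"

definition uerr :: "complex ^ ('p1 + 'p2) \<Rightarrow> nat \<Rightarrow> complex ^ 'p1"
  where "uerr c k = block12 (A k) *v lower (U c (k+1)) - upper (rerr c (k+1)) + upper (lerr c k)"

lemma upper_equation:
  "(1 / \<delta> (k+1)) *\<^sub>R upper (U c (k+2)) = r11 k *v upper (U c (k+1)) - (1 / \<delta> k) *\<^sub>R upper (U c k) + uerr c k"
proof -
  let ?U = "U c (k+1)"
  have "upper (A k *v ?U) = block11 (A k) *v upper ?U + block12 (A k) *v lower ?U"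
    by (simp add: vec_eq_iff matrix_vector_mult_def sum_UNIV_Plus block11_def block12_def)
  moreover have mat: "mat (complex_of_real t) *v v = t *\<^sub>R v" for t and v :: "complex ^ 'p1"
    by (simp add: vec_eq_iff matrix_vector_mult_def mat_def if_distrib[of "\<lambda>y. y * _"]
        scaleR_conv_of_real[where 'a = complex] cong: if_cong)
  moreover have "upper (slope c (k+1)) - upper (slope c k) = upper (A k *v ?U) - upper (rerr c (k+1)) + upper (lerr c k)"
    using arg_cong[OF slope_step[of c k], of upper] by (simp add: vec_eq_iff)
  moreover have "upper (slope c k) = (1 / \<delta> k) *\<^sub>R upper (U c (k+1)) - (1 / \<delta> k) *\<^sub>R upper (U c k)" for k
    by (simp add: slope_def vec_eq_iff algebra_simps)
  ultimately show ?thesis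
    unfolding r11_def uerr_def matrix_vector_mult_add_rdistrib mat
    by (simp add: algebra_simps scaleR_add_left)
qed

lemma uerr_le: "(norm (uerr c k))\<^sup>2 \<le> 3 * (K'\<^sup>2 * K + 1) * \<delta> k * (m c k + m c (k+1))"
  unfolding uerr_def
proof (rule residual_le)
  have "norm (block12 (A k) *v lower (U c (k+1))) \<le> opnorm (block12 (A k)) * norm (lower (U c (k+1)))"
    by (rule norm_matrix_vector_le_opnorm)
  also have "\<dots> \<le> K' * \<delta> k * norm (U c (k+1))"
    by (intro mult_mono block12 norm_lower_le K'\<delta>) auto
  finally show "norm (block12 (A k) *v lower (U c (k+1))) \<le> K' * \<delta> k * norm (U c (k+1))" .
qed (rule norm_upper_le)+

lemma upper_step:
  "norm (upper (U c (k+2))) \<le> \<delta> (k+1) * (opnorm (r11 k) * norm (upper (U c (k+1))) + norm (upper (U c k)) / \<delta> k + norm (uerr c k))"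
proof -
  have "norm (upper (U c (k+2))) = \<delta> (k+1) * norm ((1 / \<delta> (k+1)) *\<^sub>R upper (U c (k+2)))"
    by simp
  also have "norm ((1 / \<delta> (k+1)) *\<^sub>R upper (U c (k+2))) \<le>
      norm (r11 k *v upper (U c (k+1))) + norm ((1 / \<delta> k) *\<^sub>R upper (U c k)) + norm (uerr c k)"
    unfolding upper_equation
    by (intro order_trans[OF norm_triangle_ineq] add_right_mono norm_triangle_ineq4)
  also have "\<dots> \<le> opnorm (r11 k) * norm (upper (U c (k+1))) + norm (upper (U c k)) / \<delta> k + norm (uerr c k)"
    by (intro add_mono norm_matrix_vector_le_opnorm) auto
  finally show ?thesis by (simp add: mult_left_mono)
qed

text \<open>The boundary form is evaluated on the left of \<open>x_(N+1)\<close>, where it has the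
  same total value as on the right. A vanishing lower block of the solution removes the lower
  derivatives as well, although nothing is known about their size.\<close>

lemma energy_le_boundary:
  assumes "lower (U c (N+1)) = 0"
  shows "(\<Sum>k\<le>N. m c k) \<le> norm (upper (U c N)) * norm (upper (U c (N+1))) / \<delta> N
     + sqrt (\<delta> N * m c N) * norm (upper (U c (N+1)))"
proof -
  let ?U = "U c (N+1)"
  define L where "L = P c (N+1) - A N *v ?U"
  have "(\<Sum>j\<in>UNIV. w c c (N+1) j) = cdot (P c (N+1)) ?U - cdot ?U (P c (N+1))"
    by (simp add: w_def cdot_def sum_subtractf)
  also have "\<dots> = cdot L ?U - cdot ?U L"
  proof -
    have "cdot (P c (N+1)) ?U = cdot L ?U + cdot (A N *v ?U) ?U"
      by (simp add: L_def flip: cdot_add_left)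
    moreover have "cdot ?U (P c (N+1)) = cdot ?U L + cdot ?U (A N *v ?U)"
      by (subst (1 2 3) cdot_commute) (simp add: L_def flip: cdot_add_left complex_cnj_add)
    ultimately show ?thesis by (simp add: cdot_hermitian[OF herm])
  qed
  also have "\<dots> = cdot L ?U - cnj (cdot L ?U)" by (subst (2) cdot_commute) simp
  also have "\<dots> = of_real (2 * Im (cdot L ?U)) * \<i>" by (simp add: complex_eq_iff)
  finally have "2 * (\<Sum>i<N+1. m c i) = 2 * \<bar>Im (cdot L ?U)\<bar>"
    using norm_total_wronskian[of c "N+1"] by (simp add: norm_mult)
  hence "(\<Sum>i\<le>N. m c i) = \<bar>Im (cdot L ?U)\<bar>" by (simp add: lessThan_Suc_atMost)
  also have "cdot L ?U = cdot (upper L) (upper ?U)"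
    unfolding cdot_eq_upper_lower[of L ?U] assms by (simp add: cdot_def)
  also have "upper L = (1 / \<delta> N) *\<^sub>R upper ?U - (1 / \<delta> N) *\<^sub>R upper (U c N) + upper (lerr c N)"
    by (simp add: L_def lerr_def slope_def vec_eq_iff algebra_simps)
  \<comment> \<open>The product of \<open>upper ?U\<close> with itself is real, so of the difference
    quotient only the value at \<open>x_N\<close> contributes.\<close>
  also have "Im (cdot \<dots> (upper ?U)) = - Im (cdot (upper (U c N)) (upper ?U)) / \<delta> N + Im (cdot (upper (lerr c N)) (upper ?U))"
    by (simp add: cdot_add_left cdot_diff_left cdot_scaleR_left)
  also have "\<bar>\<dots>\<bar> \<le> \<bar>Im (cdot (upper (U c N)) (upper ?U))\<bar> / \<delta> N + \<bar>Im (cdot (upper (lerr c N)) (upper ?U))\<bar>"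
    by (rule order_trans[OF abs_triangle_ineq]) simp
  also have "\<dots> \<le> norm (upper (U c N)) * norm (upper ?U) / \<delta> N + sqrt (\<delta> N * m c N) * norm (upper ?U)"
  proof (intro add_mono divide_right_mono abs_Im_cdot_le)
    have "norm (upper (lerr c N)) \<le> norm (lerr c N)" by (rule norm_upper_le)
    also have "\<dots> \<le> sqrt (\<delta> N * m c N)" by (rule real_le_rsqrt[OF lerr_le])
    finally show "\<bar>Im (cdot (upper (lerr c N)) (upper ?U))\<bar> \<le> sqrt (\<delta> N * m c N) * norm (upper ?U)"
      by (intro order_trans[OF abs_Im_cdot_le] mult_right_mono) auto
  qed auto
  finally show ?thesis .
qed

lemma energy_uniformly_bounded:
  obtains M C where "0 \<le> C"
    "\<forall>c. \<forall>N\<ge>M. lower (U c (N+1)) = 0 \<longrightarrow> (\<Sum>k\<le>N. m c k) \<le> C * (norm c)\<^sup>2"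
proof -
  have sumr: "summable (\<lambda>k. \<delta> (k+1) * opnorm (r11 k))"
    using block11 by (simp add: r11_def)
  have G: "0 \<le> 3 * (K'\<^sup>2 * K + 1)" using K by simp
  obtain M C where "0 \<le> C" and
    C: "\<forall>v err m N. (\<forall>k. 0 \<le> v k) \<longrightarrow> (\<forall>k. 0 \<le> err k) \<longrightarrow> (\<forall>k. 0 \<le> m k) \<longrightarrow>
      (\<forall>k. v (k+2) \<le> \<delta> (k+1) * (opnorm (r11 k) * v (k+1) + v k / \<delta> k + err k)) \<longrightarrow>
      (\<forall>k. (err k)\<^sup>2 \<le> 3 * (K'\<^sup>2 * K + 1) * \<delta> k * (m k + m (k+1))) \<longrightarrow>
      M \<le> N \<longrightarrow> (\<Sum>k\<le>N. m k) \<le> v N * v (N+1) / \<delta> N + sqrt (\<delta> N * m N) * v (N+1) \<longrightarrow>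
      (\<Sum>k\<le>N. m k) \<le> C * (v M + v (M+1))\<^sup>2"
    by (rule energy_bound[OF opnorm_nonneg sumr G]) (rule that; assumption)
  obtain B1 where B1: "0 \<le> B1" "\<And>c. norm (U c M) \<le> B1 * norm c"
    using linear_vec_bounded[OF linU] by metis
  obtain B2 where B2: "0 \<le> B2" "\<And>c. norm (U c (M+1)) \<le> B2 * norm c"
    using linear_vec_bounded[OF linU] by metis
  show thesis
  proof (rule that[of "C * (B1 + B2)\<^sup>2" M]; (intro allI impI)?)
    show "0 \<le> C * (B1 + B2)\<^sup>2" using \<open>0 \<le> C\<close> by simp
    fix c N assume "M \<le> N" "lower (U c (N+1)) = 0"
    have "(\<Sum>k\<le>N. m c k) \<le> C * (norm (upper (U c M)) + norm (upper (U c (M+1))))\<^sup>2"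
      by (rule C[rule_format, where err = "\<lambda>k. norm (uerr c k)"])
        (rule norm_ge_zero m_nonneg upper_step uerr_le \<open>M \<le> N\<close> energy_le_boundary[OF \<open>lower _ = 0\<close>])+
    also have "\<dots> \<le> C * ((B1 + B2) * norm c)\<^sup>2"
    proof (intro mult_left_mono power_mono)
      show "norm (upper (U c M)) + norm (upper (U c (M+1))) \<le> (B1 + B2) * norm c"
        unfolding distrib_right
        by (intro add_mono order_trans[OF norm_upper_le] B1 B2)
    qed (use \<open>0 \<le> C\<close> in auto)
    finally show "(\<Sum>k\<le>N. m c k) \<le> C * (B1 + B2)\<^sup>2 * (norm c)\<^sup>2"
      by (simp add: power_mult_distrib mult_ac)
  qed
qed

lemma m_sum_le: "finite S \<Longrightarrow> m (\<Sum>i\<in>S. f i) k \<le> 2 ^ card S * (\<Sum>i\<in>S. m (f i) k)"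
proof (induction S rule: finite_induct)
  case empty
  show ?case by (simp add: m_zero)
next
  case (insert i S)
  have "m (\<Sum>i\<in>insert i S. f i) k \<le> 2 * (m (f i) k + m (\<Sum>i\<in>S. f i) k)"
    using insert.hyps m_add by simp
  also have "\<dots> \<le> 2 * (2 ^ card S * m (f i) k + 2 ^ card S * (\<Sum>i\<in>S. m (f i) k))"
    using insert.IH m_nonneg[of "f i" k] mult_right_mono[of 1 "2 ^ card S" "m (f i) k"] by (intro mult_left_mono add_mono) auto
  finally show ?case using insert.hyps by (simp add: algebra_simps)
qed

text \<open>Continuity of the energy on finitely many intervals, needed to pass to the limit of
  initial values; the constant may depend on \<open>n\<close>.\<close>

lemma partial_energy_bounded:
  "\<exists>B\<ge>0. \<forall>c. (\<Sum>k<n. m c k) \<le> B * (norm c)\<^sup>2"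
proof -
  let ?p = "CARD('p1 + 'p2)"
  define B where "B = (\<Sum>k<n. 2 ^ ?p * (\<Sum>i\<in>UNIV. m (axis i 1) k))"
  have "0 \<le> B" unfolding B_def by (intro sum_nonneg mult_nonneg_nonneg m_nonneg) auto
  have "m c k \<le> (norm c)\<^sup>2 * (2 ^ ?p * (\<Sum>i\<in>UNIV. m (axis i 1) k))" for c k
  proof -
    have "m c k = m (\<Sum>i\<in>UNIV. c $ i *s axis i 1) k" by (simp add: basis_expansion)
    also have "\<dots> \<le> 2 ^ ?p * (\<Sum>i\<in>UNIV. m (c $ i *s axis i 1) k)" by (rule m_sum_le) simp
    also have "\<dots> \<le> 2 ^ ?p * (\<Sum>i\<in>UNIV. (norm c)\<^sup>2 * m (axis i 1) k)"
      unfolding m_scale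
      by (intro mult_left_mono sum_mono mult_right_mono power_mono m_nonneg Finite_Cartesian_Product.norm_nth_le) auto
    also have "\<dots> = (norm c)\<^sup>2 * (2 ^ ?p * (\<Sum>i\<in>UNIV. m (axis i 1) k))"
      by (simp only: sum_distrib_left[symmetric] mult.left_commute)
    finally show ?thesis .
  qed
  hence "(\<Sum>k<n. m c k) \<le> (\<Sum>k<n. (norm c)\<^sup>2 * (2 ^ ?p * (\<Sum>i\<in>UNIV. m (axis i 1) k)))" for c
    by (rule sum_mono)
  hence "(\<Sum>k<n. m c k) \<le> B * (norm c)\<^sup>2" for c
    unfolding B_def sum_distrib_left[symmetric] by (subst mult.commute)
  with \<open>0 \<le> B\<close> show ?thesis by blast
qed

text \<open>If \<open>D\<close> were too small, some linear \<open>\<kappa>\<close> with fewer than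
  \<open>CARD('p1)\<close> conditions would be injective on \<open>D\<close>. Counting dimensions,
  for every \<open>N\<close> there is a unit vector killed by \<open>\<kappa>\<close> whose solution
  has vanishing lower block at \<open>x_N\<close>. By the uniform energy bound a limit of these unit
  vectors lies in \<open>D\<close>, while \<open>\<kappa>\<close> kills it: a contradiction.\<close>

lemma dim_D_ge: "CARD('p1) \<le> vec.dim D"
proof (rule ccontr)
  assume "\<not> ?thesis"
  hence less: "vec.dim D < CARD('p1)" by simp
  obtain B where B: "B \<subseteq> D" "vec.independent B" "vec.span B = D" "card B = vec.dim D"
    using vec.basis_subspace_exists[OF subspace_D] by metis
  have "finite B" using B(2) by (rule vec.finiteI_independent)
  \<comment> \<open>A coordinate kept out of the range of \<open>\<kappa>\<close>; it exists because
    \<open>D\<close> has a basis with fewer than \<open>CARD('p1)\<close> elements.\<close>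
  obtain j0 :: 'p1 where True by simp
  have "card B \<le> card (UNIV - {j0})"
    using less B(4) by (simp add: card_Diff_singleton)
  then obtain \<sigma> where \<sigma>: "\<sigma> ` B \<subseteq> UNIV - {j0}" "inj_on \<sigma> B"
    using card_le_inj[of B "UNIV - {j0}"] \<open>finite B\<close> by auto
  hence \<sigma>_j0: "\<sigma> b \<noteq> j0" if "b \<in> B" for b using that by blast
  define e where "e b = (axis (\<sigma> b) 1 :: complex ^ 'p1)" for b
  obtain \<kappa> where \<kappa>: "Vector_Spaces.linear (*s) (*s) \<kappa>" "\<And>b. b \<in> B \<Longrightarrow> \<kappa> b = e b"
    "range \<kappa> = vec.span (e ` B)"
    using vec.linear_independent_extend_subspace[OF B(2), of e] by auto
  have \<kappa>_j0: "\<kappa> c $ j0 = 0" for c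
  proof -
    have "vec.span (e ` B) \<subseteq> {v. v $ j0 = 0}"
      by (intro vec.span_minimal) (auto simp: e_def axis_def vec.subspace_def dest: \<sigma>_j0)
    thus ?thesis using \<kappa>(3) by blast
  qed
  have \<kappa>_inj: "c = 0" if "c \<in> D" "\<kappa> c = 0" for c
  proof -
    have img: "\<kappa> ` B = e ` B" using \<kappa>(2) by (intro image_cong) auto
    have "e ` B \<subseteq> cart_basis" by (auto simp: e_def cart_basis_def)
    hence "vec.independent (\<kappa> ` B)"
      unfolding img by (rule vec.independent_mono[OF vec.independent_Basis])
    moreover have "inj_on \<kappa> B"
      using \<sigma>(2) \<kappa>(2) by (auto simp: inj_on_def e_def axis_eq_axis)
    ultimately have "inj_on \<kappa> (vec.span B)"
      using vec.linear_inj_on_span_independent_image[OF \<kappa>(1)] by blast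
    thus ?thesis
      using inj_onD[of \<kappa> "vec.span B" c 0] that vec.linear_0[OF \<kappa>(1)] vec.subspace_0[OF subspace_D]
      by (simp add: B(3))
  qed
  have test: "\<exists>c. norm c = 1 \<and> \<kappa> c = 0 \<and> lower (U c N) = 0" for N
  proof -
    \<comment> \<open>The conditions on \<open>\<kappa> c\<close> and on the lower block form one
      endomorphism of the whole space. It misses the unit vector at \<open>Inl j0\<close>, so it has
      a nontrivial kernel.\<close>
    define T where "T c = (\<chi> i. case i of Inl i \<Rightarrow> \<kappa> c $ i | Inr j \<Rightarrow> U c N $ Inr j)" for c
    have lin: "Vector_Spaces.linear (*s) (*s) T"
      by unfold_locales
        (simp_all add: vec_eq_iff T_def distrib_left distrib_right mult.assoc vec.linear_add[OF \<kappa>(1)] vec.linear_add[OF linU]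
          vec.linear_scale[OF \<kappa>(1)] vec.linear_scale[OF linU] split: sum.split)
    have "axis (Inl j0) 1 \<notin> range T"
    proof
      assume "axis (Inl j0) 1 \<in> range T"
      then obtain c where "axis (Inl j0) 1 = T c" by blast
      from arg_cong[OF this, of "\<lambda>v. v $ Inl j0"] show False
        by (simp add: T_def \<kappa>_j0)
    qed
    hence "\<not> inj T" using vec.linear_inj_imp_surj[OF lin] by auto
    then obtain c where c: "c \<noteq> 0" "T c = 0"
      unfolding vec.linear_inj_iff_eq_0[OF lin] by blast
    define c' where "c' = of_real (1 / norm c) *s c"
    have "T c' = 0" using c by (simp add: c'_def vec.linear_scale[OF lin])
    hence 0: "T c' $ i = 0" for i by simp
    have "\<kappa> c' = 0"
      using 0[of "Inl i" for i] unfolding vec_eq_iff T_def by simp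
    moreover have "lower (U c' N) = 0"
      using 0[of "Inr i" for i] unfolding vec_eq_iff T_def by simp
    moreover have "norm c' = 1" using c(1) by (simp add: c'_def norm_scale_vec norm_divide)
    ultimately show ?thesis by blast
  qed
  obtain M C where C: "0 \<le> C"
    "\<forall>c. \<forall>N\<ge>M. lower (U c (N+1)) = 0 \<longrightarrow> (\<Sum>k\<le>N. m c k) \<le> C * (norm c)\<^sup>2"
    by (rule energy_uniformly_bounded) (rule that; assumption)
  have "\<forall>n. \<exists>c. norm c = 1 \<and> \<kappa> c = 0 \<and> lower (U c (M + n + 1)) = 0"
    by (rule allI) (rule test)
  from choice[OF this] obtain s
    where "\<forall>n. norm (s n) = 1 \<and> \<kappa> (s n) = 0 \<and> lower (U (s n) (M + n + 1)) = 0" ..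
  hence s: "\<And>n. norm (s n) = 1" "\<And>n. \<kappa> (s n) = 0" "\<And>n. lower (U (s n) (M + n + 1)) = 0"
    by simp_all
  have "seq_compact (sphere (0 :: complex ^ ('p1 + 'p2)) 1)"
    by (rule compact_imp_seq_compact[OF compact_sphere])
  moreover have "\<forall>n. s n \<in> sphere 0 1" using s(1) by simp
  ultimately obtain l r where l: "l \<in> sphere 0 1" and r: "strict_mono r" and lim: "(s \<circ> r) \<longlonglongrightarrow> l"
    by (rule seq_compactE)
  have "(\<lambda>i. \<kappa> ((s \<circ> r) i)) \<longlonglongrightarrow> \<kappa> l"
    by (rule continuous_on_tendsto_compose[OF linear_vec_continuous[OF \<kappa>(1), of UNIV] lim]) simp_all
  hence "\<kappa> l = 0" using s(2) by (simp add: LIMSEQ_const_iff)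
  moreover have "l \<in> D"
  proof -
    have "(\<Sum>k<n. m l k) \<le> 2 * C + 2" for n
    proof -
      obtain B where B: "0 \<le> B" "\<And>c. (\<Sum>k<n. m c k) \<le> B * (norm c)\<^sup>2"
        using partial_energy_bounded[of n] by metis
      have "(\<lambda>i. B * (norm (l - (s \<circ> r) i))\<^sup>2) \<longlonglongrightarrow> B * (norm (l - l))\<^sup>2"
        by (intro tendsto_intros lim)
      hence "\<forall>\<^sub>F i in sequentially. B * (norm (l - (s \<circ> r) i))\<^sup>2 < 1"
        by (intro order_tendstoD(2)) auto
      hence "\<forall>\<^sub>F i in sequentially. B * (norm (l - (s \<circ> r) i))\<^sup>2 < 1 \<and> i \<ge> n"
        by (intro eventually_conj eventually_ge_at_top)
      then obtain i where i: "B * (norm (l - s (r i)))\<^sup>2 < 1" "i \<ge> n"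
        by (auto simp: eventually_sequentially)
      \<comment> \<open>Since \<open>r i \<ge> n\<close>, the energy bound for
        \<open>s (r i)\<close>, valid up to the index \<open>M + r i\<close>, covers the first
        \<open>n\<close> intervals.\<close>
      have "i \<le> r i" using r by (rule seq_suble)
      have "(\<Sum>k<n. m (s (r i)) k) \<le> (\<Sum>k\<le>M + r i. m (s (r i)) k)"
        using i(2) \<open>i \<le> r i\<close> m_nonneg by (intro sum_mono2) auto
      also have "\<dots> \<le> C" using C(2)[rule_format, of "M + r i" "s (r i)"] s by simp
      finally have 1: "(\<Sum>k<n. m (s (r i)) k) \<le> C" .
      have "(\<Sum>k<n. m l k) \<le> (\<Sum>k<n. 2 * (m (s (r i)) k + m (l - s (r i)) k))"
        using m_add[of "s (r i)" "l - s (r i)"] by (intro sum_mono) simp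
      also have "\<dots> = 2 * (\<Sum>k<n. m (s (r i)) k) + 2 * (\<Sum>k<n. m (l - s (r i)) k)"
        by (simp add: sum.distrib sum_distrib_left)
      also have "\<dots> \<le> 2 * C + 2"
        using 1 B(2)[of "l - s (r i)"] i(1) by (intro add_mono) auto
      finally show ?thesis .
    qed
    thus ?thesis unfolding D_def using m_nonneg by (auto intro: summableI_nonneg_bounded)
  qed
  ultimately have "l = 0" using \<kappa>_inj by blast
  with l show False by simp
qed

theorem dim_D: "vec.dim D = CARD('p1)"
  using dim_D_le dim_D_ge by (rule antisym)

end

subsection \<open>Solutions on a single interval\<close>

text \<open>The integral of \<open>(g - y)^2\<close> is nonnegative for the mean value
  \<open>y\<close> of \<open>g\<close>.\<close>

lemma integral_square_bound:
  fixes g :: "real \<Rightarrow> real"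
  assumes "a < b" and g: "continuous_on {a..b} g"
  shows "(integral {a..b} g)\<^sup>2 \<le> (b - a) * integral {a..b} (\<lambda>t. (g t)\<^sup>2)"
proof -
  define d where "d = b - a"
  define y where "y = integral {a..b} g / d"
  have "d > 0" using assms by (simp add: d_def)
  have int: "g integrable_on {a..b}" "(\<lambda>t. (g t)\<^sup>2) integrable_on {a..b}"
    by (intro integrable_continuous_interval continuous_intros g)+
  have "((\<lambda>t. (g t)\<^sup>2 - 2 * y * g t + y\<^sup>2) has_integral
      (integral {a..b} (\<lambda>t. (g t)\<^sup>2) - 2 * y * integral {a..b} g + measure lborel {a..b} *\<^sub>R y\<^sup>2)) {a..b}"
    by (intro has_integral_add has_integral_diff has_integral_mult_right has_integral_const_real integrable_integral int)
  moreover have "0 \<le> (g t)\<^sup>2 - 2 * y * g t + y\<^sup>2" for t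
    using zero_le_power2[of "g t - y"] by (simp add: power2_diff algebra_simps)
  ultimately have "0 \<le> integral {a..b} (\<lambda>t. (g t)\<^sup>2) - 2 * y * integral {a..b} g + measure lborel {a..b} *\<^sub>R y\<^sup>2"
    by (rule has_integral_nonneg)
  also have "measure lborel {a..b} *\<^sub>R y\<^sup>2 = d * y\<^sup>2"
    using \<open>a < b\<close> by (simp add: d_def)
  also have "integral {a..b} (\<lambda>t. (g t)\<^sup>2) - 2 * y * integral {a..b} g + d * y\<^sup>2 = integral {a..b} (\<lambda>t. (g t)\<^sup>2) - (integral {a..b} g)\<^sup>2 / d"
    using \<open>d > 0\<close> by (simp add: y_def power2_eq_square field_simps)
  finally show ?thesis using \<open>d > 0\<close> by (simp add: d_def field_simps)
qed

definition solves_on :: "real set \<Rightarrow> complex \<Rightarrow> (real \<Rightarrow> complex ^ 'n) \<Rightarrow> (real \<Rightarrow> complex ^ 'n) \<Rightarrow> bool"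
  where "solves_on S z u u1 \<longleftrightarrow> (\<forall>t\<in>S. (u has_vector_derivative u1 t) (at t within S) \<and>
    (u1 has_vector_derivative (- z) *s u t) (at t within S))"

lemma solves_on_continuous:
  assumes "solves_on S z u u1"
  shows "continuous_on S u" "continuous_on S u1"
  using assms unfolding solves_on_def
  by (auto intro!: continuous_on_vector_derivative)

lemma bounded_linear_scale_left: "bounded_linear (\<lambda>a::complex. a *s (v :: complex ^ 'n))"
proof (rule bounded_linear_intro[where K = "norm v"])
  show "(r *\<^sub>R a) *s v = r *\<^sub>R (a *s v)" for r a
    by (simp add: vec_eq_iff)
qed (simp_all add: vector_sadd_rdistrib norm_scale_vec)

lemma bounded_linear_scale_right: "bounded_linear (\<lambda>v. (c::complex) *s (v :: complex ^ 'n))"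
proof (rule bounded_linear_intro[where K = "norm c"])
  show "c *s (r *\<^sub>R v) = r *\<^sub>R (c *s v)" for r and v :: "complex ^ 'n"
    by (simp add: vec_eq_iff)
qed (simp_all add: vector_add_ldistrib norm_scale_vec mult.commute)

lemma continuous_on_scale_vec [continuous_intros]:
  "continuous_on S f \<Longrightarrow> continuous_on S (\<lambda>t. c *s f t)" for c :: complex
  by (rule bounded_linear.continuous_on[OF bounded_linear_scale_right])

text \<open>The derivative of \<open>\<eta> u' - \<eta>' u\<close> is
  \<open>- z \<eta> u - \<eta>'' u\<close>, without derivatives of \<open>u\<close>. Each boundary
  functional of this shape is thus bounded by the energy alone, and a suitable polynomial
  \<open>\<eta>\<close> singles out the functional wanted.\<close>

lemma solution_test_function_bound:
  fixes u u1 :: "real \<Rightarrow> complex ^ 'n" and \<eta> \<eta>' \<eta>'' :: "real \<Rightarrow> real"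
  assumes "a < b" and z: "norm z = 1" and u: "solves_on {a..b} z u u1"
    and \<eta>: "\<And>t. (\<eta> has_vector_derivative \<eta>' t) (at t within {a..b})"
    and \<eta>': "\<And>t. (\<eta>' has_vector_derivative \<eta>'' t) (at t within {a..b})"
    and B: "\<And>t. t \<in> {a..b} \<Longrightarrow> \<bar>\<eta> t\<bar> + \<bar>\<eta>'' t\<bar> \<le> B"
  shows "(norm ((\<eta> b *\<^sub>R u1 b - \<eta>' b *\<^sub>R u b) - (\<eta> a *\<^sub>R u1 a - \<eta>' a *\<^sub>R u a)))\<^sup>2
     \<le> B\<^sup>2 * (b - a) * integral {a..b} (\<lambda>t. (norm (u t))\<^sup>2)"
proof -
  define F where "F t = \<eta> t *\<^sub>R u1 t - \<eta>' t *\<^sub>R u t" for t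
  define G where "G t = \<eta> t *\<^sub>R ((- z) *s u t) - \<eta>'' t *\<^sub>R u t" for t
  have cu: "continuous_on {a..b} u" by (rule solves_on_continuous[OF u])
  have "B \<ge> 0" using B[of a] \<open>a < b\<close> by simp
  have "(F has_vector_derivative G t) (at t within {a..b})" if "t \<in> {a..b}" for t
  proof -
    have "(F has_vector_derivative ((\<eta> t *\<^sub>R ((- z) *s u t) + \<eta>' t *\<^sub>R u1 t) - (\<eta>' t *\<^sub>R u1 t + \<eta>'' t *\<^sub>R u t))) (at t within {a..b})"
      unfolding F_def using u that unfolding solves_on_def
      by (intro has_vector_derivative_diff has_vector_derivative_scaleR
          \<eta>[unfolded has_real_derivative_iff_has_vector_derivative[symmetric]]
          \<eta>'[unfolded has_real_derivative_iff_has_vector_derivative[symmetric]]) auto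
    thus ?thesis by (simp add: G_def)
  qed
  hence G: "(G has_integral (F b - F a)) {a..b}"
    using \<open>a < b\<close> by (intro fundamental_theorem_of_calculus) auto
  have G_le: "norm (G t) \<le> B * norm (u t)" if "t \<in> {a..b}" for t
  proof -
    have "norm (G t) \<le> \<bar>\<eta> t\<bar> * norm (u t) + \<bar>\<eta>'' t\<bar> * norm (u t)"
      unfolding G_def using norm_scale_vec[of "- z" "u t"] z
      by (intro order_trans[OF norm_triangle_ineq4]) simp
    also have "\<dots> \<le> B * norm (u t)"
      unfolding distrib_right[symmetric] by (intro mult_right_mono B that) simp
    finally show ?thesis .
  qed
  have "norm (integral {a..b} G) \<le> integral {a..b} (\<lambda>t. B * norm (u t))"
    by (rule integral_norm_bound_integral[OF has_integral_integrable[OF G] _ G_le])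
      (intro integrable_continuous_interval continuous_intros cu)
  hence "norm (F b - F a) \<le> integral {a..b} (\<lambda>t. B * norm (u t))"
    by (simp only: integral_unique[OF G])
  also have "\<dots> = B * integral {a..b} (\<lambda>t. norm (u t))" by simp
  finally have "(norm (F b - F a))\<^sup>2 \<le> (B * integral {a..b} (\<lambda>t. norm (u t)))\<^sup>2"
    by (intro power_mono) auto
  also have "\<dots> \<le> B\<^sup>2 * ((b - a) * integral {a..b} (\<lambda>t. (norm (u t))\<^sup>2))"
    unfolding power_mult_distrib
    by (intro mult_left_mono integral_square_bound continuous_intros cu \<open>a < b\<close>) auto
  finally show ?thesis by (simp add: F_def mult.assoc)
qed

lemma poly_derivative_intro:
  "(f has_field_derivative f') (at t within S) \<Longrightarrow> f' = g \<Longrightarrow> (f has_vector_derivative g) (at t within S)"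
  for f :: "real \<Rightarrow> real"
  by (simp add: has_real_derivative_iff_has_vector_derivative)

text \<open>The linear test functions \<open>b - t\<close> and \<open>t - a\<close> isolate the
  derivative at the left and at the right end, together with the difference of the values.\<close>

lemma solution_slope_bounds:
  fixes u u1 :: "real \<Rightarrow> complex ^ 'n"
  assumes "a < b" and z: "norm z = 1" and u: "solves_on {a..b} z u u1"
  shows "(norm (u1 a - (1 / (b - a)) *\<^sub>R (u b - u a)))\<^sup>2 \<le> (b - a) * integral {a..b} (\<lambda>t. (norm (u t))\<^sup>2)"
    and "(norm (u1 b - (1 / (b - a)) *\<^sub>R (u b - u a)))\<^sup>2 \<le> (b - a) * integral {a..b} (\<lambda>t. (norm (u t))\<^sup>2)"
proof -
  define d where "d = b - a"
  have "d > 0" using \<open>a < b\<close> by (simp add: d_def)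
  let ?m = "integral {a..b} (\<lambda>t. (norm (u t))\<^sup>2)"
  have scale: "(norm (v - (1 / d) *\<^sub>R (u b - u a)))\<^sup>2 \<le> d * ?m"
    if "(norm w)\<^sup>2 \<le> d\<^sup>2 * d * ?m" "d *\<^sub>R v - (u b - u a) = s *\<^sub>R w" "\<bar>s\<bar> = 1" for v w s
  proof -
    have "v - (1 / d) *\<^sub>R (u b - u a) = (1 / d) *\<^sub>R (s *\<^sub>R w)"
      unfolding that(2)[symmetric] using \<open>d > 0\<close> by (simp add: algebra_simps)
    hence "(norm (v - (1 / d) *\<^sub>R (u b - u a)))\<^sup>2 = (norm w)\<^sup>2 / d\<^sup>2"
      using that(3) \<open>d > 0\<close> by (simp add: power_divide)
    also have "\<dots> \<le> d\<^sup>2 * d * ?m / d\<^sup>2"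
      using that(1) by (intro divide_right_mono) auto
    finally show ?thesis using \<open>d > 0\<close> by simp
  qed
  have "(norm (((b - b) *\<^sub>R u1 b - (- 1) *\<^sub>R u b) - ((b - a) *\<^sub>R u1 a - (- 1) *\<^sub>R u a)))\<^sup>2 \<le> d\<^sup>2 * (b - a) * ?m"
    by (rule solution_test_function_bound[OF assms, where \<eta>'' = "\<lambda>_. 0"])
      (auto intro!: poly_derivative_intro derivative_eq_intros simp: d_def)
  from scale[where s = "-1", OF this[folded d_def]]
  show "(norm (u1 a - (1 / (b - a)) *\<^sub>R (u b - u a)))\<^sup>2 \<le> (b - a) * ?m"
    by (simp add: d_def algebra_simps)
  have "(norm (((b - a) *\<^sub>R u1 b - 1 *\<^sub>R u b) - ((a - a) *\<^sub>R u1 a - 1 *\<^sub>R u a)))\<^sup>2 \<le> d\<^sup>2 * (b - a) * ?m"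
    by (rule solution_test_function_bound[OF assms, where \<eta>'' = "\<lambda>_. 0"])
      (auto intro!: poly_derivative_intro derivative_eq_intros simp: d_def)
  from scale[where s = 1, OF this[folded d_def]]
  show "(norm (u1 b - (1 / (b - a)) *\<^sub>R (u b - u a)))\<^sup>2 \<le> (b - a) * ?m"
    by (simp add: d_def algebra_simps)
qed

text \<open>The test function is the cubic with value 0 at both ends and derivative 0 at one end,
  with derivative of modulus 1 at the other, where the value of \<open>u\<close> is extracted. On an
  interval of length \<open>d\<close> it is at most \<open>d\<close> and its second derivative at
  most \<open>4 / d\<close>, whence the factor \<open>d^2 + 4\<close>.\<close>

lemma solution_value_bounds:
  fixes u u1 :: "real \<Rightarrow> complex ^ 'n"
  assumes "a < b" and z: "norm z = 1" and u: "solves_on {a..b} z u u1"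
  shows "(b - a) * (norm (u a))\<^sup>2 \<le> ((b - a)\<^sup>2 + 4)\<^sup>2 * integral {a..b} (\<lambda>t. (norm (u t))\<^sup>2)"
    and "(b - a) * (norm (u b))\<^sup>2 \<le> ((b - a)\<^sup>2 + 4)\<^sup>2 * integral {a..b} (\<lambda>t. (norm (u t))\<^sup>2)"
proof -
  define d where "d = b - a"
  have "d > 0" using \<open>a < b\<close> by (simp add: d_def)
  let ?m = "integral {a..b} (\<lambda>t. (norm (u t))\<^sup>2)"
  have fin: "d * (norm v)\<^sup>2 \<le> (d\<^sup>2 + 4)\<^sup>2 * ?m" if "(norm v)\<^sup>2 \<le> (d + 4 / d)\<^sup>2 * d * ?m" for v :: "complex ^ 'n"
  proof -
    have "d * (norm v)\<^sup>2 \<le> d * ((d + 4 / d)\<^sup>2 * d * ?m)"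
      using that \<open>d > 0\<close> by (intro mult_left_mono) auto
    also have "\<dots> = (d * (d + 4 / d))\<^sup>2 * ?m" by (simp add: power2_eq_square algebra_simps)
    also have "d * (d + 4 / d) = d\<^sup>2 + 4" using \<open>d > 0\<close> by (simp add: power2_eq_square distrib_left)
    finally show ?thesis .
  qed
  have bound: "\<bar>s * r * r / d\<^sup>2\<bar> + \<bar>(2 * y - 4 * y') / d\<^sup>2\<bar> \<le> d + 4 / d"
    if "0 \<le> s" "s \<le> d" "0 \<le> r" "r \<le> d" "0 \<le> y" "y \<le> d" "0 \<le> y'" "y' \<le> d" for s r y y'
  proof -
    have "s * r * r \<le> d * d * d" using that by (intro mult_mono) auto
    hence "s * r * r / d\<^sup>2 \<le> d" using \<open>d > 0\<close> by (simp add: field_simps power2_eq_square)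
    moreover have "\<bar>2 * y - 4 * y'\<bar> \<le> 4 * d" using that by linarith
    hence "\<bar>(2 * y - 4 * y') / d\<^sup>2\<bar> \<le> 4 / d" using \<open>d > 0\<close> by (simp add: abs_divide field_simps power2_eq_square)
    ultimately show ?thesis using that by simp
  qed
  let ?\<eta> = "\<lambda>t. (t - a) * (b - t) * (b - t) / d\<^sup>2"
  let ?\<eta>1 = "\<lambda>t. ((b - t) * (b - t) - 2 * (t - a) * (b - t)) / d\<^sup>2"
  let ?\<eta>2 = "\<lambda>t. (2 * (t - a) - 4 * (b - t)) / d\<^sup>2"
  have "(norm ((?\<eta> b *\<^sub>R u1 b - ?\<eta>1 b *\<^sub>R u b) - (?\<eta> a *\<^sub>R u1 a - ?\<eta>1 a *\<^sub>R u a)))\<^sup>2 \<le> (d + 4 / d)\<^sup>2 * (b - a) * ?m"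
  proof (rule solution_test_function_bound[OF assms, where \<eta>'' = ?\<eta>2])
    show "(?\<eta> has_vector_derivative ?\<eta>1 t) (at t within {a..b})" for t
      by (rule has_real_derivative_iff_has_vector_derivative[THEN iffD1])
        (use \<open>d > 0\<close> in \<open>auto intro!: derivative_eq_intros simp: field_simps\<close>)
    show "(?\<eta>1 has_vector_derivative ?\<eta>2 t) (at t within {a..b})" for t
      by (rule has_real_derivative_iff_has_vector_derivative[THEN iffD1])
        (use \<open>d > 0\<close> in \<open>auto intro!: derivative_eq_intros simp: field_simps\<close>)
    show "\<bar>?\<eta> t\<bar> + \<bar>?\<eta>2 t\<bar> \<le> d + 4 / d" if "t \<in> {a..b}" for t
      using that by (intro bound) (auto simp: d_def)
  qed
  also have "((?\<eta> b *\<^sub>R u1 b - ?\<eta>1 b *\<^sub>R u b) - (?\<eta> a *\<^sub>R u1 a - ?\<eta>1 a *\<^sub>R u a)) = u a"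
    using \<open>d > 0\<close> by (simp add: d_def power2_eq_square)
  finally show "(b - a) * (norm (u a))\<^sup>2 \<le> ((b - a)\<^sup>2 + 4)\<^sup>2 * ?m"
    using fin by (simp add: d_def)
  let ?\<eta> = "\<lambda>t. (b - t) * (t - a) * (t - a) / d\<^sup>2"
  let ?\<eta>1 = "\<lambda>t. (2 * (b - t) * (t - a) - (t - a) * (t - a)) / d\<^sup>2"
  let ?\<eta>2 = "\<lambda>t. (2 * (b - t) - 4 * (t - a)) / d\<^sup>2"
  have "(norm ((?\<eta> b *\<^sub>R u1 b - ?\<eta>1 b *\<^sub>R u b) - (?\<eta> a *\<^sub>R u1 a - ?\<eta>1 a *\<^sub>R u a)))\<^sup>2 \<le> (d + 4 / d)\<^sup>2 * (b - a) * ?m"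
  proof (rule solution_test_function_bound[OF assms, where \<eta>'' = ?\<eta>2])
    show "(?\<eta> has_vector_derivative ?\<eta>1 t) (at t within {a..b})" for t
      by (rule has_real_derivative_iff_has_vector_derivative[THEN iffD1])
        (use \<open>d > 0\<close> in \<open>auto intro!: derivative_eq_intros simp: field_simps\<close>)
    show "(?\<eta>1 has_vector_derivative ?\<eta>2 t) (at t within {a..b})" for t
      by (rule has_real_derivative_iff_has_vector_derivative[THEN iffD1])
        (use \<open>d > 0\<close> in \<open>auto intro!: derivative_eq_intros simp: field_simps\<close>)
    show "\<bar>?\<eta> t\<bar> + \<bar>?\<eta>2 t\<bar> \<le> d + 4 / d" if "t \<in> {a..b}" for t
      using that by (intro bound) (auto simp: d_def)
  qed
  also have "((?\<eta> b *\<^sub>R u1 b - ?\<eta>1 b *\<^sub>R u b) - (?\<eta> a *\<^sub>R u1 a - ?\<eta>1 a *\<^sub>R u a)) = u b"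
    using \<open>d > 0\<close> by (simp add: d_def power2_eq_square)
  finally show "(b - a) * (norm (u b))\<^sup>2 \<le> ((b - a)\<^sup>2 + 4)\<^sup>2 * ?m"
    using fin by (simp add: d_def)
qed

lemma has_vector_derivative_nth:
  "(u has_vector_derivative u') F \<Longrightarrow> ((\<lambda>t. u t $ j) has_vector_derivative u' $ j) F"
  for u :: "real \<Rightarrow> complex ^ 'n"
  by (rule bounded_linear.has_vector_derivative[OF bounded_linear_vec_nth])

lemma solution_green:
  fixes u u1 v v1 :: "real \<Rightarrow> complex ^ 'n"
  assumes "a < b" and u: "solves_on {a..b} z u u1" and v: "solves_on {a..b} z v v1"
  shows "(u1 b $ j * cnj (v b $ j) - u b $ j * cnj (v1 b $ j)) - (u1 a $ j * cnj (v a $ j) - u a $ j * cnj (v1 a $ j))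
    = (cnj z - z) * integral {a..b} (\<lambda>t. u t $ j * cnj (v t $ j))"
proof -
  let ?F = "\<lambda>t. u1 t $ j * cnj (v t $ j) - u t $ j * cnj (v1 t $ j)"
  have "(?F has_vector_derivative (cnj z - z) * (u t $ j * cnj (v t $ j))) (at t within {a..b})" if "t \<in> {a..b}" for t
  proof -
    have "(?F has_vector_derivative (u1 t $ j * cnj (v1 t $ j) + ((- z) *s u t) $ j * cnj (v t $ j))
       - (u t $ j * cnj (((- z) *s v t) $ j) + u1 t $ j * cnj (v1 t $ j))) (at t within {a..b})"
      using u v that unfolding solves_on_def
      by (intro has_vector_derivative_diff has_vector_derivative_mult has_vector_derivative_cnj has_vector_derivative_nth) auto
    thus ?thesis by (simp add: algebra_simps)
  qed
  hence "((\<lambda>t. (cnj z - z) * (u t $ j * cnj (v t $ j))) has_integral (?F b - ?F a)) {a..b}"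
    using \<open>a < b\<close> by (intro fundamental_theorem_of_calculus) auto
  from integral_unique[OF this] show ?thesis by simp
qed

subsection \<open>The fundamental solutions\<close>

text \<open>\<open>cs z\<close> and \<open>sn z\<close> are \<open>cos (w t)\<close> and
  \<open>sin (w t) / w\<close> with \<open>w^2 = z\<close>: the solutions of
  \<open>- y'' = z y\<close> with initial data (1,0) and (0,1). Both are even in \<open>w\<close>,
  so the branch chosen by \<open>csqrt\<close> is immaterial.\<close>

definition cs :: "complex \<Rightarrow> real \<Rightarrow> complex"
  where "cs z t = cosh (csqrt (- z) * of_real t)"

definition sn :: "complex \<Rightarrow> real \<Rightarrow> complex"
  where "sn z t = sinh (csqrt (- z) * of_real t) / csqrt (- z)"

lemma cs_0 [simp]: "cs z 0 = 1" and sn_0 [simp]: "sn z 0 = 0"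
  by (simp_all add: cs_def sn_def)

lemma cs_deriv: "z \<noteq> 0 \<Longrightarrow> (cs z has_vector_derivative (- z * sn z t)) (at t within S)"
  and sn_deriv: "z \<noteq> 0 \<Longrightarrow> (sn z has_vector_derivative cs z t) (at t within S)"
proof -
  assume "z \<noteq> 0"
  let ?\<omega> = "csqrt (- z)"
  have \<omega>: "?\<omega> * ?\<omega> = - z" "?\<omega> \<noteq> 0"
    using power2_csqrt[of "- z"] \<open>z \<noteq> 0\<close> by (auto simp: power2_eq_square)
  have "((\<lambda>y. cosh (?\<omega> * y)) has_field_derivative sinh (?\<omega> * of_real t) * ?\<omega>) (at (of_real t))"
    "((\<lambda>y. sinh (?\<omega> * y) / ?\<omega>) has_field_derivative cosh (?\<omega> * of_real t)) (at (of_real t))"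
    using \<omega>(2) by (auto intro!: derivative_eq_intros)
  note this[THEN has_vector_derivative_real_field, of S]
  moreover have "sinh (?\<omega> * of_real t) * ?\<omega> = - z * sn z t"
    using \<omega> by (simp add: sn_def field_simps) (simp flip: mult.assoc)
  ultimately show "(cs z has_vector_derivative (- z * sn z t)) (at t within S)"
    "(sn z has_vector_derivative cs z t) (at t within S)"
    unfolding cs_def[abs_def] sn_def[abs_def] by (simp_all add: o_def)
qed

lemma cs_sn_identity: "z \<noteq> 0 \<Longrightarrow> cs z t * cs z t + z * (sn z t * sn z t) = 1"
proof -
  assume "z \<noteq> 0"
  let ?\<omega> = "csqrt (- z)"
  have \<omega>: "?\<omega> * ?\<omega> = - z" "?\<omega> \<noteq> 0"
    using power2_csqrt[of "- z"] \<open>z \<noteq> 0\<close> by (auto simp: power2_eq_square)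
  have "z * (sn z t * sn z t) = - (sinh (?\<omega> * of_real t))\<^sup>2"
    using \<omega> \<open>z \<noteq> 0\<close> by (simp add: sn_def power2_eq_square)
  thus ?thesis using cosh_square_eq[of "?\<omega> * of_real t"]
    by (simp add: cs_def power2_eq_square)
qed

lemma linear_combination_solves:
  assumes "z \<noteq> 0"
  shows "solves_on S z (\<lambda>t. cs z (t - a) *s u + sn z (t - a) *s v)
    (\<lambda>t. (- z * sn z (t - a)) *s u + cs z (t - a) *s v)"
proof -
  have shift: "((\<lambda>t. t - a) has_vector_derivative 1) (at t within S)" for t
    by (auto intro!: derivative_eq_intros)
  have c: "((\<lambda>t. cs z (t - a)) has_vector_derivative (- z * sn z (t - a))) (at t within S)" for t
    using vector_diff_chain_within[OF shift cs_deriv[OF assms]] by (simp add: o_def)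
  have s: "((\<lambda>t. sn z (t - a)) has_vector_derivative cs z (t - a)) (at t within S)" for t
    using vector_diff_chain_within[OF shift sn_deriv[OF assms]] by (simp add: o_def)
  have lin: "((\<lambda>t. f t *s w) has_vector_derivative f' *s w) (at t within S)"
    if "(f has_vector_derivative f') (at t within S)" for f f' t and w :: "complex ^ 'n"
    by (rule bounded_linear.has_vector_derivative[OF bounded_linear_scale_left that])
  show ?thesis
    unfolding solves_on_def
  proof (intro ballI conjI)
    fix t assume "t \<in> S"
    show "((\<lambda>t. cs z (t - a) *s u + sn z (t - a) *s v) has_vector_derivative
        (- z * sn z (t - a)) *s u + cs z (t - a) *s v) (at t within S)"
      by (intro has_vector_derivative_add lin c s)
    have "((\<lambda>t. - z * sn z (t - a)) has_vector_derivative - z * cs z (t - a)) (at t within S)"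
      by (intro has_vector_derivative_mult_right s)
    from has_vector_derivative_add[OF lin[OF this] lin[OF c]]
    show "((\<lambda>t. (- z * sn z (t - a)) *s u + cs z (t - a) *s v) has_vector_derivative
        (- z) *s (cs z (t - a) *s u + sn z (t - a) *s v)) (at t within S)"
      by (simp only: vector_add_ldistrib vector_smult_assoc)
  qed
qed

text \<open>The pair consists of the value at \<open>x_k\<close> and the derivative on the right of
  \<open>x_k\<close>, so the jump is already included in the second component.\<close>

primrec sol_data :: "complex \<Rightarrow> (nat \<Rightarrow> real) \<Rightarrow> (nat \<Rightarrow> complex ^ 'n ^ 'n) \<Rightarrow> complex ^ 'n \<Rightarrow> nat \<Rightarrow>
    (complex ^ 'n) \<times> (complex ^ 'n)" where
  "sol_data z x \<Lambda> c 0 = (c, 0)"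
| "sol_data z x \<Lambda> c (Suc k) = (let \<delta> = x (Suc k) - x k; (U, P) = sol_data z x \<Lambda> c k;
     V = cs z \<delta> *s U + sn z \<delta> *s P
     in (V, (- z * sn z \<delta>) *s U + cs z \<delta> *s P + \<Lambda> (Suc k) *v V))"

section \<open>Solutions continued across the interactions\<close>

locale grid =
  fixes x :: "nat \<Rightarrow> real" and \<Lambda> :: "nat \<Rightarrow> complex ^ 'n::finite ^ 'n" and z :: complex
  assumes x_mono: "strict_mono x" and x0: "x 0 = 0" and x_lim: "filterlim x at_top sequentially"
    and herm\<Lambda>: "\<And>k. k \<ge> 1 \<Longrightarrow> hermitian (\<Lambda> k)"
    and norm_z: "norm z = 1" and Im_z: "\<bar>Im z\<bar> = 1"
begin

lemma z_neq_0: "z \<noteq> 0" using norm_z by auto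

lemma x_less: "x k < x (Suc k)" using x_mono by (simp add: strict_mono_def)

definition U :: "complex ^ 'n \<Rightarrow> nat \<Rightarrow> complex ^ 'n" where "U c k = fst (sol_data z x \<Lambda> c k)"
definition P :: "complex ^ 'n \<Rightarrow> nat \<Rightarrow> complex ^ 'n" where "P c k = snd (sol_data z x \<Lambda> c k)"

text \<open>The formula of the \<open>k\<close>-th interval, defined on the whole line, so that
  one-sided limits at both end points are ordinary values.\<close>

definition piece :: "complex ^ 'n \<Rightarrow> nat \<Rightarrow> real \<Rightarrow> complex ^ 'n"
  where "piece c k t = cs z (t - x k) *s U c k + sn z (t - x k) *s P c k"
definition piece1 :: "complex ^ 'n \<Rightarrow> nat \<Rightarrow> real \<Rightarrow> complex ^ 'n"
  where "piece1 c k t = (- z * sn z (t - x k)) *s U c k + cs z (t - x k) *s P c k"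

lemma UP_0 [simp]: "U c 0 = c" "P c 0 = 0"
  by (simp_all add: U_def P_def)

lemma piece_left: "piece c k (x k) = U c k" "piece1 c k (x k) = P c k"
  by (simp_all add: piece_def piece1_def)

lemma piece_right: "piece c k (x (Suc k)) = U c (Suc k)"
    "piece1 c k (x (Suc k)) = P c (Suc k) - \<Lambda> (Suc k) *v U c (Suc k)"
  by (simp_all add: piece_def piece1_def U_def P_def Let_def split_beta)

lemma piece_solves: "solves_on S z (piece c k) (piece1 c k)"
  unfolding piece_def[abs_def] piece1_def[abs_def] by (rule linear_combination_solves[OF z_neq_0])

lemma UP_linear: "U (c + c') k = U c k + U c' k \<and> U (a *s c) k = a *s U c k \<and>
    P (c + c') k = P c k + P c' k \<and> P (a *s c) k = a *s P c k"
proof (induction k)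
  case (Suc k)
  have U: "U c (Suc k) = cs z (x (Suc k) - x k) *s U c k + sn z (x (Suc k) - x k) *s P c k" for c
    by (simp add: U_def P_def Let_def split_beta)
  have P: "P c (Suc k) = (- z * sn z (x (Suc k) - x k)) *s U c k + cs z (x (Suc k) - x k) *s P c k + \<Lambda> (Suc k) *v U c (Suc k)" for c
    by (simp add: U_def P_def Let_def split_beta)
  show ?case
    using Suc.IH unfolding U P
    by (simp add: vec.add vec.scale vector_add_ldistrib vector_smult_assoc algebra_simps)
qed simp

lemma piece_linear: "piece (c + c') k t = piece c k t + piece c' k t" "piece (a *s c) k t = a *s piece c k t"
  using UP_linear[of c c' k] UP_linear[of c c k a]
  by (simp_all add: piece_def vector_add_ldistrib vector_smult_assoc mult.commute)

definition m :: "complex ^ 'n \<Rightarrow> nat \<Rightarrow> real"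
  where "m c k = integral {x k..x (Suc k)} (\<lambda>t. (norm (piece c k t))\<^sup>2)"

definition I :: "complex ^ 'n \<Rightarrow> complex ^ 'n \<Rightarrow> nat \<Rightarrow> 'n \<Rightarrow> complex"
  where "I c c' k j = integral {x k..x (Suc k)} (\<lambda>t. piece c k t $ j * cnj (piece c' k t $ j))"

lemma piece_continuous [continuous_intros]: "continuous_on S (piece c k)" "continuous_on S (piece1 c k)"
  by (rule solves_on_continuous[OF piece_solves])+

lemma norm_piece_integrable: "(\<lambda>t. (norm (piece c k t))\<^sup>2) integrable_on {x k..x (Suc k)}"
  by (intro integrable_continuous_interval continuous_intros)

lemma m_nonneg: "0 \<le> m c k"
  unfolding m_def by (intro integral_nonneg norm_piece_integrable) auto

lemma m_add: "m (c + c') k \<le> 2 * (m c k + m c' k)"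
proof -
  have "m (c + c') k \<le> integral {x k..x (Suc k)} (\<lambda>t. 2 * ((norm (piece c k t))\<^sup>2 + (norm (piece c' k t))\<^sup>2))"
    unfolding m_def
  proof (intro integral_le norm_piece_integrable integrable_on_mult_right integrable_add)
    fix t
    have "(norm (piece (c + c') k t))\<^sup>2 \<le> (norm (piece c k t) + norm (piece c' k t))\<^sup>2"
      unfolding piece_linear by (intro power_mono norm_triangle_ineq) auto
    also have "\<dots> \<le> 2 * ((norm (piece c k t))\<^sup>2 + (norm (piece c' k t))\<^sup>2)"
      using sum_squares_bound[of "norm (piece c k t)" "norm (piece c' k t)"] by (simp add: power2_sum)
    finally show "(norm (piece (c + c') k t))\<^sup>2 \<le> 2 * ((norm (piece c k t))\<^sup>2 + (norm (piece c' k t))\<^sup>2)" .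
  qed
  also have "\<dots> = 2 * (m c k + m c' k)"
    unfolding m_def by (simp add: integral_add norm_piece_integrable)
  finally show ?thesis .
qed

lemma m_scale: "m (a *s c) k = (norm a)\<^sup>2 * m c k"
  unfolding m_def piece_linear norm_scale_vec power_mult_distrib by simp

lemma I_le: "norm (I c c' k j) \<le> m c k + m c' k"
proof -
  have "norm (I c c' k j) \<le> integral {x k..x (Suc k)} (\<lambda>t. (norm (piece c k t))\<^sup>2 + (norm (piece c' k t))\<^sup>2)"
    unfolding I_def
  proof (intro integral_norm_bound_integral integrable_add norm_piece_integrable integrable_continuous_interval continuous_intros)
    fix t
    have "norm (piece c k t $ j * cnj (piece c' k t $ j)) \<le> norm (piece c k t) * norm (piece c' k t)"
      by (simp add: norm_mult mult_mono Finite_Cartesian_Product.norm_nth_le)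
    also have "\<dots> \<le> ((norm (piece c k t))\<^sup>2 + (norm (piece c' k t))\<^sup>2) / 2" by (rule mult_le_half_squares)
    finally show "norm (piece c k t $ j * cnj (piece c' k t $ j)) \<le> (norm (piece c k t))\<^sup>2 + (norm (piece c' k t))\<^sup>2"
      using zero_le_power2[of "norm (piece c k t)"] zero_le_power2[of "norm (piece c' k t)"] by argo
  qed
  also have "\<dots> = m c k + m c' k"
    unfolding m_def by (simp add: integral_add norm_piece_integrable)
  finally show ?thesis .
qed

lemma cdot_self: "cdot v v = of_real ((norm v)\<^sup>2)"
  by (rule complex_eqI) (simp_all add: Re_cdot power2_norm_eq_inner del: of_real_power)

lemma I_sum: "(\<Sum>j\<in>UNIV. I c c k j) = of_real (m c k)"
proof -
  have "(\<Sum>j\<in>UNIV. I c c k j) = integral {x k..x (Suc k)} (\<lambda>t. \<Sum>j\<in>UNIV. piece c k t $ j * cnj (piece c k t $ j))"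
    unfolding I_def
    by (intro integral_sum[symmetric] finite integrable_continuous_interval continuous_intros)
  also have "\<dots> = integral {x k..x (Suc k)} (\<lambda>t. of_real ((norm (piece c k t))\<^sup>2))"
    unfolding cdot_self[symmetric] cdot_def ..
  also have "\<dots> = of_real (m c k)"
    unfolding m_def using has_integral_of_real[OF integrable_integral[OF norm_piece_integrable]]
    by (rule integral_unique)
  finally show ?thesis .
qed

end

subsection \<open>Green's formula for absolutely continuous functions\<close>

text \<open>\<open>F\<close> is only an indefinite integral and need not be differentiable
  everywhere, so the product rule is replaced by Fubini on the triangle below the diagonal.\<close>

lemma indefinite_integral_by_parts:
  fixes F G v v' :: "real \<Rightarrow> complex"
  assumes "s \<le> t" and G: "set_integrable lborel {s..t} G"
    and F: "\<And>\<tau>. \<tau> \<in> {s..t} \<Longrightarrow> F \<tau> - F s = (LINT \<sigma>:{s..\<tau>}|lborel. G \<sigma>)"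
    and v: "\<And>\<tau>. \<tau> \<in> {s..t} \<Longrightarrow> (v has_vector_derivative v' \<tau>) (at \<tau> within {s..t})"
    and v': "continuous_on {s..t} v'"
  shows "set_integrable lborel {s..t} (\<lambda>\<tau>. G \<tau> * v \<tau>)"
    and "set_integrable lborel {s..t} (\<lambda>\<tau>. F \<tau> * v' \<tau>)"
    and "(LINT \<tau>:{s..t}|lborel. G \<tau> * v \<tau>) + (LINT \<tau>:{s..t}|lborel. F \<tau> * v' \<tau>) = F t * v t - F s * v s"
proof -
  define g where "g \<sigma> = indicator {s..t} \<sigma> *\<^sub>R G \<sigma>" for \<sigma>
  define h where "h \<tau> = indicator {s..t} \<tau> *\<^sub>R v' \<tau>" for \<tau>
  have g: "integrable lborel g" using G by (simp add: set_integrable_def g_def[abs_def])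
  have h: "integrable lborel h"
    using borel_integrable_atLeastAtMost'[OF v'] by (simp add: set_integrable_def h_def[abs_def])
  have [measurable]: "g \<in> borel_measurable borel" "h \<in> borel_measurable borel"
    using borel_measurable_integrable[OF g] borel_measurable_integrable[OF h] by simp_all
  \<comment> \<open>Integrating \<open>K\<close> over its first variable gives
    \<open>(F \<tau> - F s) * h \<tau>\<close>, over its second one
    \<open>g \<sigma> * (v t - v \<sigma>)\<close>.\<close>
  define K where "K p = indicator {p. fst p \<le> snd p} p *\<^sub>R (g (fst p) * h (snd p))" for p :: "real \<times> real"
  have "integrable (lborel \<Otimes>\<^sub>M lborel) (\<lambda>p. g (fst p) * h (snd p))"
  proof (rule lborel_pair.Fubini_integrable)
    show "integrable lborel (\<lambda>x. LINT y|lborel. norm (g (fst (x, y)) * h (snd (x, y))))"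
      using g h by (simp add: norm_mult)
    show "AE x in lborel. integrable lborel (\<lambda>y. g (fst (x, y)) * h (snd (x, y)))"
      using h by simp
  qed measurable
  moreover have "closed {p :: real \<times> real. fst p \<le> snd p}"
    by (intro closed_Collect_le continuous_intros)
  hence "{p :: real \<times> real. fst p \<le> snd p} \<in> sets (lborel \<Otimes>\<^sub>M lborel)"
    unfolding lborel_prod sets_lborel by (rule borel_closed)
  ultimately have K: "integrable (lborel \<Otimes>\<^sub>M lborel) K"
    unfolding K_def[abs_def] by (intro integrable_mult_indicator)
  have inner1: "(LINT \<sigma>|lborel. K (\<sigma>, \<tau>)) = (F \<tau> - F s) * h \<tau>" for \<tau>
  proof (cases "\<tau> \<in> {s..t}")
    case True
    have K_eq: "K (\<sigma>, \<tau>) = (indicator {s..\<tau>} \<sigma> *\<^sub>R G \<sigma>) * h \<tau>" for \<sigma>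
      using True by (auto simp: K_def g_def indicator_def)
    show ?thesis unfolding K_eq F[OF True] set_lebesgue_integral_def by (rule integral_mult_left_zero)
  qed (simp add: K_def h_def)
  have inner2: "(LINT \<tau>|lborel. K (\<sigma>, \<tau>)) = g \<sigma> * (v t - v \<sigma>)" for \<sigma>
  proof (cases "\<sigma> \<in> {s..t}")
    case True
    have K_eq: "K (\<sigma>, \<tau>) = g \<sigma> * (indicator {\<sigma>..t} \<tau> *\<^sub>R v' \<tau>)" for \<tau>
      using True by (auto simp: K_def h_def indicator_def)
    have FTC: "(LINT \<tau>|lborel. indicator {\<sigma>..t} \<tau> *\<^sub>R v' \<tau>) = v t - v \<sigma>"
    proof (rule integral_FTC_atLeastAtMost)
      show "continuous_on {\<sigma>..t} v'" using True by (intro continuous_on_subset[OF v']) auto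
      show "(v has_vector_derivative v' x) (at x within {\<sigma>..t})" if "\<sigma> \<le> x" "x \<le> t" for x
        using True that by (intro has_vector_derivative_within_subset[OF v]) auto
    qed (use True in auto)
    show ?thesis unfolding K_eq FTC[symmetric] by (rule integral_mult_right_zero)
  qed (simp add: K_def g_def)
  have eq: "(LINT \<tau>|lborel. (F \<tau> - F s) * h \<tau>) = (LINT \<sigma>|lborel. g \<sigma> * (v t - v \<sigma>))"
    using lborel_pair.Fubini_integral[of "\<lambda>\<sigma> \<tau>. K (\<sigma>, \<tau>)"] K by (simp add: inner1 inner2)
  have int2: "integrable lborel (\<lambda>\<sigma>. g \<sigma> * (v t - v \<sigma>))"
    using lborel_pair.integrable_fst'[OF K] by (simp add: inner2)
  have int1: "integrable lborel (\<lambda>\<tau>. (F \<tau> - F s) * h \<tau>)"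
    using lborel_pair.integrable_snd[of "\<lambda>\<sigma> \<tau>. K (\<sigma>, \<tau>)"] K by (simp add: inner1)
  have "integrable lborel (\<lambda>\<sigma>. g \<sigma> * v t - g \<sigma> * (v t - v \<sigma>))"
    using g int2 by (intro Bochner_Integration.integrable_diff) auto
  hence iG: "integrable lborel (\<lambda>\<sigma>. g \<sigma> * v \<sigma>)" by (simp add: algebra_simps)
  have "integrable lborel (\<lambda>\<tau>. (F \<tau> - F s) * h \<tau> + F s * h \<tau>)"
    using h int1 by (intro Bochner_Integration.integrable_add) auto
  hence iF: "integrable lborel (\<lambda>\<tau>. F \<tau> * h \<tau>)" by (simp add: algebra_simps)
  show "set_integrable lborel {s..t} (\<lambda>\<tau>. G \<tau> * v \<tau>)"
    using iG by (simp add: set_integrable_def g_def)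
  show "set_integrable lborel {s..t} (\<lambda>\<tau>. F \<tau> * v' \<tau>)"
    using iF by (simp add: set_integrable_def h_def)
  have e1: "(LINT \<tau>|lborel. (F \<tau> - F s) * h \<tau>) = (LINT \<tau>|lborel. F \<tau> * h \<tau>) - F s * (LINT \<tau>|lborel. h \<tau>)"
    unfolding left_diff_distrib using iF h by (subst Bochner_Integration.integral_diff) auto
  have e2: "(LINT \<sigma>|lborel. g \<sigma> * (v t - v \<sigma>)) = (LINT \<sigma>|lborel. g \<sigma>) * v t - (LINT \<sigma>|lborel. g \<sigma> * v \<sigma>)"
    unfolding right_diff_distrib using iG g by (subst Bochner_Integration.integral_diff) auto
  have e3: "(LINT \<sigma>|lborel. g \<sigma>) = F t - F s"
    using F[of t] \<open>s \<le> t\<close> by (simp add: g_def set_lebesgue_integral_def)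
  have e4: "(LINT \<tau>|lborel. h \<tau>) = v t - v s"
    unfolding h_def using v v' \<open>s \<le> t\<close> by (intro integral_FTC_atLeastAtMost) auto
  have "(LINT \<sigma>|lborel. g \<sigma> * v \<sigma>) + (LINT \<tau>|lborel. F \<tau> * h \<tau>) = F t * v t - F s * v s"
    using eq unfolding e1 e2 e3 e4 by (simp add: algebra_simps)
  thus "(LINT \<tau>:{s..t}|lborel. G \<tau> * v \<tau>) + (LINT \<tau>:{s..t}|lborel. F \<tau> * v' \<tau>) = F t * v t - F s * v s"
    by (simp add: set_lebesgue_integral_def g_def h_def)
qed

lemma ac_deriv_on_nth:
  fixes f g :: "real \<Rightarrow> complex ^ 'n"
  assumes "ac_deriv_on S f g" "s \<in> S" "t \<in> S" "s \<le> t"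
  shows "set_integrable lborel {s..t} (\<lambda>\<tau>. g \<tau> $ j)"
    and "f t $ j - f s $ j = (LINT \<tau>:{s..t}|lborel. g \<tau> $ j)"
proof -
  have g: "set_integrable lborel {s..t} g" and f: "f t - f s = (LINT \<tau>:{s..t}|lborel. g \<tau>)"
    using assms by (auto simp: ac_deriv_on_def)
  show "set_integrable lborel {s..t} (\<lambda>\<tau>. g \<tau> $ j)"
    using integrable_bounded_linear[OF bounded_linear_vec_nth g[unfolded set_integrable_def], of j]
    by (simp add: set_integrable_def)
  show "f t $ j - f s $ j = (LINT \<tau>:{s..t}|lborel. g \<tau> $ j)"
    using arg_cong[OF f, of "\<lambda>v. v $ j"]
      integral_bounded_linear[OF bounded_linear_vec_nth g[unfolded set_integrable_def], of j]
    by (simp add: set_lebesgue_integral_def)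
qed

text \<open>Two integrations by parts, of \<open>f1\<close> against \<open>u\<close> and of
  \<open>f\<close> against \<open>u1\<close>; the products of the two first derivatives cancel in
  the difference.\<close>

lemma green_closed_interval:
  fixes f f1 f2 u u1 :: "real \<Rightarrow> complex ^ 'n"
  assumes f: "ac_deriv_on S f f1" and f1: "ac_deriv_on S f1 f2" and S: "{s..t} \<subseteq> S" "s \<le> t"
    and u: "solves_on {s..t} z u u1"
  shows "(LINT \<tau>:{s..t}|lborel. cdot (f2 \<tau>) (u \<tau>) + cnj z * cdot (f \<tau>) (u \<tau>))
     = cdot (f1 t) (u t) - cdot (f t) (u1 t) - (cdot (f1 s) (u s) - cdot (f s) (u1 s))"
proof -
  have cu: "continuous_on {s..t} u" "continuous_on {s..t} u1"
    by (rule solves_on_continuous[OF u])+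
  have du: "((\<lambda>t. cnj (u t $ j)) has_vector_derivative cnj (u1 \<tau> $ j)) (at \<tau> within {s..t})"
    and du1: "((\<lambda>t. cnj (u1 t $ j)) has_vector_derivative cnj (((- z) *s u \<tau>) $ j)) (at \<tau> within {s..t})"
    if "\<tau> \<in> {s..t}" for \<tau> j
    by (intro has_vector_derivative_cnj has_vector_derivative_nth; use u that in \<open>unfold solves_on_def, blast\<close>)+
  have cont: "continuous_on {s..t} (\<lambda>\<tau>. cnj (u1 \<tau> $ j))" "continuous_on {s..t} (\<lambda>\<tau>. cnj (((- z) *s u \<tau>) $ j))" for j
    by (intro continuous_intros cu)+
  have ends: "s \<in> S" "t \<in> S" using S by auto
  have mid: "f1 \<tau> $ j - f1 s $ j = (LINT \<tau>:{s..\<tau>}|lborel. f2 \<tau> $ j)"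
    "f \<tau> $ j - f s $ j = (LINT \<tau>:{s..\<tau>}|lborel. f1 \<tau> $ j)" if "\<tau> \<in> {s..t}" for \<tau> j
    using ac_deriv_on_nth(2)[OF f1 ends(1), of \<tau> j] ac_deriv_on_nth(2)[OF f ends(1), of \<tau> j] S that by auto
  have part1: "set_integrable lborel {s..t} (\<lambda>\<tau>. f2 \<tau> $ j * cnj (u \<tau> $ j))"
      "(LINT \<tau>:{s..t}|lborel. f2 \<tau> $ j * cnj (u \<tau> $ j)) + (LINT \<tau>:{s..t}|lborel. f1 \<tau> $ j * cnj (u1 \<tau> $ j))
        = f1 t $ j * cnj (u t $ j) - f1 s $ j * cnj (u s $ j)" for j
    by (rule indefinite_integral_by_parts[OF S(2) ac_deriv_on_nth(1)[OF f1 ends S(2)] mid(1) du cont(1)]; assumption)+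
  have part2: "set_integrable lborel {s..t} (\<lambda>\<tau>. f \<tau> $ j * cnj (((- z) *s u \<tau>) $ j))"
      "(LINT \<tau>:{s..t}|lborel. f1 \<tau> $ j * cnj (u1 \<tau> $ j)) + (LINT \<tau>:{s..t}|lborel. f \<tau> $ j * cnj (((- z) *s u \<tau>) $ j))
        = f t $ j * cnj (u1 t $ j) - f s $ j * cnj (u1 s $ j)" for j
    by (rule indefinite_integral_by_parts[OF S(2) ac_deriv_on_nth(1)[OF f ends S(2)] mid(2) du1 cont(2)]; assumption)+
  have \<phi>: "cdot (f2 \<tau>) (u \<tau>) + cnj z * cdot (f \<tau>) (u \<tau>) =
      (\<Sum>j\<in>UNIV. f2 \<tau> $ j * cnj (u \<tau> $ j) - f \<tau> $ j * cnj (((- z) *s u \<tau>) $ j))" for \<tau>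
    by (simp add: cdot_def sum.distrib sum_distrib_left algebra_simps)
  have "(LINT \<tau>:{s..t}|lborel. cdot (f2 \<tau>) (u \<tau>) + cnj z * cdot (f \<tau>) (u \<tau>)) =
      (\<Sum>j\<in>UNIV. LINT \<tau>:{s..t}|lborel. f2 \<tau> $ j * cnj (u \<tau> $ j) - f \<tau> $ j * cnj (((- z) *s u \<tau>) $ j))"
    unfolding set_lebesgue_integral_def \<phi> scaleR_sum_right
    by (rule Bochner_Integration.integral_sum)
      (rule set_integral_diff(1)[OF part1(1) part2(1), unfolded set_integrable_def])
  also have "\<dots> = (\<Sum>j\<in>UNIV. (f1 t $ j * cnj (u t $ j) - f1 s $ j * cnj (u s $ j))
      - (f t $ j * cnj (u1 t $ j) - f s $ j * cnj (u1 s $ j)))"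
  proof (rule sum.cong[OF refl])
    fix j
    show "(LINT \<tau>:{s..t}|lborel. f2 \<tau> $ j * cnj (u \<tau> $ j) - f \<tau> $ j * cnj (((- z) *s u \<tau>) $ j)) =
      (f1 t $ j * cnj (u t $ j) - f1 s $ j * cnj (u s $ j)) - (f t $ j * cnj (u1 t $ j) - f s $ j * cnj (u1 s $ j))"
      unfolding part1(2)[symmetric] part2(2)[symmetric] set_integral_diff(2)[OF part1(1) part2(1)] by simp
  qed
  also have "\<dots> = cdot (f1 t) (u t) - cdot (f t) (u1 t) - (cdot (f1 s) (u s) - cdot (f s) (u1 s))"
    by (simp add: cdot_def sum_subtractf)
  finally show ?thesis .
qed

lemma tendsto_cdot [tendsto_intros]:
  "(f \<longlongrightarrow> a) F \<Longrightarrow> (g \<longlongrightarrow> b) F \<Longrightarrow> ((\<lambda>t. cdot (f t) (g t)) \<longlongrightarrow> cdot a b) F"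
  unfolding cdot_def by (intro tendsto_sum tendsto_mult tendsto_cnj tendsto_vec_nth)

lemma square_integrable_continuous:
  fixes u :: "real \<Rightarrow> complex ^ 'n"
  assumes u: "continuous_on {a..b} u" and S: "S \<subseteq> {a..b}" "S \<in> sets borel"
  shows "square_integrable S u"
  unfolding square_integrable_def
proof
  have "set_integrable lborel S u"
    by (rule set_integrable_subset[OF borel_integrable_atLeastAtMost'[OF u]]) (use S in auto)
  thus "set_borel_measurable lborel S u"
    unfolding set_borel_measurable_def set_integrable_def by (rule borel_measurable_integrable)
  have "continuous_on {a..b} (\<lambda>t. (norm (u t))\<^sup>2)" by (intro continuous_intros u)
  from borel_integrable_atLeastAtMost'[OF this]
  show "set_integrable lborel S (\<lambda>t. (norm (u t))\<^sup>2)"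
    by (rule set_integrable_subset) (use S in auto)
qed

lemma square_integrable_subset:
  assumes f: "square_integrable S f" and "T \<subseteq> S" "T \<in> sets borel"
  shows "square_integrable T f"
  unfolding square_integrable_def
proof
  have fS: "set_borel_measurable lborel S f" "set_integrable lborel S (\<lambda>t. (norm (f t))\<^sup>2)"
    using f by (simp_all add: square_integrable_def)
  show "set_borel_measurable lborel T f"
    by (rule set_borel_measurable_subset[OF fS(1)]) (use assms(2,3) in simp_all)
  show "set_integrable lborel T (\<lambda>t. (norm (f t))\<^sup>2)"
    by (rule set_integrable_subset[OF fS(2)]) (use assms(2,3) in simp_all)
qed

text \<open>Domain functions are controlled on open intervals only, with one-sided limits at the
  ends. The interval is therefore exhausted by closed ones, and only the limits of the boundary form
  are assumed.\<close>

lemma green_open_interval: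
  fixes f f1 f2 u u1 :: "real \<Rightarrow> complex ^ 'n"
  assumes "a < b" and f: "W22_on a b f f1 f2" and u: "solves_on {a..b} z u u1"
    and \<beta>a: "((\<lambda>t. cdot (f1 t) (u t) - cdot (f t) (u1 t)) \<longlongrightarrow> \<beta>a) (at_right a)"
    and \<beta>b: "((\<lambda>t. cdot (f1 t) (u t) - cdot (f t) (u1 t)) \<longlongrightarrow> \<beta>b) (at_left b)"
  shows "(LINT \<tau>:{a<..<b}|lborel. cdot (f2 \<tau>) (u \<tau>) + cnj z * cdot (f \<tau>) (u \<tau>)) = \<beta>b - \<beta>a"
proof -
  let ?\<phi> = "\<lambda>\<tau>. cdot (f2 \<tau>) (u \<tau>) + cnj z * cdot (f \<tau>) (u \<tau>)"
  let ?B = "\<lambda>t. cdot (f1 t) (u t) - cdot (f t) (u1 t)"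
  \<comment> \<open>The shift by 3 keeps \<open>2 * r i < b - a\<close>, so the closed intervals are
    nonempty from the start.\<close>
  define r where "r i = (b - a) / real (i + 3)" for i
  have r0: "r i > 0" for i using \<open>a < b\<close> by (simp add: r_def)
  have rn: "r i \<noteq> 0" for i using r0[of i] by simp
  have rlim: "r \<longlonglongrightarrow> 0"
    unfolding r_def by (intro real_tendsto_divide_at_top[OF tendsto_const]
        filterlim_compose[OF filterlim_real_sequentially filterlim_add_const_nat_at_top])
  have r2: "2 * r i < b - a" for i
    using mult_strict_right_mono[OF \<open>a < b\<close>, of "1 + real i"] by (simp add: r_def field_simps)
  have rdec: "r j \<le> r i" if "i \<le> j" for i j
    using that \<open>a < b\<close> by (auto simp: r_def intro!: divide_left_mono)
  define A where "A i = {a + r i..b - r i}" for i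
  have "incseq A"
  proof (rule incseq_SucI, rule subsetI)
    fix i y assume "y \<in> A i"
    thus "y \<in> A (Suc i)" using rdec[of i "Suc i"] by (simp add: A_def)
  qed
  have UN: "(\<Union>i. A i) = {a<..<b}"
  proof
    have "A i \<subseteq> {a<..<b}" for i
    proof
      fix y assume "y \<in> A i"
      thus "y \<in> {a<..<b}" using r0[of i] by (simp add: A_def)
    qed
    thus "(\<Union>i. A i) \<subseteq> {a<..<b}" by blast
    show "{a<..<b} \<subseteq> (\<Union>i. A i)"
    proof
      fix y assume y: "y \<in> {a<..<b}"
      hence "0 < min (y - a) (b - y)" by auto
      from order_tendstoD(2)[OF rlim this] obtain i where "r i < min (y - a) (b - y)"
        by (auto simp: eventually_sequentially)
      hence "y \<in> A i" by (auto simp: A_def)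
      thus "y \<in> (\<Union>i. A i)" by blast
    qed
  qed
  have "square_integrable {a<..<b} u"
    by (rule square_integrable_continuous[OF solves_on_continuous(1)[OF u]]) auto
  hence "set_integrable lborel {a<..<b} ?\<phi>"
    using f unfolding W22_on_def
    by (intro set_integral_add(1) set_integrable_mult_right set_integrable_cdot) auto
  with \<open>incseq A\<close> UN have "(\<lambda>i. LINT t:A i|lborel. ?\<phi> t) \<longlonglongrightarrow> (LINT t:{a<..<b}|lborel. ?\<phi> t)"
    using set_integral_cont_up[of A lborel ?\<phi>] by (simp add: A_def)
  moreover have "(LINT t:A i|lborel. ?\<phi> t) = ?B (b - r i) - ?B (a + r i)" for i
  proof -
    have sub: "{a + r i..b - r i} \<subseteq> {a<..<b}" "a + r i \<le> b - r i" "{a + r i..b - r i} \<subseteq> {a..b}"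
      using r0[of i] r2[of i] by auto
    have "solves_on {a + r i..b - r i} z u u1"
      using u sub(3) unfolding solves_on_def by (meson has_vector_derivative_within_subset subsetD)
    from green_closed_interval[OF _ _ sub(1,2) this] f show ?thesis
      unfolding W22_on_def A_def by blast
  qed
  moreover have "(\<lambda>i. ?B (b - r i) - ?B (a + r i)) \<longlonglongrightarrow> \<beta>b - \<beta>a"
  proof (intro tendsto_diff[of "\<lambda>i. ?B (b - r i)"])
    have "filterlim (\<lambda>i. b - r i) (at_left b) sequentially"
      using tendsto_diff[OF tendsto_const rlim, of b] by (auto simp: filterlim_at r0 rn)
    thus "(\<lambda>i. ?B (b - r i)) \<longlonglongrightarrow> \<beta>b" by (rule filterlim_compose[OF \<beta>b])
    have "filterlim (\<lambda>i. a + r i) (at_right a) sequentially"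
      using tendsto_add[OF tendsto_const rlim, of a] by (auto simp: filterlim_at r0 rn)
    thus "(\<lambda>i. ?B (a + r i)) \<longlonglongrightarrow> \<beta>a" by (rule filterlim_compose[OF \<beta>a])
  qed
  ultimately show ?thesis by (simp add: LIMSEQ_unique)
qed

lemma set_integral_split:
  fixes \<phi> :: "real \<Rightarrow> 'a::{banach, second_countable_topology}"
  assumes "a \<le> b" "b \<le> c" and \<phi>: "set_integrable lborel {a<..<c} \<phi>"
  shows "(LINT t:{a<..<c}|lborel. \<phi> t) = (LINT t:{a<..<b}|lborel. \<phi> t) + (LINT t:{b<..<c}|lborel. \<phi> t)"
proof -
  have i: "set_integrable lborel {a<..<b} \<phi>" "set_integrable lborel {b<..<c} \<phi>"
    using assms by (auto intro!: set_integrable_subset[OF \<phi>])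
  have "(LINT t:{a<..<b} \<union> {b<..<c}|lborel. \<phi> t) = (LINT t:{a<..<b}|lborel. \<phi> t) + (LINT t:{b<..<c}|lborel. \<phi> t)"
    by (rule set_integral_Un[OF _ i]) auto
  moreover have "(LINT t:{a<..<c}|lborel. \<phi> t) = (LINT t:{a<..<b} \<union> {b<..<c}|lborel. \<phi> t)"
  proof (rule set_integral_cong_set)
    have "AE t in lborel. t \<noteq> b" by (rule AE_lborel_singleton)
    thus "AE t in lborel. t \<in> {a<..<b} \<union> {b<..<c} \<longleftrightarrow> t \<in> {a<..<c}"
      by eventually_elim (use assms in auto)
    show "set_borel_measurable lborel {a<..<c} \<phi>" "set_borel_measurable lborel ({a<..<b} \<union> {b<..<c}) \<phi>"
      using \<phi> set_integrable_Un[OF i] unfolding set_integrable_def set_borel_measurable_def by auto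
  qed
  ultimately show ?thesis by simp
qed

lemma norm_cdot_le_mult: "norm (cdot u v) \<le> CARD('n) * (norm u * norm v)" for u v :: "complex ^ 'n"
proof -
  have "norm (cdot u v) \<le> (\<Sum>i\<in>(UNIV::'n set). norm u * norm v)"
    unfolding cdot_def
    by (rule sum_norm_le) (simp add: norm_mult mult_mono Finite_Cartesian_Product.norm_nth_le)
  thus ?thesis by simp
qed

lemma norm_set_integral_le:
  fixes g :: "real \<Rightarrow> complex ^ 'n"
  assumes g: "set_integrable lborel {s..t} g" and "s \<le> t" and B: "\<And>u. u \<in> {s..t} \<Longrightarrow> norm (g u) \<le> B"
  shows "norm (LINT u:{s..t}|lborel. g u) \<le> B * (t - s)"
proof -
  have "0 \<le> B" using B[of s] \<open>s \<le> t\<close> norm_ge_zero[of "g s"] by (simp del: norm_ge_zero)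
  moreover have "(g has_integral (LINT u:{s..t}|lborel. g u)) (cbox s t)"
    using set_borel_integral_eq_integral[OF g] by (simp add: integrable_integral)
  ultimately show ?thesis
    using has_integral_bound[of B g _ s t] B \<open>s \<le> t\<close> by simp
qed

section \<open>Green's formula on the half-line\<close>

context grid
begin

definition idx :: "real \<Rightarrow> nat" where "idx t = (LEAST k. t < x (Suc k))"

lemma idx_eq: assumes "x k \<le> t" "t < x (Suc k)" shows "idx t = k"
  unfolding idx_def
proof (rule Least_equality)
  fix j assume "t < x (Suc j)"
  hence "x k < x (Suc j)" using assms by simp
  hence "k < Suc j" using x_mono by (simp add: strict_mono_less)
  thus "k \<le> j" by simp
qed (rule assms)

lemma x_le: "i \<le> j \<Longrightarrow> x i \<le> x j"
  using x_mono by (simp add: strict_mono_less_eq)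

lemma x_nonneg: "0 \<le> x k"
  using x_le[of 0 k] x0 by simp

definition sol :: "complex ^ 'n \<Rightarrow> real \<Rightarrow> complex ^ 'n"
  where "sol c t = piece c (idx t) t"

lemma sol_eq: "x k \<le> t \<Longrightarrow> t < x (Suc k) \<Longrightarrow> sol c t = piece c k t"
  by (simp add: sol_def idx_eq)

lemma sol_linear: "sol (c + c') t = sol c t + sol c' t" "sol (a *s c) t = a *s sol c t"
  by (simp_all add: sol_def piece_linear)

lemma measurable_idx: "idx \<in> borel \<rightarrow>\<^sub>M count_space UNIV"
  unfolding idx_def[abs_def] by measurable

lemma measurable_sol: "sol c \<in> borel_measurable borel"
  unfolding sol_def[abs_def]
  by (rule measurable_compose_countable[OF _ measurable_idx])
    (intro borel_measurable_continuous_onI continuous_intros)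

lemma piece_tendsto: "(piece c k \<longlongrightarrow> piece c k a) (at a within S)" "(piece1 c k \<longlongrightarrow> piece1 c k a) (at a within S)"
  using piece_continuous[of UNIV c k]
  by (auto simp: continuous_on_eq_continuous_at isCont_def intro: tendsto_within_subset[where S = UNIV])

lemma sol_integral:
  "set_integrable lborel {0..<x N} (\<lambda>t. (norm (sol c t))\<^sup>2)"
  "(LINT t:{0..<x N}|lborel. (norm (sol c t))\<^sup>2) = (\<Sum>k<N. m c k)"
proof (induction N)
  case 0
  { case 1 show ?case by (simp add: x0 set_integrable_def) }
  { case 2 show ?case by (simp add: x0 set_lebesgue_integral_def) }
next
  case (Suc N)
  let ?S = "{x N..<x (Suc N)}"
  have ci: "continuous_on {x N..x (Suc N)} (\<lambda>t. (norm (piece c N t))\<^sup>2)"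
    by (intro continuous_intros)
  have i: "set_integrable lborel ?S (\<lambda>t. (norm (piece c N t))\<^sup>2)"
    by (rule set_integrable_subset[OF borel_integrable_atLeastAtMost'[OF ci]]) auto
  have i': "set_integrable lborel ?S (\<lambda>t. (norm (sol c t))\<^sup>2)"
    using i by (rule set_integrable_cong[THEN iffD1, rotated -1]) (auto simp: sol_eq)
  have "(LINT t:?S|lborel. (norm (sol c t))\<^sup>2) = (LINT t:?S|lborel. (norm (piece c N t))\<^sup>2)"
    by (rule set_lebesgue_integral_cong) (auto simp: sol_eq)
  also have "\<dots> = integral ?S (\<lambda>t. (norm (piece c N t))\<^sup>2)"
    by (rule set_borel_integral_eq_integral(2)[OF i])
  also have "\<dots> = m c N"
    unfolding m_def
  proof (rule integral_spike_set)
    have "{t \<in> {x N..x (Suc N)} - ?S. (norm (piece c N t))\<^sup>2 \<noteq> 0} \<subseteq> {x (Suc N)}" by auto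
    thus "negligible {t \<in> {x N..x (Suc N)} - ?S. (norm (piece c N t))\<^sup>2 \<noteq> 0}"
      by (rule negligible_subset[OF negligible_sing])
    have "{t \<in> ?S - {x N..x (Suc N)}. (norm (piece c N t))\<^sup>2 \<noteq> 0} = {}" by auto
    thus "negligible {t \<in> ?S - {x N..x (Suc N)}. (norm (piece c N t))\<^sup>2 \<noteq> 0}"
      by (simp only: negligible_empty)
  qed
  finally have L: "(LINT t:?S|lborel. (norm (sol c t))\<^sup>2) = m c N" .
  have un: "{0..<x (Suc N)} = {0..<x N} \<union> ?S"
    using x_nonneg[of N] x_less[of N] by auto
  { case 1 show ?case unfolding un by (rule set_integrable_Un[OF Suc.IH(1) i']) auto }
  { case 2
    have "(LINT t:{0..<x N} \<union> ?S|lborel. (norm (sol c t))\<^sup>2) =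
      (LINT t:{0..<x N}|lborel. (norm (sol c t))\<^sup>2) + (LINT t:?S|lborel. (norm (sol c t))\<^sup>2)"
      by (rule set_integral_Un[OF _ Suc.IH(1) i']) auto
    thus ?case unfolding un by (simp add: Suc.IH(2) L) }
qed

lemma sol_square_integrable_bounded: "square_integrable {0<..<x N} (sol c)"
  unfolding square_integrable_def
proof
  show "set_borel_measurable lborel {0<..<x N} (sol c)"
    using measurable_sol[of c] unfolding set_borel_measurable_def by simp
  show "set_integrable lborel {0<..<x N} (\<lambda>t. (norm (sol c t))\<^sup>2)"
    by (rule set_integrable_subset[OF sol_integral(1)]) auto
qed

lemma x_exceeds: "\<exists>N\<ge>n. r < x N"
proof -
  have "\<forall>\<^sub>F N in sequentially. r < x N" using x_lim by (simp add: filterlim_at_top_dense)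
  hence "\<forall>\<^sub>F N in sequentially. r < x N \<and> n \<le> N" by (intro eventually_conj eventually_ge_at_top)
  thus ?thesis by (auto simp: eventually_sequentially)
qed

lemma sol_square_integrable_iff: "square_integrable {0<..} (sol c) \<longleftrightarrow> summable (m c)"
proof
  assume "square_integrable {0<..} (sol c)"
  hence i: "set_integrable lborel {0<..} (\<lambda>t. (norm (sol c t))\<^sup>2)"
    by (simp add: square_integrable_def)
  show "summable (m c)"
  proof (rule summableI_nonneg_bounded)
    fix N
    have "AE t in lborel. t \<noteq> 0" by (rule AE_lborel_singleton)
    hence "AE t in lborel. indicator {0..<x N} t *\<^sub>R (norm (sol c t))\<^sup>2 \<le> indicator {0<..} t *\<^sub>R (norm (sol c t))\<^sup>2"
      by eventually_elim (auto simp: indicator_def)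
    hence "(LINT t:{0..<x N}|lborel. (norm (sol c t))\<^sup>2) \<le> (LINT t:{0<..}|lborel. (norm (sol c t))\<^sup>2)"
      using i sol_integral(1)[of N c] unfolding set_lebesgue_integral_def set_integrable_def
      by (intro integral_mono_AE) auto
    thus "(\<Sum>k<N. m c k) \<le> (LINT t:{0<..}|lborel. (norm (sol c t))\<^sup>2)" by (simp add: sol_integral)
  qed (rule m_nonneg)
next
  assume s: "summable (m c)"
  have "integrable lborel (\<lambda>t. indicator {0..} t *\<^sub>R (norm (sol c t))\<^sup>2)"
  proof (rule integrable_monotone_convergence)
    show "integrable lborel (\<lambda>t. indicator {0..<x N} t *\<^sub>R (norm (sol c t))\<^sup>2)" for N
      using sol_integral(1) by (simp add: set_integrable_def)
    show "AE t in lborel. mono (\<lambda>N. indicator {0..<x N} t *\<^sub>R (norm (sol c t))\<^sup>2)"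
      using x_le by (intro AE_I2 monoI) (auto simp: indicator_def intro: less_le_trans)
    show "AE t in lborel. (\<lambda>N. indicator {0..<x N} t *\<^sub>R (norm (sol c t))\<^sup>2) \<longlonglongrightarrow> indicator {0..} t *\<^sub>R (norm (sol c t))\<^sup>2"
    proof (rule AE_I2)
      fix t
      have "\<forall>\<^sub>F N in sequentially. t < x N" using x_lim by (simp add: filterlim_at_top_dense)
      hence "\<forall>\<^sub>F N in sequentially. indicator {0..<x N} t *\<^sub>R (norm (sol c t))\<^sup>2 = indicator {0..} t *\<^sub>R (norm (sol c t))\<^sup>2"
        by eventually_elim (auto simp: indicator_def)
      thus "(\<lambda>N. indicator {0..<x N} t *\<^sub>R (norm (sol c t))\<^sup>2) \<longlonglongrightarrow> indicator {0..} t *\<^sub>R (norm (sol c t))\<^sup>2"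
        by (rule tendsto_eventually)
    qed
    show "(\<lambda>N. LINT t|lborel. indicator {0..<x N} t *\<^sub>R (norm (sol c t))\<^sup>2) \<longlonglongrightarrow> suminf (m c)"
      using summable_LIMSEQ[OF s] sol_integral(2)[of _ c] by (simp add: set_lebesgue_integral_def)
    have [measurable]: "sol c \<in> borel_measurable borel" by (rule measurable_sol)
    show "(\<lambda>t. indicator {0..} t *\<^sub>R (norm (sol c t))\<^sup>2) \<in> borel_measurable lborel" by measurable
  qed
  hence "set_integrable lborel {0..} (\<lambda>t. (norm (sol c t))\<^sup>2)" by (simp add: set_integrable_def)
  hence "set_integrable lborel {0<..} (\<lambda>t. (norm (sol c t))\<^sup>2)"
    by (rule set_integrable_subset) auto
  moreover have "set_borel_measurable lborel {0<..} (sol c)"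
    using measurable_sol[of c] unfolding set_borel_measurable_def by simp
  ultimately show "square_integrable {0<..} (sol c)" by (simp add: square_integrable_def)
qed

text \<open>Formed with \<open>piece c k\<close> in place of \<open>sol c\<close>, so that the same
  expression has limits at both ends of the \<open>k\<close>-th interval.\<close>

definition bdry :: "complex ^ 'n \<Rightarrow> nat \<Rightarrow> (real \<Rightarrow> complex ^ 'n) \<Rightarrow> (real \<Rightarrow> complex ^ 'n) \<Rightarrow> real \<Rightarrow> complex"
  where "bdry c k f f1 t = cdot (f1 t) (piece c k t) - cdot (f t) (piece1 c k t)"

lemma bdry_tendsto:
  assumes "(f1 \<longlongrightarrow> l) (at a within S)" "(f \<longlongrightarrow> y) (at a within S)"
  shows "(bdry c k f f1 \<longlongrightarrow> cdot l (piece c k a) - cdot y (piece1 c k a)) (at a within S)"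
  unfolding bdry_def[abs_def] by (intro tendsto_diff tendsto_cdot assms piece_tendsto)

text \<open>At an interaction both functions change their derivative by the same hermitian matrix
  applied to their value, so the left and right limits of the boundary form agree and the intervals
  telescope.\<close>

lemma green_grid:
  assumes W: "\<And>k. k \<le> N \<Longrightarrow> W22_on (x k) (x (Suc k)) f f1 f2"
    and J: "\<And>k. k < N \<Longrightarrow> jump_condition (\<Lambda> (Suc k)) (x (Suc k)) f f1"
    and start: "(bdry c 0 f f1 \<longlongrightarrow> \<beta>0) (at_right 0)"
    and fin: "(bdry c N f f1 \<longlongrightarrow> \<beta>) (at_left (x (Suc N)))"
    and int: "set_integrable lborel {0<..<x (Suc N)} (\<lambda>t. cdot (f2 t) (sol c t) + cnj z * cdot (f t) (sol c t))"
  shows "(LINT t:{0<..<x (Suc N)}|lborel. cdot (f2 t) (sol c t) + cnj z * cdot (f t) (sol c t)) = \<beta> - \<beta>0"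
proof -
  let ?\<phi> = "\<lambda>t. cdot (f2 t) (sol c t) + cnj z * cdot (f t) (sol c t)"
  have local: "(LINT t:{x k<..<x (Suc k)}|lborel. ?\<phi> t) = \<beta>b - \<beta>a"
    if "k \<le> N" "(bdry c k f f1 \<longlongrightarrow> \<beta>a) (at_right (x k))" "(bdry c k f f1 \<longlongrightarrow> \<beta>b) (at_left (x (Suc k)))" for k \<beta>a \<beta>b
  proof -
    have "(LINT t:{x k<..<x (Suc k)}|lborel. ?\<phi> t) =
      (LINT t:{x k<..<x (Suc k)}|lborel. cdot (f2 t) (piece c k t) + cnj z * cdot (f t) (piece c k t))"
      by (rule set_lebesgue_integral_cong) (auto simp: sol_eq[of k])
    also have "\<dots> = \<beta>b - \<beta>a"
      using that(2,3) unfolding bdry_def[abs_def]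
      by (rule green_open_interval[OF x_less W[OF that(1)] piece_solves])
    finally show ?thesis .
  qed
  have "(LINT t:{0<..<x (Suc n)}|lborel. ?\<phi> t) = \<gamma> - \<beta>0"
    if "n \<le> N" "(bdry c n f f1 \<longlongrightarrow> \<gamma>) (at_left (x (Suc n)))" for n \<gamma>
    using that
  proof (induction n arbitrary: \<gamma>)
    case 0
    show ?case using local[of 0 \<beta>0 \<gamma>] 0 start by (simp add: x0)
  next
    case (Suc n)
    let ?y = "x (Suc n)"
    have int': "set_integrable lborel {0<..<x (Suc (Suc n))} ?\<phi>"
      by (rule set_integrable_subset[OF int]) (use x_le[of "Suc (Suc n)" "Suc N"] Suc.prems(1) in auto)
    from J[of n] Suc.prems(1) have "jump_condition (\<Lambda> (Suc n)) ?y f f1" by simp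
    then obtain l r where lims: "(f \<longlongrightarrow> f ?y) (at_left ?y)" "(f \<longlongrightarrow> f ?y) (at_right ?y)"
      "(f1 \<longlongrightarrow> l) (at_left ?y)" "(f1 \<longlongrightarrow> r) (at_right ?y)" and lr: "r - l = \<Lambda> (Suc n) *v f ?y"
      unfolding jump_condition_def by blast
    let ?\<beta> = "cdot l (piece c n ?y) - cdot (f ?y) (piece1 c n ?y)"
    have "cdot r (piece c (Suc n) ?y) - cdot (f ?y) (piece1 c (Suc n) ?y) = ?\<beta>"
    proof -
      have r: "r = l + \<Lambda> (Suc n) *v f ?y" using lr by (simp add: algebra_simps)
      have "cdot (f ?y) (P c (Suc n) - \<Lambda> (Suc n) *v U c (Suc n)) =
          cdot (f ?y) (P c (Suc n)) - cdot (f ?y) (\<Lambda> (Suc n) *v U c (Suc n))"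
        by (simp add: cdot_def sum_subtractf algebra_simps)
      thus ?thesis
        unfolding piece_left piece_right r cdot_add_left
        by (simp add: cdot_hermitian[OF herm\<Lambda>])
    qed
    hence right: "(bdry c (Suc n) f f1 \<longlongrightarrow> ?\<beta>) (at_right ?y)"
      using bdry_tendsto[OF lims(4,2), of c "Suc n"] by simp
    have "(LINT t:{0<..<?y}|lborel. ?\<phi> t) = ?\<beta> - \<beta>0"
      using Suc.prems(1) by (intro Suc.IH bdry_tendsto lims) simp
    moreover have "(LINT t:{?y<..<x (Suc (Suc n))}|lborel. ?\<phi> t) = \<gamma> - ?\<beta>"
      by (rule local[OF Suc.prems(1) right Suc.prems(2)])
    moreover have "(LINT t:{0<..<x (Suc (Suc n))}|lborel. ?\<phi> t) =
        (LINT t:{0<..<?y}|lborel. ?\<phi> t) + (LINT t:{?y<..<x (Suc (Suc n))}|lborel. ?\<phi> t)"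
      by (rule set_integral_split[OF x_nonneg less_imp_le[OF x_less] int'])
    ultimately show ?case by simp
  qed
  from this[OF order_refl fin] show ?thesis .
qed

lemma set_integral_tendsto:
  fixes \<phi> :: "real \<Rightarrow> complex"
  assumes "set_integrable lborel {0<..} \<phi>"
  shows "(\<lambda>N. LINT t:{0<..<x N}|lborel. \<phi> t) \<longlonglongrightarrow> (LINT t:{0<..}|lborel. \<phi> t)"
proof -
  have "(\<Union>N. {0<..<x N}) = {0<..}"
    using x_exceeds[of 0] by force
  moreover have "incseq (\<lambda>N. {0<..<x N})"
  proof (intro incseq_SucI subsetI)
    fix n t assume "t \<in> {0<..<x n}"
    thus "t \<in> {0<..<x (Suc n)}" using x_less[of n] by simp
  qed
  ultimately show ?thesis
    using set_integral_cont_up[of "\<lambda>N. {0<..<x N}" lborel \<phi>] assms by simp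
qed

text \<open>Both outer boundary terms vanish: at 0 by the Neumann conditions on \<open>f\<close> and
  on the solution, far out because \<open>f\<close> has bounded support. The integral over
  \<open>(0, x_N)\<close> is then 0 for all large \<open>N\<close>.\<close>

lemma green_domain:
  assumes f: "H_domain x \<Lambda> f f1 f2" and sq: "square_integrable {0<..} f" "square_integrable {0<..} f2"
    and c: "square_integrable {0<..} (sol c)"
  shows "(LINT t:{0<..}|lborel. cdot (f2 t) (sol c t) + cnj z * cdot (f t) (sol c t)) = 0"
proof -
  let ?\<phi> = "\<lambda>t. cdot (f2 t) (sol c t) + cnj z * cdot (f t) (sol c t)"
  have int: "set_integrable lborel {0<..} ?\<phi>"
    by (intro set_integral_add(1) set_integrable_mult_right set_integrable_cdot sq c)
  obtain R where R: "\<And>t. t > R \<Longrightarrow> f t = 0" using f by (auto simp: H_domain_def)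
  have W: "W22_on (x k) (x (Suc k)) f f1 f2" for k
    using f unfolding H_domain_def by (metis diff_Suc_1 le_add1 plus_1_eq_Suc)
  have J: "jump_condition (\<Lambda> (Suc k)) (x (Suc k)) f f1" for k
    using f unfolding H_domain_def by simp
  have ac: "set_integrable lborel {s..t} f1" "f t - f s = (LINT u:{s..t}|lborel. f1 u)"
    if "x k < s" "s \<le> t" "t < x (Suc k)" for s t k
    using W[of k] that unfolding W22_on_def ac_deriv_on_def by auto
  have start: "(bdry c 0 f f1 \<longlongrightarrow> 0) (at_right 0)"
  proof -
    have f10: "(f1 \<longlongrightarrow> 0) (at_right 0)" using f by (simp add: H_domain_def)
    hence "\<forall>\<^sub>F t in at_right 0. norm (f1 t) < 1"
      using tendsto_norm_zero[OF f10] by (intro order_tendstoD(2)) auto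
    then obtain e0 where e0: "e0 > 0" "\<And>t. 0 < t \<Longrightarrow> t < e0 \<Longrightarrow> norm (f1 t) < 1"
      by (auto simp: eventually_at_right_field)
    define e where "e = min e0 (x 1)"
    have e: "e > 0" "e \<le> x 1" "\<And>t. 0 < t \<Longrightarrow> t < e \<Longrightarrow> norm (f1 t) < 1"
      using e0 x_less[of 0] by (auto simp: e_def x0)
    \<comment> \<open>The domain conditions name no limit of \<open>f\<close> at 0. Boundedness near
      0, from that of \<open>f1\<close>, is enough, since \<open>piece1 c 0\<close> tends to 0
      there.\<close>
    define B where "B = norm (f (e/2)) + e"
    have bound: "norm (f t) \<le> B" if "0 < t" "t < e / 2" for t
    proof -
      have 1: "x 0 < t" "t \<le> e / 2" "e / 2 < x (Suc 0)" using that e by (auto simp: x0)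
      have "norm (LINT u:{t..e/2}|lborel. f1 u) \<le> 1 * (e/2 - t)"
        by (rule norm_set_integral_le[OF ac(1)[OF 1]]) (use that e in \<open>auto intro!: less_imp_le\<close>)
      hence "norm (f (e/2) - f t) \<le> e" using ac(2)[OF 1] that by simp
      thus ?thesis using norm_triangle_sub[of "f t" "f (e/2)"] by (simp add: B_def norm_minus_commute)
    qed
    have "((\<lambda>t. cdot (f t) (piece1 c 0 t)) \<longlongrightarrow> 0) (at_right 0)"
    proof (rule Lim_null_comparison)
      have "((\<lambda>t. CARD('n) * (B * norm (piece1 c 0 t))) \<longlongrightarrow> CARD('n) * (B * norm (piece1 c 0 0))) (at_right 0)"
        by (intro tendsto_intros piece_tendsto)
      thus "((\<lambda>t. CARD('n) * (B * norm (piece1 c 0 t))) \<longlongrightarrow> 0) (at_right 0)"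
        using piece_left(2)[of c 0] by (simp only: x0 UP_0 norm_zero mult_zero_right)
      have "\<forall>\<^sub>F t in at_right 0. 0 < t \<and> t < e / 2"
        using e(1) unfolding eventually_at_right_field by (intro exI[of _ "e/2"]) auto
      thus "\<forall>\<^sub>F t in at_right 0. norm (cdot (f t) (piece1 c 0 t)) \<le> CARD('n) * (B * norm (piece1 c 0 t))"
      proof eventually_elim
        case (elim t)
        show ?case
          using bound[of t] elim
          by (intro order_trans[OF norm_cdot_le_mult] mult_left_mono mult_right_mono) auto
      qed
    qed
    moreover have "((\<lambda>t. cdot (f1 t) (piece c 0 t)) \<longlongrightarrow> cdot 0 (piece c 0 0)) (at_right 0)"
      by (intro tendsto_cdot f10 piece_tendsto)
    ultimately show ?thesis
      unfolding bdry_def[abs_def] using tendsto_diff by (fastforce simp: cdot_def)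
  qed
  have fin: "(bdry c N f f1 \<longlongrightarrow> 0) (at_left (x (Suc N)))" if "R < x N" for N
  proof -
    let ?y = "x (Suc N)"
    obtain l where l: "(f1 \<longlongrightarrow> l) (at_left ?y)" and fl: "(f \<longlongrightarrow> f ?y) (at_left ?y)"
      using J[of N] by (auto simp: jump_condition_def)
    have "f ?y = 0" using R that x_less[of N] by simp
    \<comment> \<open>On the region where \<open>f\<close> vanishes, integrals of \<open>f1\<close>
      vanish, but its pointwise values are not prescribed. A nonzero limit \<open>l\<close> would
      keep \<open>f1\<close> close to \<open>l\<close> and make the integral over some
      \<open>{s..t}\<close> nonzero.\<close>
    moreover have "l = 0"
    proof (rule ccontr)
      assume "l \<noteq> 0"
      hence "\<forall>\<^sub>F t in at_left ?y. dist (f1 t) l < norm l / 2"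
        using l by (intro tendstoD) auto
      then obtain a0 where a0: "a0 < ?y" "\<And>t. a0 < t \<Longrightarrow> t < ?y \<Longrightarrow> dist (f1 t) l < norm l / 2"
        by (auto simp: eventually_at_left_field)
      define a where "a = max a0 (x N)"
      have a: "a < ?y" "x N \<le> a" "\<And>t. a < t \<Longrightarrow> t < ?y \<Longrightarrow> dist (f1 t) l < norm l / 2"
        using a0 x_less[of N] by (auto simp: a_def)
      define s t where "s = a + (?y - a) / 3" and "t = a + 2 * (?y - a) / 3"
      have st: "a < s" "s < t" "t < ?y" using a(1) by (simp_all add: s_def t_def field_simps)
      have st': "x N < s" "s \<le> t" "t < x (Suc N)" using st a by auto
      have f0: "f s = 0" "f t = 0" using R that st' by auto
      have const: "set_integrable lborel {s..t} (\<lambda>_. l)"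
        by (rule borel_integrable_atLeastAtMost') (intro continuous_intros)
      have "norm (LINT u:{s..t}|lborel. f1 u - l) \<le> norm l / 2 * (t - s)"
        by (rule norm_set_integral_le[OF set_integral_diff(1)[OF ac(1)[OF st'] const] st'(2)])
          (use a(3) st in \<open>auto simp: dist_norm intro!: less_imp_le\<close>)
      also have "(LINT u:{s..t}|lborel. f1 u - l) = - ((t - s) *\<^sub>R l)"
        using set_integral_diff(2)[OF ac(1)[OF st'] const] ac(2)[OF st'] f0 st'(2)
        by (simp add: set_lebesgue_integral_def)
      finally have "(t - s) * norm l \<le> norm l / 2 * (t - s)" using st by simp
      thus False using st \<open>l \<noteq> 0\<close> by (simp add: field_simps)
    qed
    ultimately show ?thesis
      using bdry_tendsto[OF l fl, of c N] by (simp add: cdot_def)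
  qed
  have "(LINT t:{0<..<x N}|lborel. ?\<phi> t) = 0" if N: "N \<ge> 1" "R < x (N - 1)" for N
  proof -
    obtain M where M: "N = Suc M" using N by (cases N) auto
    have "set_integrable lborel {0<..<x (Suc M)} ?\<phi>"
      by (rule set_integrable_subset[OF int]) auto
    from green_grid[OF W J start fin this] N show ?thesis by (simp add: M)
  qed
  moreover have "\<forall>\<^sub>F N in sequentially. N \<ge> 1 \<and> R < x (N - 1)"
  proof -
    obtain M where "R < x M" using x_exceeds[of 0 R] by auto
    have "R < x (N - 1)" if "N \<ge> Suc M" for N
    proof -
      have "x M \<le> x (N - 1)" using that by (intro x_le) simp
      with \<open>R < x M\<close> show ?thesis by (rule less_le_trans)
    qed
    thus ?thesis unfolding eventually_sequentially by (intro exI[of _ "Suc M"]) auto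
  qed
  ultimately have "\<forall>\<^sub>F N in sequentially. (LINT t:{0<..<x N}|lborel. ?\<phi> t) = 0"
    by (auto elim: eventually_mono)
  hence "(\<lambda>N. LINT t:{0<..<x N}|lborel. ?\<phi> t) \<longlonglongrightarrow> 0" by (rule tendsto_eventually)
  with set_integral_tendsto[OF int] show ?thesis by (rule LIMSEQ_unique)
qed

end

section \<open>Smooth pieces, variation of constants and vanishing almost everywhere\<close>

lemma square_integrable_cong:
  assumes "\<And>t. t \<in> S \<Longrightarrow> f t = g t"
  shows "square_integrable S f \<longleftrightarrow> square_integrable S g"
proof -
  have "(\<lambda>t. indicator S t *\<^sub>R f t) = (\<lambda>t. indicator S t *\<^sub>R g t)"
    "(\<lambda>t. indicat_real S t *\<^sub>R (norm (f t))\<^sup>2) = (\<lambda>t. indicat_real S t *\<^sub>R (norm (g t))\<^sup>2)"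
    using assms by (auto simp: indicator_def fun_eq_iff)
  thus ?thesis
    unfolding square_integrable_def set_borel_measurable_def set_integrable_def by (simp only:)
qed

lemma square_integrable_Un:
  assumes f: "square_integrable S f" "square_integrable T f" and [measurable]: "S \<in> sets borel" "T \<in> sets borel"
  shows "square_integrable (S \<union> T) f"
  unfolding square_integrable_def
proof
  have [measurable]: "(\<lambda>t. indicator S t *\<^sub>R f t) \<in> borel_measurable lborel"
      "(\<lambda>t. indicator T t *\<^sub>R f t) \<in> borel_measurable lborel"
    using f by (simp_all add: square_integrable_def set_borel_measurable_def)
  have "(\<lambda>t. indicator (S \<union> T) t *\<^sub>R f t) = (\<lambda>t. if t \<in> S then indicator S t *\<^sub>R f t else indicator T t *\<^sub>R f t)"
    by (auto simp: indicator_def fun_eq_iff)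
  also have "\<dots> \<in> borel_measurable lborel" by measurable
  finally show "set_borel_measurable lborel (S \<union> T) f" by (simp add: set_borel_measurable_def)
  show "set_integrable lborel (S \<union> T) (\<lambda>t. (norm (f t))\<^sup>2)"
    using f assms(3,4) unfolding square_integrable_def by (intro set_integrable_Un) auto
qed

lemma square_integrable_extend_zero:
  assumes f: "square_integrable S f" and "S \<subseteq> T" and zero: "\<And>t. t \<in> T - S \<Longrightarrow> f t = 0"
  shows "square_integrable T f"
proof -
  have "(\<lambda>t. indicator S t *\<^sub>R f t) = (\<lambda>t. indicator T t *\<^sub>R f t)"
    "(\<lambda>t. indicat_real S t *\<^sub>R (norm (f t))\<^sup>2) = (\<lambda>t. indicat_real T t *\<^sub>R (norm (f t))\<^sup>2)"
    using assms(2) zero by (fastforce simp: indicator_def fun_eq_iff)+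
  thus ?thesis
    using f unfolding square_integrable_def set_borel_measurable_def set_integrable_def by (simp only:)
qed

lemma ac_deriv_on_smooth:
  fixes \<phi> \<phi>1 f f1 :: "real \<Rightarrow> complex ^ 'n"
  assumes \<phi>: "\<And>t. t \<in> {a..b} \<Longrightarrow> (\<phi> has_vector_derivative \<phi>1 t) (at t within {a..b})"
    and \<phi>1: "continuous_on {a..b} \<phi>1"
    and eq: "\<And>t. t \<in> {a<..<b} \<Longrightarrow> f t = \<phi> t \<and> f1 t = \<phi>1 t"
  shows "ac_deriv_on {a<..<b} f f1"
  unfolding ac_deriv_on_def
proof (intro ballI impI conjI)
  fix s t assume st: "s \<in> {a<..<b}" "t \<in> {a<..<b}" "s \<le> t"
  have c: "continuous_on {s..t} \<phi>1" using st by (intro continuous_on_subset[OF \<phi>1]) auto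
  have cong: "f1 u = \<phi>1 u" if "u \<in> {s..t}" for u using eq[of u] st that by auto
  show "set_integrable lborel {s..t} f1"
    using borel_integrable_atLeastAtMost'[OF c]
    by (rule set_integrable_cong[THEN iffD1, rotated -1]) (auto simp: cong)
  have "(LINT u:{s..t}|lborel. f1 u) = (LINT u:{s..t}|lborel. \<phi>1 u)"
    by (rule set_lebesgue_integral_cong) (auto simp: cong)
  also have "\<dots> = \<phi> t - \<phi> s"
    unfolding set_lebesgue_integral_def
  proof (rule integral_FTC_atLeastAtMost[OF st(3) _ c])
    show "(\<phi> has_vector_derivative \<phi>1 u) (at u within {s..t})" if "s \<le> u" "u \<le> t" for u
      using st that by (intro has_vector_derivative_within_subset[OF \<phi>]) auto
  qed
  finally show "f t - f s = (LINT u:{s..t}|lborel. f1 u)" using eq st by simp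
qed

lemma W22_on_smooth:
  fixes \<phi> \<phi>1 \<phi>2 f f1 f2 :: "real \<Rightarrow> complex ^ 'n"
  assumes \<phi>: "\<And>t. t \<in> {a..b} \<Longrightarrow> (\<phi> has_vector_derivative \<phi>1 t) (at t within {a..b})"
    and \<phi>1: "\<And>t. t \<in> {a..b} \<Longrightarrow> (\<phi>1 has_vector_derivative \<phi>2 t) (at t within {a..b})"
    and \<phi>2: "continuous_on {a..b} \<phi>2"
    and eq: "\<And>t. t \<in> {a<..<b} \<Longrightarrow> f t = \<phi> t \<and> f1 t = \<phi>1 t \<and> f2 t = \<phi>2 t"
  shows "W22_on a b f f1 f2"
proof -
  have c: "continuous_on {a..b} \<phi>" "continuous_on {a..b} \<phi>1"
    by (rule continuous_on_vector_derivative[OF \<phi>] continuous_on_vector_derivative[OF \<phi>1]; assumption)+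
  have "square_integrable {a<..<b} \<phi>" "square_integrable {a<..<b} \<phi>1" "square_integrable {a<..<b} \<phi>2"
    by (intro square_integrable_continuous[of a b] c \<phi>2; simp add: greaterThanLessThan_subseteq_atLeastAtMost_iff)+
  moreover have "square_integrable {a<..<b} f \<longleftrightarrow> square_integrable {a<..<b} \<phi>"
    "square_integrable {a<..<b} f1 \<longleftrightarrow> square_integrable {a<..<b} \<phi>1"
    "square_integrable {a<..<b} f2 \<longleftrightarrow> square_integrable {a<..<b} \<phi>2"
    using eq by (intro square_integrable_cong; simp)+
  moreover have "ac_deriv_on {a<..<b} f f1"
    by (rule ac_deriv_on_smooth[OF \<phi> c(2)]) (use eq in auto)
  moreover have "ac_deriv_on {a<..<b} f1 f2"
    by (rule ac_deriv_on_smooth[OF \<phi>1 \<phi>2]) (use eq in auto)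
  ultimately show ?thesis by (simp add: W22_on_def)
qed

lemma bounded_bilinear_scale_vec: "bounded_bilinear (\<lambda>a v. a *s v :: complex ^ 'n)"
proof
  show "\<exists>K. \<forall>a v. norm (a *s v :: complex ^ 'n) \<le> norm a * norm v * K"
    by (intro exI[of _ 1]) (simp add: norm_scale_vec)
qed (simp_all add: vec_eq_iff algebra_simps)

text \<open>Variation of constants for \<open>- y'' - w y = h\<close>: the homogeneous part
  \<open>p\<close> carries the data at \<open>b\<close>, and the coefficients \<open>A\<close> and
  \<open>B\<close> are normalised to vanish there.\<close>

lemma inhomogeneous_solution:
  fixes h :: "real \<Rightarrow> complex ^ 'n"
  assumes "a < b" "w \<noteq> 0" and h: "continuous_on {a..b} h"
  shows "\<exists>\<phi> \<phi>1. (\<forall>t\<in>{a..b}. (\<phi> has_vector_derivative \<phi>1 t) (at t within {a..b}) \<and>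
      (\<phi>1 has_vector_derivative ((- w) *s \<phi> t - h t)) (at t within {a..b})) \<and> \<phi> b = y0 \<and> \<phi>1 b = y1"
proof -
  have cc: "continuous_on {a..b} (cs w)" "continuous_on {a..b} (sn w)"
    by (rule continuous_on_vector_derivative[OF cs_deriv[OF \<open>w \<noteq> 0\<close>]]
        continuous_on_vector_derivative[OF sn_deriv[OF \<open>w \<noteq> 0\<close>]])+
  note contI = bounded_bilinear.continuous_on[OF bounded_bilinear_scale_vec]
  have cA: "continuous_on {a..b} (\<lambda>t. - (cs w t *s h t))" and cB: "continuous_on {a..b} (\<lambda>t. - (sn w t *s h t))"
    by (intro continuous_on_minus contI cc h)+
  define A0 B0 where "A0 t = integral {a..t} (\<lambda>t. - (cs w t *s h t))"
    and "B0 t = integral {a..t} (\<lambda>t. - (sn w t *s h t))" for t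
  have A0: "(A0 has_vector_derivative - (cs w t *s h t)) (at t within {a..b})"
    and B0: "(B0 has_vector_derivative - (sn w t *s h t)) (at t within {a..b})" if "t \<in> {a..b}" for t
    using integral_has_vector_derivative[OF cA that] integral_has_vector_derivative[OF cB that]
    unfolding A0_def[abs_def] B0_def[abs_def] by simp_all
  define A B where "A t = A0 t - A0 b" and "B t = B0 t - B0 b" for t
  have A: "(A has_vector_derivative - (cs w t *s h t)) (at t within {a..b})"
    and B: "(B has_vector_derivative - (sn w t *s h t)) (at t within {a..b})" if "t \<in> {a..b}" for t
    using has_vector_derivative_diff[OF A0[OF that] has_vector_derivative_const, of "A0 b"]
      has_vector_derivative_diff[OF B0[OF that] has_vector_derivative_const, of "B0 b"]
    by (simp_all add: A_def[abs_def] B_def[abs_def])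
  define p where "p t = cs w (t - b) *s y0 + sn w (t - b) *s y1" for t
  define p1 where "p1 t = (- w * sn w (t - b)) *s y0 + cs w (t - b) *s y1" for t
  have p: "(p has_vector_derivative p1 t) (at t within {a..b})"
    "(p1 has_vector_derivative (- w) *s p t) (at t within {a..b})" if "t \<in> {a..b}" for t
    using linear_combination_solves[OF \<open>w \<noteq> 0\<close>, of "{a..b}" b y0 y1] that
    by (auto simp: solves_on_def p_def[abs_def] p1_def[abs_def])
  define \<phi> where "\<phi> t = p t + (sn w t *s A t - cs w t *s B t)" for t
  define \<phi>1 where "\<phi>1 t = p1 t + (cs w t *s A t + (w * sn w t) *s B t)" for t
  note prod = bounded_bilinear.has_vector_derivative[OF bounded_bilinear_scale_vec]
  have "(\<phi> has_vector_derivative \<phi>1 t) (at t within {a..b})" if t: "t \<in> {a..b}" for t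
  proof -
    have "(\<phi> has_vector_derivative p1 t + ((sn w t *s - (cs w t *s h t) + cs w t *s A t)
        - (cs w t *s - (sn w t *s h t) + (- w * sn w t) *s B t))) (at t within {a..b})"
      unfolding \<phi>_def[abs_def]
      by (intro has_vector_derivative_add has_vector_derivative_diff p t prod A B cs_deriv sn_deriv \<open>w \<noteq> 0\<close>)
    also have "p1 t + ((sn w t *s - (cs w t *s h t) + cs w t *s A t)
        - (cs w t *s - (sn w t *s h t) + (- w * sn w t) *s B t)) = \<phi>1 t"
      by (simp add: \<phi>1_def vec_eq_iff)
    finally show ?thesis .
  qed
  moreover have "(\<phi>1 has_vector_derivative ((- w) *s \<phi> t - h t)) (at t within {a..b})" if t: "t \<in> {a..b}" for t
  proof -
    have "(\<phi>1 has_vector_derivative (- w) *s p t + ((cs w t *s - (cs w t *s h t) + (- w * sn w t) *s A t)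
        + ((w * sn w t) *s - (sn w t *s h t) + (w * cs w t) *s B t))) (at t within {a..b})"
      unfolding \<phi>1_def[abs_def]
      by (intro has_vector_derivative_add p t prod A B cs_deriv sn_deriv has_vector_derivative_mult_right \<open>w \<noteq> 0\<close>)
    also have "(- w) *s p t + ((cs w t *s - (cs w t *s h t) + (- w * sn w t) *s A t)
        + ((w * sn w t) *s - (sn w t *s h t) + (w * cs w t) *s B t)) = (- w) *s \<phi> t - h t"
    proof -
      have id: "cs w t * (cs w t * y) + w * (sn w t * (sn w t * y)) = y" for y
        using arg_cong[OF cs_sn_identity[OF \<open>w \<noteq> 0\<close>, of t], of "\<lambda>v. v * y"] by (simp add: algebra_simps)
      show ?thesis by (simp add: \<phi>_def vec_eq_iff algebra_simps) (simp add: id)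
    qed
    finally show ?thesis .
  qed
  moreover have "\<phi> b = y0" "\<phi>1 b = y1"
    by (simp_all add: \<phi>_def \<phi>1_def p_def p1_def A_def B_def)
  ultimately show ?thesis by blast
qed

text \<open>By Lebesgue differentiation \<open>p\<close> is almost everywhere the limit of its
  averages over short intervals, all of which are 0.\<close>

lemma integrable_zero_on_intervals_AE:
  fixes p :: "real \<Rightarrow> complex"
  assumes p: "integrable lborel p" and zero: "\<And>s s'. s < s' \<Longrightarrow> (LINT t:{s<..<s'}|lborel. p t) = 0"
  shows "AE t in lborel. p t = 0"
proof -
  have si: "set_integrable lborel S p" if "S \<in> sets borel" for S
    using p that unfolding set_integrable_def by (intro integrable_mult_indicator) auto
  have int: "p integrable_on cbox a b" for a b
    by (rule set_borel_integral_eq_integral(1)[OF si]) simp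
  have integral0: "integral (cbox a b) p = 0" for a b
  proof (cases "a < b")
    case True
    have "integral (cbox a b) p = integral (box a b) p" by (rule integral_open_interval[symmetric])
    also have "\<dots> = (LINT t:{a<..<b}|lborel. p t)"
      using set_borel_integral_eq_integral(2)[OF si[of "{a<..<b}"]] by (simp add: box_real)
    finally show ?thesis using zero[OF True] by simp
  next
    case False
    show ?thesis by (rule integral_null) (use False in simp)
  qed
  obtain N where N: "negligible N" "\<And>x e. x \<notin> N \<Longrightarrow> 0 < e \<Longrightarrow>
      \<exists>d>0. \<forall>h. 0 < h \<and> h < d \<longrightarrow> norm (integral (cbox x (x + h *\<^sub>R One)) p /\<^sub>R h ^ DIM(real) - p x) < e"
    using integrable_ccontinuous_explicit[OF int] by metis
  have "p x = 0" if notin: "x \<notin> N" for x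
  proof (rule ccontr)
    assume "p x \<noteq> 0"
    then obtain d where "d > 0" "\<And>h. 0 < h \<Longrightarrow> h < d \<Longrightarrow> norm (integral (cbox x (x + h *\<^sub>R One)) p /\<^sub>R h ^ DIM(real) - p x) < norm (p x)"
      using N(2)[OF notin, of "norm (p x)"] by auto
    from this(2)[of "d / 2"] this(1) show False unfolding integral0 by simp
  qed
  hence sub: "{t. p t \<noteq> 0} \<subseteq> N" by blast
  have [measurable]: "p \<in> borel_measurable borel" using borel_measurable_integrable[OF p] by simp
  have "{t. p t \<noteq> 0} \<in> null_sets lebesgue"
    using negligible_subset[OF N(1) sub] by (simp add: negligible_iff_null_sets)
  moreover have "{t. p t \<noteq> 0} \<in> sets lborel" by measurable
  ultimately have "{t. p t \<noteq> 0} \<in> null_sets lborel"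
    using null_sets_completion_iff by blast
  from AE_not_in[OF this] show ?thesis by simp
qed

text \<open>Indicators of intervals are dominated limits of continuous trapezoids, so every
  component integrates to 0 over every interval.\<close>

lemma AE_zero_if_orthogonal_to_continuous:
  fixes q :: "real \<Rightarrow> complex ^ 'n"
  assumes q: "square_integrable {0<..<b} q"
    and orth: "\<And>h. continuous_on UNIV h \<Longrightarrow> (LINT t:{0<..<b}|lborel. cdot (h t) (q t)) = 0"
  shows "AE t in lborel. t \<in> {0<..<b} \<longrightarrow> q t = 0"
proof -
  have comp: "AE t in lborel. indicator {0<..<b} t *\<^sub>R cnj (q t $ j) = 0" for j
  proof (rule integrable_zero_on_intervals_AE)
    let ?p = "\<lambda>t. indicator {0<..<b} t *\<^sub>R cnj (q t $ j)"
    have cdot_axis: "cdot (axis j 1) v = cnj (v $ j)" for v :: "complex ^ 'n"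
      by (simp add: cdot_def axis_def if_distrib[of "\<lambda>y. y * _"] cong: if_cong)
    have "square_integrable {0<..<b} (\<lambda>_. axis j 1 :: complex ^ 'n)"
      by (rule square_integrable_continuous[of 0 b]) (auto intro: continuous_intros)
    from set_integrable_cdot[OF this q] show p: "integrable lborel ?p"
      by (simp add: set_integrable_def cdot_axis)
    fix s s' :: real assume "s < s'"
    \<comment> \<open>A trapezoid of slope \<open>n\<close> supported in \<open>{s..s'}\<close>; it
      converges pointwise to the indicator of the open interval.\<close>
    define \<tau> where "\<tau> n t = max 0 (min 1 (min (real n * (t - s)) (real n * (s' - t))))" for n t
    have c\<tau>: "continuous_on UNIV (\<tau> n)" for n
      unfolding \<tau>_def[abs_def] by (intro continuous_intros)
    have zero: "(LINT t|lborel. of_real (\<tau> n t) * ?p t) = 0" for n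
    proof -
      have "continuous_on UNIV (\<lambda>t. of_real (\<tau> n t) *s (axis j 1 :: complex ^ 'n))"
        by (intro bounded_linear.continuous_on[OF bounded_linear_scale_left] continuous_on_of_real c\<tau>)
      from orth[OF this] show ?thesis
        by (simp add: cdot_scale_left cdot_axis set_lebesgue_integral_def mult_scaleR_right[symmetric] del: mult_scaleR_right)
    qed
    have "(\<lambda>n. LINT t|lborel. of_real (\<tau> n t) * ?p t) \<longlonglongrightarrow> (LINT t|lborel. indicator {s<..<s'} t *\<^sub>R ?p t)"
    proof (rule integral_dominated_convergence)
      have [measurable]: "?p \<in> borel_measurable lborel" using p by (rule borel_measurable_integrable)
      have [measurable]: "\<tau> n \<in> borel_measurable borel" for n
        by (rule borel_measurable_continuous_onI[OF c\<tau>])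
      show "(\<lambda>t. indicator {s<..<s'} t *\<^sub>R ?p t) \<in> borel_measurable lborel" by measurable
      show "(\<lambda>t. of_real (\<tau> n t) * ?p t) \<in> borel_measurable lborel" for n by measurable
      show "integrable lborel (\<lambda>t. norm (?p t))" using p by (rule integrable_norm)
      show "AE t in lborel. norm (of_real (\<tau> n t) * ?p t) \<le> norm (?p t)" for n
      proof (rule AE_I2)
        fix t
        have "norm (of_real (\<tau> n t) * ?p t) = \<bar>\<tau> n t\<bar> * norm (?p t)" by (simp only: norm_mult norm_of_real)
        also have "\<dots> \<le> 1 * norm (?p t)" by (intro mult_right_mono) (auto simp: \<tau>_def)
        finally show "norm (of_real (\<tau> n t) * ?p t) \<le> norm (?p t)" by simp
      qed
      show "AE t in lborel. (\<lambda>n. of_real (\<tau> n t) * ?p t) \<longlonglongrightarrow> indicator {s<..<s'} t *\<^sub>R ?p t"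
      proof (rule AE_I2)
        fix t
        have "(\<lambda>n. \<tau> n t) \<longlonglongrightarrow> indicator {s<..<s'} t"
        proof (cases "t \<in> {s<..<s'}")
          case True
          define e where "e = min (t - s) (s' - t)"
          have "e > 0" using True by (simp add: e_def)
          have one: "\<tau> n t = 1" if n: "n \<ge> nat \<lceil>1 / e\<rceil>" for n
          proof -
            have "1 / e \<le> real n" using n by linarith
            hence "1 \<le> real n * e" using \<open>e > 0\<close> by (simp add: field_simps)
            moreover have "real n * e \<le> real n * (t - s)" "real n * e \<le> real n * (s' - t)"
              by (intro mult_left_mono; simp add: e_def)+
            ultimately show ?thesis by (simp add: \<tau>_def)
          qed
          have "\<forall>\<^sub>F n in sequentially. \<tau> n t = indicator {s<..<s'} t"
            by (rule eventually_sequentiallyI[of "nat \<lceil>1 / e\<rceil>"]) (use one True in simp)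
          thus ?thesis by (rule tendsto_eventually)
        next
          case False
          have "\<tau> n t = 0" for n
          proof -
            have "real n * (t - s) \<le> 0 \<or> real n * (s' - t) \<le> 0"
              using False by (auto simp: mult_le_0_iff)
            thus ?thesis by (auto simp: \<tau>_def)
          qed
          thus ?thesis using False by simp
        qed
        hence "(\<lambda>n. of_real (\<tau> n t) * ?p t) \<longlonglongrightarrow> of_real (indicator {s<..<s'} t) * ?p t"
          by (intro tendsto_intros)
        thus "(\<lambda>n. of_real (\<tau> n t) * ?p t) \<longlonglongrightarrow> indicator {s<..<s'} t *\<^sub>R ?p t"
          by (simp add: scaleR_conv_of_real)
      qed
    qed
    thus "(LINT t:{s<..<s'}|lborel. ?p t) = 0"
      unfolding zero set_lebesgue_integral_def by (simp add: LIMSEQ_const_iff)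
  qed
  have "AE t in lborel. \<forall>j. indicator {0<..<b} t *\<^sub>R cnj (q t $ j) = 0"
    unfolding AE_all_countable using comp by blast
  thus ?thesis
    by eventually_elim (auto simp: vec_eq_iff indicator_def split: if_splits)
qed

lemma tendsto_at_ends:
  fixes f \<phi> :: "real \<Rightarrow> 'a::t2_space"
  assumes "a < b" and \<phi>: "continuous_on {a..b} \<phi>" and eq: "\<And>t. t \<in> {a<..<b} \<Longrightarrow> f t = \<phi> t"
  shows "(f \<longlongrightarrow> \<phi> a) (at_right a)" "(f \<longlongrightarrow> \<phi> b) (at_left b)"
proof -
  have "(\<phi> \<longlongrightarrow> \<phi> a) (at a within {a..b})" "(\<phi> \<longlongrightarrow> \<phi> b) (at b within {a..b})"
    using \<phi> \<open>a < b\<close> by (auto simp: continuous_on_def)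
  hence lim: "(\<phi> \<longlongrightarrow> \<phi> a) (at_right a)" "(\<phi> \<longlongrightarrow> \<phi> b) (at_left b)"
    using \<open>a < b\<close> by (simp_all add: at_within_Icc_at_right at_within_Icc_at_left)
  have "\<forall>\<^sub>F t in at_right a. \<phi> t = f t"
    using eventually_at_right_real[OF \<open>a < b\<close>] by eventually_elim (simp add: eq)
  thus "(f \<longlongrightarrow> \<phi> a) (at_right a)" by (rule Lim_transform_eventually[OF lim(1)])
  have "\<forall>\<^sub>F t in at_left b. \<phi> t = f t"
    using eventually_at_left_real[OF \<open>a < b\<close>] by eventually_elim (simp add: eq)
  thus "(f \<longlongrightarrow> \<phi> b) (at_left b)" by (rule Lim_transform_eventually[OF lim(2)])
qed

section \<open>Domain elements with prescribed right-hand side\<close>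

context grid
begin

lemma cnj_z_neq_0: "cnj z \<noteq> 0" using z_neq_0 by simp

text \<open>The data are imposed at the last node, hence the recursion runs from right to left:
  crossing a node backwards subtracts the jump from the derivative. The induction therefore has to
  allow arbitrary final data \<open>y0\<close> and \<open>y1\<close>. The parameter is
  \<open>cnj z\<close> because a solution for \<open>z\<close> occupies the conjugated argument of
  the pairing.\<close>

lemma backward_family:
  assumes h: "continuous_on UNIV h"
  shows "\<exists>\<phi> \<phi>1. (\<forall>k\<le>N. \<forall>t\<in>{x k..x (Suc k)}. (\<phi> k has_vector_derivative \<phi>1 k t) (at t within {x k..x (Suc k)}) \<and>
      (\<phi>1 k has_vector_derivative ((- cnj z) *s \<phi> k t - h t)) (at t within {x k..x (Suc k)})) \<and>
    (\<forall>k<N. \<phi> (Suc k) (x (Suc k)) = \<phi> k (x (Suc k)) \<and>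
      \<phi>1 (Suc k) (x (Suc k)) - \<phi>1 k (x (Suc k)) = \<Lambda> (Suc k) *v \<phi> k (x (Suc k))) \<and>
    \<phi> N (x (Suc N)) = y0 \<and> \<phi>1 N (x (Suc N)) = y1"
proof (induction N arbitrary: y0 y1)
  case 0
  obtain \<psi> \<psi>1 where "(\<forall>t\<in>{x 0..x (Suc 0)}. (\<psi> has_vector_derivative \<psi>1 t) (at t within {x 0..x (Suc 0)}) \<and>
      (\<psi>1 has_vector_derivative ((- cnj z) *s \<psi> t - h t)) (at t within {x 0..x (Suc 0)})) \<and>
      \<psi> (x (Suc 0)) = y0 \<and> \<psi>1 (x (Suc 0)) = y1"
    using inhomogeneous_solution[OF x_less[of 0] cnj_z_neq_0 continuous_on_subset[OF h subset_UNIV], of y0 y1] by blast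
  thus ?case by (intro exI[of _ "\<lambda>_. \<psi>"] exI[of _ "\<lambda>_. \<psi>1"]) simp
next
  case (Suc N)
  let ?a = "x (Suc N)" and ?b = "x (Suc (Suc N))"
  obtain \<psi> \<psi>1 where \<psi>: "(\<forall>t\<in>{?a..?b}. (\<psi> has_vector_derivative \<psi>1 t) (at t within {?a..?b}) \<and>
      (\<psi>1 has_vector_derivative ((- cnj z) *s \<psi> t - h t)) (at t within {?a..?b})) \<and> \<psi> ?b = y0 \<and> \<psi>1 ?b = y1"
    using inhomogeneous_solution[OF x_less cnj_z_neq_0 continuous_on_subset[OF h subset_UNIV], of "Suc N" y0 y1] by blast
  from Suc.IH[of "\<psi> ?a" "\<psi>1 ?a - \<Lambda> (Suc N) *v \<psi> ?a"] obtain \<phi> \<phi>1 where \<phi>: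
    "\<forall>k\<le>N. \<forall>t\<in>{x k..x (Suc k)}. (\<phi> k has_vector_derivative \<phi>1 k t) (at t within {x k..x (Suc k)}) \<and>
      (\<phi>1 k has_vector_derivative ((- cnj z) *s \<phi> k t - h t)) (at t within {x k..x (Suc k)})"
    "\<forall>k<N. \<phi> (Suc k) (x (Suc k)) = \<phi> k (x (Suc k)) \<and>
      \<phi>1 (Suc k) (x (Suc k)) - \<phi>1 k (x (Suc k)) = \<Lambda> (Suc k) *v \<phi> k (x (Suc k))"
    "\<phi> N ?a = \<psi> ?a" "\<phi>1 N ?a = \<psi>1 ?a - \<Lambda> (Suc N) *v \<psi> ?a"
    by (elim exE conjE) (rule that)
  show ?case
    by (rule exI[of _ "\<phi>(Suc N := \<psi>)"], rule exI[of _ "\<phi>1(Suc N := \<psi>1)"])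
      (use \<psi> \<phi> in \<open>auto simp: le_Suc_eq less_Suc_eq\<close>)
qed

lemma square_integrable_pieces:
  assumes c: "\<And>k. k \<le> N \<Longrightarrow> continuous_on {x k..x (Suc k)} (\<phi> k)"
    and eq: "\<And>k t. k \<le> N \<Longrightarrow> x k \<le> t \<Longrightarrow> t < x (Suc k) \<Longrightarrow> f t = \<phi> k t"
    and zero: "\<And>t. x (Suc N) \<le> t \<Longrightarrow> f t = 0"
  shows "square_integrable {0<..} f"
proof -
  have "square_integrable {0..<x (Suc n)} f" if "n \<le> N" for n
    using that
  proof (induction n)
    case 0
    have "square_integrable {0..<x (Suc 0)} (\<phi> 0)"
      by (rule square_integrable_continuous[OF c[of 0]]) (auto simp: x0)
    thus ?case using eq[of 0] by (subst square_integrable_cong[of _ f "\<phi> 0"]) (auto simp: x0)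
  next
    case (Suc n)
    let ?S = "{x (Suc n)..<x (Suc (Suc n))}"
    have "square_integrable ?S (\<phi> (Suc n))"
      by (rule square_integrable_continuous[OF c[OF Suc.prems]]) auto
    hence "square_integrable ?S f"
      using eq[OF Suc.prems] by (subst square_integrable_cong[of _ f "\<phi> (Suc n)"]) auto
    hence "square_integrable ({0..<x (Suc n)} \<union> ?S) f"
      using Suc by (intro square_integrable_Un) auto
    moreover have "{0..<x (Suc n)} \<union> ?S = {0..<x (Suc (Suc n))}"
      using x_nonneg[of "Suc n"] x_less[of "Suc n"] by auto
    ultimately show ?case by simp
  qed
  from this[of N] have "square_integrable {0<..<x (Suc N)} f"
    by (rule square_integrable_subset[where S = "{0..<x (Suc N)}", OF _ _ borel_open]) auto
  thus ?thesis by (rule square_integrable_extend_zero) (use zero in auto)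
qed

text \<open>
  Solving \<open>- f'' - cnj z f = h\<close> backwards from vanishing data at \<open>x\<^bsub>N+1\<^esub>\<close> produces an element of the
  domain precisely if \<open>f' (0) = 0\<close>, which by Green's formula is orthogonality of \<open>h\<close> to the solutions.
\<close>

lemma orthogonal_test_function:
  assumes h: "continuous_on UNIV h"
    and orth: "\<And>i. (LINT t:{0<..<x (Suc N)}|lborel. cdot (h t) (sol (axis i 1) t)) = 0"
  shows "\<exists>f f1 f2. H_domain x \<Lambda> f f1 f2 \<and> square_integrable {0<..} f \<and> square_integrable {0<..} f2 \<and>
    (\<forall>t>0. f2 t + cnj z *s f t = (if t < x (Suc N) then - h t else 0))"
proof -
  obtain \<phi>0 \<psi>0 where fam:
    "\<forall>k\<le>N. \<forall>t\<in>{x k..x (Suc k)}. (\<phi>0 k has_vector_derivative \<psi>0 k t) (at t within {x k..x (Suc k)}) \<and>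
      (\<psi>0 k has_vector_derivative ((- cnj z) *s \<phi>0 k t - h t)) (at t within {x k..x (Suc k)})"
    "\<forall>k<N. \<phi>0 (Suc k) (x (Suc k)) = \<phi>0 k (x (Suc k)) \<and>
      \<psi>0 (Suc k) (x (Suc k)) - \<psi>0 k (x (Suc k)) = \<Lambda> (Suc k) *v \<phi>0 k (x (Suc k))"
    "\<phi>0 N (x (Suc N)) = 0" "\<psi>0 N (x (Suc N)) = 0"
    using backward_family[OF h, of N 0 0] by (elim exE conjE) (rule that)
  \<comment> \<open>Continuation by 0 beyond \<open>x_(N+1)\<close> respects the jump condition at
    that node, as value and derivative vanish there.\<close>
  define \<phi> where "\<phi> k = (if k \<le> N then \<phi>0 k else (\<lambda>_. 0))" for k
  define \<psi> where "\<psi> k = (if k \<le> N then \<psi>0 k else (\<lambda>_. 0))" for k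
  define \<xi> where "\<xi> k t = (if k \<le> N then (- cnj z) *s \<phi>0 k t - h t else 0)" for k t
  have d\<phi>: "(\<phi> k has_vector_derivative \<psi> k t) (at t within {x k..x (Suc k)})"
    and d\<psi>: "(\<psi> k has_vector_derivative \<xi> k t) (at t within {x k..x (Suc k)})" if "t \<in> {x k..x (Suc k)}" for k t
    using fam(1) that by (auto simp: \<phi>_def \<psi>_def \<xi>_def)
  have c: "continuous_on {x k..x (Suc k)} (\<phi> k)" "continuous_on {x k..x (Suc k)} (\<psi> k)" for k
    by (rule continuous_on_vector_derivative[OF d\<phi>] continuous_on_vector_derivative[OF d\<psi>]; assumption)+
  have c\<xi>: "continuous_on {x k..x (Suc k)} (\<xi> k)" for k
  proof (cases "k \<le> N")
    case True
    have "continuous_on {x k..x (Suc k)} (\<lambda>t. (- cnj z) *s \<phi> k t - h t)"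
      by (intro continuous_on_diff continuous_on_scale_vec c continuous_on_subset[OF h subset_UNIV])
    thus ?thesis using True by (simp add: \<xi>_def[abs_def] \<phi>_def)
  qed (simp add: \<xi>_def[abs_def])
  have match: "\<phi> (Suc k) (x (Suc k)) = \<phi> k (x (Suc k))"
    "\<psi> (Suc k) (x (Suc k)) - \<psi> k (x (Suc k)) = \<Lambda> (Suc k) *v \<phi> k (x (Suc k))" for k
  proof -
    consider "k < N" | "k = N" | "k > N" by linarith
    thus "\<phi> (Suc k) (x (Suc k)) = \<phi> k (x (Suc k))"
      "\<psi> (Suc k) (x (Suc k)) - \<psi> k (x (Suc k)) = \<Lambda> (Suc k) *v \<phi> k (x (Suc k))"
      using fam(2-4) by (cases; auto simp: \<phi>_def \<psi>_def)+
  qed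
  define f f1 f2 where "f t = \<phi> (idx t) t" and "f1 t = \<psi> (idx t) t" and "f2 t = \<xi> (idx t) t" for t
  have f_eq: "f t = \<phi> k t" "f1 t = \<psi> k t" "f2 t = \<xi> k t" if "x k \<le> t" "t < x (Suc k)" for k t
    using idx_eq[OF that] by (simp_all add: f_def f1_def f2_def)
  have idx_ge: "\<exists>k. x k \<le> t \<and> t < x (Suc k)" if t: "0 \<le> t" for t
  proof -
    obtain n where "t < x n" using x_exceeds[of 0 t] by blast
    moreover have "0 < n" using \<open>t < x n\<close> t x0 by (cases n) auto
    ultimately have ex: "\<exists>k. t < x (Suc k)" by (cases n) auto
    define k where "k = (LEAST k. t < x (Suc k))"
    have "t < x (Suc k)" unfolding k_def using ex by (rule LeastI_ex)
    moreover have "x k \<le> t"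
    proof (cases k)
      case (Suc j)
      hence "\<not> t < x (Suc j)" using not_less_Least[of j "\<lambda>k. t < x (Suc k)"] unfolding k_def by simp
      thus ?thesis using Suc by simp
    qed (use t x0 in simp)
    ultimately show ?thesis by blast
  qed
  have far: "f t = 0" "f2 t = 0" if t: "x (Suc N) \<le> t" for t
  proof -
    have "0 \<le> t" using t x_nonneg[of "Suc N"] by simp
    then obtain k where k: "x k \<le> t" "t < x (Suc k)" using idx_ge by blast
    have "x (Suc N) < x (Suc k)" using t k(2) by simp
    hence "k > N" using x_mono by (simp add: strict_mono_less)
    thus "f t = 0" "f2 t = 0" using f_eq[OF k] by (simp_all add: \<phi>_def \<xi>_def)
  qed
  have W: "W22_on (x k) (x (Suc k)) f f1 f2" for k
    by (rule W22_on_smooth[OF d\<phi> d\<psi> c\<xi>]) (use f_eq[of k] in auto)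
  have lims: "(f \<longlongrightarrow> \<phi> k (x k)) (at_right (x k))" "(f \<longlongrightarrow> \<phi> k (x (Suc k))) (at_left (x (Suc k)))"
    "(f1 \<longlongrightarrow> \<psi> k (x k)) (at_right (x k))" "(f1 \<longlongrightarrow> \<psi> k (x (Suc k))) (at_left (x (Suc k)))" for k
    using f_eq[of k] by (auto intro!: tendsto_at_ends[OF x_less] c)
  have J: "jump_condition (\<Lambda> (Suc k)) (x (Suc k)) f f1" for k
  proof -
    have fx: "f (x (Suc k)) = \<phi> k (x (Suc k))"
      using f_eq(1)[of "Suc k" "x (Suc k)"] x_less[of "Suc k"] match(1) by simp
    show ?thesis
      unfolding jump_condition_def fx
      using lims(2)[of k] lims(1)[of "Suc k"] lims(4)[of k] lims(3)[of "Suc k"] match[of k] by auto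
  qed
  have sum: "f2 t + cnj z *s f t = (if t < x (Suc N) then - h t else 0)" if t: "0 < t" for t
  proof (cases "t < x (Suc N)")
    case True
    obtain k where k: "x k \<le> t" "t < x (Suc k)" using idx_ge[of t] t by auto
    have "x k < x (Suc N)" using True k(1) by simp
    hence "k \<le> N" using x_mono by (simp add: strict_mono_less)
    thus ?thesis using True by (simp add: f_eq[OF k] \<phi>_def \<xi>_def vec_eq_iff)
  qed (use far in simp)
  have sq: "square_integrable {0<..} f" "square_integrable {0<..} f2"
    using square_integrable_pieces[of N \<phi> f, OF c(1) f_eq(1) far(1)]
      square_integrable_pieces[of N \<xi> f2, OF c\<xi> f_eq(3) far(2)] by simp_all
  \<comment> \<open>Green's formula against the solution with initial value \<open>axis i 1\<close>
    has only one surviving boundary term, component \<open>i\<close> of the derivative at 0.\<close>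
  have "\<psi> 0 0 = 0"
  proof -
    have "cnj ((\<psi> 0 0) $ i) = 0" for i
    proof -
      let ?\<phi> = "\<lambda>t. cdot (f2 t) (sol (axis i 1) t) + cnj z * cdot (f t) (sol (axis i 1) t)"
      have \<phi>_eq: "?\<phi> t = - cdot (h t) (sol (axis i 1) t)" if "t \<in> {0<..<x (Suc N)}" for t
      proof -
        have "?\<phi> t = cdot (f2 t + cnj z *s f t) (sol (axis i 1) t)"
          by (simp add: cdot_add_left cdot_scale_left)
        also have "\<dots> = - cdot (h t) (sol (axis i 1) t)"
          using sum[of t] that by (simp add: cdot_def sum_negf)
        finally show ?thesis .
      qed
      have int: "set_integrable lborel {0<..<x (Suc N)} ?\<phi>"
        by (intro set_integral_add(1) set_integrable_mult_right set_integrable_cdot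
            sol_square_integrable_bounded square_integrable_subset[OF sq(1)] square_integrable_subset[OF sq(2)]) auto
      have start: "(bdry (axis i 1) 0 f f1 \<longlongrightarrow> cdot (\<psi> 0 0) (axis i 1)) (at_right 0)"
        using bdry_tendsto[OF lims(3)[of 0] lims(1)[of 0], of "axis i 1" 0]
        by (simp add: piece_left x0[symmetric]) (simp add: x0 cdot_def)
      have fin: "(bdry (axis i 1) N f f1 \<longlongrightarrow> 0) (at_left (x (Suc N)))"
        using bdry_tendsto[OF lims(4)[of N] lims(2)[of N], of "axis i 1" N] fam(3,4)
        by (simp add: \<phi>_def \<psi>_def cdot_def)
      have "(LINT t:{0<..<x (Suc N)}|lborel. ?\<phi> t) = 0 - cdot (\<psi> 0 0) (axis i 1)"
        by (rule green_grid[OF W J start fin int])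
      moreover have "(LINT t:{0<..<x (Suc N)}|lborel. ?\<phi> t) =
          (LINT t:{0<..<x (Suc N)}|lborel. - cdot (h t) (sol (axis i 1) t))"
        by (rule set_lebesgue_integral_cong) (use \<phi>_eq in auto)
      ultimately have "cdot (\<psi> 0 0) (axis i 1) = 0"
        using orth[of i] by (simp add: set_lebesgue_integral_def)
      thus ?thesis by (simp add: cdot_def axis_def if_distrib[of cnj] if_distrib[of "\<lambda>y. _ * y"] cong: if_cong)
    qed
    thus ?thesis by (simp add: vec_eq_iff)
  qed
  hence "(f1 \<longlongrightarrow> 0) (at_right 0)" using lims(3)[of 0] by (simp add: x0)
  moreover have "W22_on (x (k - 1)) (x k) f f1 f2 \<and> jump_condition (\<Lambda> k) (x k) f f1" if "k \<ge> 1" for k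
    using that W[of "k - 1"] J[of "k - 1"] by simp
  moreover have "\<forall>t>x (Suc N). f t = 0" using far by simp
  ultimately have "H_domain x \<Lambda> f f1 f2" unfolding H_domain_def by blast
  with sq sum show ?thesis by blast
qed

end

lemma cdot_axis_left: "cdot (a *s axis j 1) v = a * cnj (v $ j)"
  by (simp add: cdot_def axis_def if_distrib[of "\<lambda>y. y * _"] if_distrib[of "\<lambda>y. _ * y"] cong: if_cong)

lemma cdot_sum_left: "cdot (\<Sum>i\<in>S. f i) v = (\<Sum>i\<in>S. cdot (f i) v)"
  by (induction S rule: infinite_finite_induct) (simp_all add: cdot_add_left, simp_all add: cdot_def)

lemma cdot_sum_right: "cdot v (\<Sum>i\<in>S. f i) = (\<Sum>i\<in>S. cdot v (f i))"
  by (subst cdot_commute, subst cdot_sum_left, subst cnj_sum, rule sum.cong[OF refl], subst cdot_commute) simp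

lemma cdot_scale_right: "cdot v (a *s w) = cnj a * cdot v w"
  by (subst cdot_commute, subst cdot_scale_left, subst (2) cdot_commute) simp

section \<open>Weak solutions are classical\<close>

context grid
begin

lemma sol_expand: "sol c t = (\<Sum>i\<in>UNIV. c $ i *s sol (axis i 1) t)"
proof -
  have "Vector_Spaces.linear (*s) (*s) (\<lambda>c. sol c t)"
    by unfold_locales (simp_all add: sol_linear algebra_simps vector_add_ldistrib)
  from vec.linear_sum[OF this, of "\<lambda>i. c $ i *s axis i 1" UNIV] show ?thesis
    by (simp add: basis_expansion sol_linear)
qed

lemma sol_first: "0 \<le> t \<Longrightarrow> t < x 1 \<Longrightarrow> sol c t = cs z t *s c"
  using sol_eq[of 0 t c] by (simp add: x0 piece_def)

text \<open>On the first interval \<open>sol c t\<close> is just \<open>cs z t *s c\<close>, so one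
  scalar weight suffices. The factor \<open>x 1 - t\<close> lets it be extended continuously by 0,
  and \<open>K\<close> normalises the pairing; \<open>K\<close> is nonzero because its integrand is
  positive at 0.\<close>

lemma dual_test_function:
  "\<exists>\<psi>. continuous_on UNIV \<psi> \<and> (\<forall>t\<ge>x 1. \<psi> t = 0) \<and>
    (\<forall>N i j. (LINT t:{0<..<x (Suc N)}|lborel. cdot (\<psi> t *s axis i 1) (sol (axis j 1) t)) = (if i = j then 1 else 0))"
proof -
  define K where "K = integral {0..x 1} (\<lambda>t. (norm (cs z t))\<^sup>2 * (x 1 - t))"
  have x1: "0 < x 1" using x_less[of 0] by (simp add: x0)
  have ccs: "continuous_on S (cs z)" for S
    by (rule continuous_on_vector_derivative[OF cs_deriv[OF z_neq_0]])
  have cint: "continuous_on {0..x 1} (\<lambda>t. (norm (cs z t))\<^sup>2 * (x 1 - t))"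
    by (intro continuous_intros ccs)
  have "K \<noteq> 0"
  proof
    assume "K = 0"
    hence "((\<lambda>t. (norm (cs z t))\<^sup>2 * (x 1 - t)) has_integral 0) (cbox 0 (x 1))"
      using integrable_integral[OF integrable_continuous_interval[OF cint]] by (simp add: K_def)
    from has_integral_0_cbox_imp_0[OF _ _ this, of 0] cint x1 show False
      by (auto simp: box_real)
  qed
  define \<psi> where "\<psi> t = cs z t * of_real (max 0 (x 1 - t)) / of_real K" for t
  have zero: "\<psi> t = 0" if "t \<ge> x 1" for t using that by (simp add: \<psi>_def)
  show ?thesis
  proof (intro exI[of _ \<psi>] conjI allI impI zero)
    show "continuous_on UNIV \<psi>"
      unfolding \<psi>_def[abs_def] using \<open>K \<noteq> 0\<close> by (intro continuous_intros ccs) auto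
    fix N i j
    have eq: "indicator {0<..<x (Suc N)} t *\<^sub>R cdot (\<psi> t *s axis i 1) (sol (axis j 1) t)
      = indicator {0<..<x 1} t *\<^sub>R ((if i = j then 1 / of_real K else 0) * of_real ((norm (cs z t))\<^sup>2 * (x 1 - t)))" for t
    proof (cases "t \<in> {0<..<x 1}")
      case True
      have "t < x (Suc N)" using True x_le[of 1 "Suc N"] by simp
      have "cdot (\<psi> t *s axis i 1) (sol (axis j 1) t) = \<psi> t * cnj (cs z t) * (if i = j then 1 else 0)"
        unfolding cdot_axis_left using sol_first[of t "axis j 1"] True by (simp add: axis_def)
      also have "\<psi> t * cnj (cs z t) = 1 / of_real K * of_real ((norm (cs z t))\<^sup>2 * (x 1 - t))"
        using True complex_norm_square[of "cs z t"] by (simp add: \<psi>_def)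
      finally show ?thesis using True \<open>t < x (Suc N)\<close> by simp
    next
      case False
      hence "t \<le> 0 \<or> t \<ge> x 1" by auto
      thus ?thesis using False zero[of t] by (auto simp: cdot_axis_left)
    qed
    have i: "set_integrable lborel {0..x 1} (\<lambda>t. (norm (cs z t))\<^sup>2 * (x 1 - t))"
      by (rule borel_integrable_atLeastAtMost'[OF cint])
    have i': "set_integrable lborel {0<..<x 1} (\<lambda>t. (norm (cs z t))\<^sup>2 * (x 1 - t))"
      by (rule set_integrable_subset[OF i]) auto
    have "(LINT t:{0<..<x 1}|lborel. (norm (cs z t))\<^sup>2 * (x 1 - t)) = integral (box 0 (x 1)) (\<lambda>t. (norm (cs z t))\<^sup>2 * (x 1 - t))"
      using set_borel_integral_eq_integral(2)[OF i'] by (simp add: box_real)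
    also have "\<dots> = K" unfolding integral_open_interval by (simp add: K_def)
    finally have K: "(LINT t:{0<..<x 1}|lborel. (norm (cs z t))\<^sup>2 * (x 1 - t)) = K" .
    have "(LINT t:{0<..<x (Suc N)}|lborel. cdot (\<psi> t *s axis i 1) (sol (axis j 1) t)) =
      (if i = j then 1 / of_real K else 0) * (LINT t:{0<..<x 1}|lborel. complex_of_real ((norm (cs z t))\<^sup>2 * (x 1 - t)))"
      unfolding set_lebesgue_integral_def eq mult_scaleR_right[symmetric] by (rule integral_mult_right_zero)
    also have "(LINT t:{0<..<x 1}|lborel. complex_of_real ((norm (cs z t))\<^sup>2 * (x 1 - t))) = of_real K"
      unfolding K[symmetric] by (rule set_integral_complex_of_real)
    finally show "(LINT t:{0<..<x (Suc N)}|lborel. cdot (\<psi> t *s axis i 1) (sol (axis j 1) t)) = (if i = j then 1 else 0)"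
      using \<open>K \<noteq> 0\<close> by simp
  qed
qed

text \<open>The weak equation makes \<open>g\<close> orthogonal to every continuous \<open>h\<close>
  that is orthogonal to all solutions. Correcting an arbitrary \<open>h\<close> by multiples of the
  dual test functions reaches this situation and shows that \<open>g\<close> acts on
  \<open>h\<close> as a fixed combination of solutions does.\<close>

lemma weak_solution_is_sol:
  assumes g: "square_integrable {0<..} g"
    and weak: "\<And>f f1 f2. H_domain x \<Lambda> f f1 f2 \<Longrightarrow> square_integrable {0<..} f \<Longrightarrow> square_integrable {0<..} f2 \<Longrightarrow>
      (LINT t:{0<..}|lborel. cdot (f2 t) (g t) + cnj z * cdot (f t) (g t)) = 0"
  shows "\<exists>c. AE t in lborel. t \<in> {0<..} \<longrightarrow> g t = sol c t"
proof -
  obtain \<psi> where *: "continuous_on UNIV \<psi> \<and> (\<forall>t\<ge>x 1. \<psi> t = 0) \<and>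
    (\<forall>N i j. (LINT t:{0<..<x (Suc N)}|lborel. cdot (\<psi> t *s axis i 1) (sol (axis j 1) t)) = (if i = j then 1 else 0))"
    using dual_test_function ..
  note \<psi> = *[THEN conjunct1] and \<psi>_zero = *[THEN conjunct2, THEN conjunct1, rule_format]
    and dual = *[THEN conjunct2, THEN conjunct2, rule_format]
  have g_bounded: "square_integrable {0<..<x (Suc N)} g" for N
    by (rule square_integrable_subset[OF g]) auto
  have sq_cont: "square_integrable {0<..<x (Suc N)} h" if "continuous_on UNIV h" for h :: "real \<Rightarrow> complex ^ 'n" and N
    by (rule square_integrable_continuous[of 0 "x (Suc N)"]) (auto intro: continuous_on_subset[OF that])
  have orth: "(LINT t:{0<..<x (Suc N)}|lborel. cdot (h t) (g t)) = 0"
    if h: "continuous_on UNIV h" and o: "\<And>i. (LINT t:{0<..<x (Suc N)}|lborel. cdot (h t) (sol (axis i 1) t)) = 0" for h N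
  proof -
    obtain f f1 f2 where f: "H_domain x \<Lambda> f f1 f2" "square_integrable {0<..} f" "square_integrable {0<..} f2"
      and sum: "\<forall>t>0. f2 t + cnj z *s f t = (if t < x (Suc N) then - h t else 0)"
      using orthogonal_test_function[OF h o] by blast
    have eq: "indicator {0<..} t *\<^sub>R (cdot (f2 t) (g t) + cnj z * cdot (f t) (g t)) =
        - (indicator {0<..<x (Suc N)} t *\<^sub>R cdot (h t) (g t))" for t
    proof (cases "0 < t")
      case True
      have "cdot (f2 t) (g t) + cnj z * cdot (f t) (g t) = cdot (f2 t + cnj z *s f t) (g t)"
        by (simp add: cdot_add_left cdot_scale_left)
      also have "f2 t + cnj z *s f t = (if t < x (Suc N) then - h t else 0)" using sum True by blast
      finally show ?thesis using True by (simp add: cdot_def sum_negf)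
    qed simp
    show ?thesis using weak[OF f] unfolding set_lebesgue_integral_def eq by simp
  qed
  \<comment> \<open>The dual functions vanish beyond \<open>x 1\<close>, so these numbers, and with
    them the initial value \<open>c\<close>, do not depend on \<open>N\<close>.\<close>
  define \<gamma> where "\<gamma> i = (LINT t:{0<..<x 1}|lborel. cdot (\<psi> t *s axis i 1) (g t))" for i
  have \<gamma>: "(LINT t:{0<..<x (Suc N)}|lborel. cdot (\<psi> t *s axis i 1) (g t)) = \<gamma> i" for i N
  proof -
    have "indicator {0<..<x (Suc N)} t *\<^sub>R cdot (\<psi> t *s axis i 1) (g t) = indicator {0<..<x 1} t *\<^sub>R cdot (\<psi> t *s axis i 1) (g t)" for t
      using x_le[of 1 "Suc N"] \<psi>_zero[of t] by (cases "t < x 1") (auto simp: cdot_def indicator_def)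
    thus ?thesis unfolding \<gamma>_def set_lebesgue_integral_def by (simp only:)
  qed
  \<comment> \<open>Conjugated because \<open>cdot\<close> is conjugate linear in its second
    argument.\<close>
  define c where "c = (\<chi> i. cnj (\<gamma> i))"
  have c\<psi>: "continuous_on UNIV (\<lambda>t. a *s (\<psi> t *s axis i 1 :: complex ^ 'n))" for a i
    by (intro continuous_on_scale_vec bounded_linear.continuous_on[OF bounded_linear_scale_left] \<psi>)
  have main: "(LINT t:{0<..<x (Suc N)}|lborel. cdot (h t) (g t - sol c t)) = 0" if h: "continuous_on UNIV h" for h N
  proof -
    let ?J = "{0<..<x (Suc N)}"
    define a where "a i = (LINT t:?J|lborel. cdot (h t) (sol (axis i 1) t))" for i
    \<comment> \<open>Subtracting the pairings \<open>a i\<close> by means of the dual functions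
      makes \<open>h'\<close> orthogonal to all solutions on \<open>?J\<close>.\<close>
    define h' where "h' t = h t - (\<Sum>i\<in>UNIV. a i *s (\<psi> t *s axis i 1))" for t
    have ch': "continuous_on UNIV h'"
      unfolding h'_def[abs_def] by (intro continuous_on_diff continuous_on_sum h c\<psi>)
    have split: "(LINT t:?J|lborel. cdot (h' t) (q t)) =
        (LINT t:?J|lborel. cdot (h t) (q t)) - (\<Sum>i\<in>UNIV. a i * (LINT t:?J|lborel. cdot (\<psi> t *s axis i 1) (q t)))"
      if q: "square_integrable ?J q" for q
    proof -
      have i1: "set_integrable lborel ?J (\<lambda>t. cdot (h t) (q t))"
        by (intro set_integrable_cdot sq_cont h q)
      have c1: "continuous_on UNIV (\<lambda>t. \<psi> t *s axis i 1 :: complex ^ 'n)" for i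
        using c\<psi>[of 1 i] by simp
      have i2: "set_integrable lborel ?J (\<lambda>t. a i * cdot (\<psi> t *s axis i 1) (q t))" for i
        by (intro set_integrable_mult_right set_integrable_cdot sq_cont c1 q)
      have i3: "set_integrable lborel ?J (\<lambda>t. \<Sum>i\<in>UNIV. a i * cdot (\<psi> t *s axis i 1) (q t))"
        using i2 unfolding set_integrable_def scaleR_sum_right by (intro Bochner_Integration.integrable_sum)
      have "(LINT t:?J|lborel. cdot (h' t) (q t)) =
          (LINT t:?J|lborel. cdot (h t) (q t) - (\<Sum>i\<in>UNIV. a i * cdot (\<psi> t *s axis i 1) (q t)))"
        by (simp only: h'_def cdot_diff_left cdot_sum_left cdot_scale_left)
      also have "\<dots> = (LINT t:?J|lborel. cdot (h t) (q t)) - (LINT t:?J|lborel. \<Sum>i\<in>UNIV. a i * cdot (\<psi> t *s axis i 1) (q t))"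
        by (rule set_integral_diff(2)[OF i1 i3])
      also have "(LINT t:?J|lborel. \<Sum>i\<in>UNIV. a i * cdot (\<psi> t *s axis i 1) (q t)) =
          (\<Sum>i\<in>UNIV. LINT t:?J|lborel. a i * cdot (\<psi> t *s axis i 1) (q t))"
        unfolding set_lebesgue_integral_def scaleR_sum_right
        by (rule Bochner_Integration.integral_sum) (use i2 in \<open>simp add: set_integrable_def\<close>)
      also have "\<dots> = (\<Sum>i\<in>UNIV. a i * (LINT t:?J|lborel. cdot (\<psi> t *s axis i 1) (q t)))"
        by (simp only: set_integral_mult_right)
      finally show ?thesis .
    qed
    have "(LINT t:?J|lborel. cdot (h' t) (sol (axis j 1) t)) = 0" for j
      unfolding split[OF sol_square_integrable_bounded] dual
      by (simp add: a_def if_distrib[of "\<lambda>y. _ * y"] cong: if_cong)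
    from orth[OF ch' this] have "(LINT t:?J|lborel. cdot (h t) (g t)) = (\<Sum>i\<in>UNIV. a i * \<gamma> i)"
      unfolding split[OF g_bounded] \<gamma> by simp
    also have "\<dots> = (\<Sum>i\<in>UNIV. LINT t:?J|lborel. \<gamma> i * cdot (h t) (sol (axis i 1) t))"
      by (simp only: a_def set_integral_mult_right mult.commute)
    also have "\<dots> = (LINT t:?J|lborel. \<Sum>i\<in>UNIV. \<gamma> i * cdot (h t) (sol (axis i 1) t))"
    proof -
      have "set_integrable lborel ?J (\<lambda>t. \<gamma> i * cdot (h t) (sol (axis i 1) t))" for i
        by (intro set_integrable_mult_right set_integrable_cdot sq_cont h sol_square_integrable_bounded)
      thus ?thesis
        unfolding set_lebesgue_integral_def scaleR_sum_right set_integrable_def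
        by (intro Bochner_Integration.integral_sum[symmetric])
    qed
    also have "\<dots> = (LINT t:?J|lborel. cdot (h t) (sol c t))"
      by (subst (2) sol_expand) (simp add: cdot_sum_right cdot_scale_right c_def)
    finally have eq: "(LINT t:?J|lborel. cdot (h t) (g t)) = (LINT t:?J|lborel. cdot (h t) (sol c t))" .
    have diff: "cdot u (v - w) = cdot u v - cdot u w" for u v w :: "complex ^ 'n"
      by (simp add: cdot_def sum_subtractf algebra_simps)
    have "set_integrable lborel ?J (\<lambda>t. cdot (h t) (g t))" "set_integrable lborel ?J (\<lambda>t. cdot (h t) (sol c t))"
      by (intro set_integrable_cdot sq_cont h g_bounded sol_square_integrable_bounded)+
    from set_integral_diff(2)[OF this] eq show ?thesis unfolding diff by simp
  qed
  have "AE t in lborel. t \<in> {0<..<x (Suc N)} \<longrightarrow> g t - sol c t = 0" for N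
    by (rule AE_zero_if_orthogonal_to_continuous[OF square_integrable_diff[OF g_bounded sol_square_integrable_bounded] main])
  hence "AE t in lborel. \<forall>N. t \<in> {0<..<x (Suc N)} \<longrightarrow> g t - sol c t = 0"
    unfolding AE_all_countable by blast
  hence "AE t in lborel. t \<in> {0<..} \<longrightarrow> g t = sol c t"
  proof eventually_elim
    case (elim t)
    show ?case
    proof
      assume "t \<in> {0<..}"
      obtain N where "N \<ge> 1" "t < x N" using x_exceeds[of 1 t] by blast
      hence "t \<in> {0<..<x (Suc (N - 1))}" using \<open>t \<in> {0<..}\<close> by simp
      thus "g t = sol c t" using elim by (metis eq_iff_diff_eq_0)
    qed
  qed
  thus ?thesis by blast
qed

end

subsection \<open>Deficiency spaces\<close>

lemma L2_class_eq_iff: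
  assumes "square_integrable {0<..} f" "square_integrable {0<..} g"
  shows "L2_class f = L2_class g \<longleftrightarrow> (AE t in lborel. t \<in> {0<..} \<longrightarrow> f t = g t)"
  using Quotient3_rel[OF Quotient3_L2, of f g] assms by (auto simp: L2_eq_def)

lemma L2_class_cases:
  obtains g where "square_integrable {0<..} g" "G = L2_class g"
proof
  have "L2_eq (L2_rep G) (L2_rep G)" by (rule Quotient3_rep_reflp[OF Quotient3_L2])
  thus "square_integrable {0<..} (L2_rep G)" by (simp add: L2_eq_def)
  show "G = L2_class (L2_rep G)" by (rule Quotient3_abs_rep[OF Quotient3_L2, symmetric])
qed

lemma L2_eq_refl: "square_integrable {0<..} f \<Longrightarrow> L2_eq f f"
  by (simp add: L2_eq_def)

lemma cinner_L2_scale_right: "cinner_L2 F (cscale_L2 a G) = cnj a * cinner_L2 F G"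
  by transfer (simp add: cdot_scale_right set_lebesgue_integral_def mult_scaleR_right[symmetric] del: mult_scaleR_right)

text \<open>Expresses the complex inner product by the real one, whose continuity gives the closed
  condition needed in \<open>adjoint_graph_closure\<close>.\<close>

lemma cinner_L2_eq: "cinner_L2 F G = Complex (inner F G) (inner F (cscale_L2 \<i> G))"
  by (rule complex_eqI) (simp_all add: inner_L2_def cinner_L2_scale_right)

lemma adjoint_graph_closure: "adjoint_graph (closure T) = adjoint_graph T"
proof
  show "adjoint_graph (closure T) \<subseteq> adjoint_graph T"
    using closure_subset[of T] by (auto simp: adjoint_graph_def)
  show "adjoint_graph T \<subseteq> adjoint_graph (closure T)"
  proof (clarsimp simp: adjoint_graph_def)
    fix G H F TF
    assume adj: "\<forall>(F, TF)\<in>T. cinner_L2 TF G = cinner_L2 F H" and cl: "(F, TF) \<in> closure T"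
    have "closed {p. cinner_L2 (snd p) G = cinner_L2 (fst p) H}"
      unfolding cinner_L2_eq complex.inject Collect_conj_eq
      by (intro closed_Int closed_Collect_eq continuous_intros)
    hence "closure T \<subseteq> {p. cinner_L2 (snd p) G = cinner_L2 (fst p) H}"
      by (intro closure_minimal) (use adj in auto)
    thus "cinner_L2 TF G = cinner_L2 F H" using cl by auto
  qed
qed

text \<open>\<open>f\<close> need not be linear outside \<open>D\<close>; in the application it is
  the class of a solution, meaningful only for square integrable ones. Its values on a basis of
  \<open>D\<close> are extended to a linear \<open>g\<close> that agrees with \<open>f\<close> on
  \<open>D\<close>.\<close>

lemma cdimension_linear_image:
  fixes f :: "complex ^ 'n \<Rightarrow> 'm::finite L2"
  assumes D: "vec.subspace D"
    and add: "\<And>c c'. c \<in> D \<Longrightarrow> c' \<in> D \<Longrightarrow> f (c + c') = f c + f c'"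
    and scale: "\<And>a c. c \<in> D \<Longrightarrow> f (a *s c) = cscale_L2 a (f c)"
    and inj: "\<And>c. c \<in> D \<Longrightarrow> f c = 0 \<Longrightarrow> c = 0"
  shows "cdimension (f ` D) = enat (vec.dim D)"
proof -
  interpret p: vector_space_pair "(*s) :: complex \<Rightarrow> complex ^ 'n \<Rightarrow> _" "cscale_L2 :: complex \<Rightarrow> 'm L2 \<Rightarrow> _" ..
  obtain B where B: "B \<subseteq> D" "vec.independent B" "D \<subseteq> vec.span B" "card B = vec.dim D"
    by (rule vec.basis_exists)
  have span: "vec.span B = D"
    using B(1,3) vec.span_minimal[OF B(1) D] by blast
  have "finite B" using B(2) by (rule vec.finiteI_independent)
  obtain g where g: "Vector_Spaces.linear (*s) cscale_L2 g" "\<forall>b\<in>B. g b = f b"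
    using p.linear_independent_extend[OF B(2), of f] by blast
  have "vec.subspace {c \<in> D. g c = f c}"
    unfolding vec.subspace_def
  proof (safe)
    have "f 0 = 0" using scale[OF vec.subspace_0[OF D], of 0] by simp
    thus "g 0 = f 0" by (simp add: p.linear_0[OF g(1)])
  qed (use D add scale in \<open>auto simp: vec.subspace_def p.linear_add[OF g(1)] p.linear_scale[OF g(1)]\<close>)
  hence "vec.span B \<subseteq> {c \<in> D. g c = f c}"
    using B(1) g(2) by (intro vec.span_minimal) auto
  hence gf: "g c = f c" if "c \<in> D" for c using that span by blast
  have inj_g: "inj_on g (vec.span B)"
  proof (rule inj_onI)
    fix c c' assume c: "c \<in> vec.span B" "c' \<in> vec.span B" "g c = g c'"
    have "c - c' \<in> D" using c span vec.subspace_diff[OF D] by simp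
    moreover have "g (c - c') = 0" using c(3) by (simp add: p.linear_diff[OF g(1)])
    ultimately have "c - c' = 0" using inj gf by metis
    thus "c = c'" by simp
  qed
  have "f ` D = g ` vec.span B" using gf span by force
  also have "\<dots> = cspan_L2 (g ` B)"
    unfolding cspan_L2_def by (rule p.linear_span_image[OF g(1), symmetric])
  finally have img: "f ` D = cspan_L2 (g ` B)" .
  have "complex_L2.independent (g ` B)"
    using p.linear_independent_injective_image[OF g(1) B(2) inj_g] .
  hence "cdim_L2 (cspan_L2 (g ` B)) = card (g ` B)"
    by (simp add: complex_L2.dim_eq_card_independent complex_L2.dim_span)
  also have "card (g ` B) = card B"
    using inj_g vec.span_superset by (intro card_image) (rule inj_on_subset)
  finally have "cdim_L2 (f ` D) = vec.dim D" using img B(4) by simp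
  moreover have "\<exists>B'. finite B' \<and> cspan_L2 B' = cspan_L2 (f ` D)"
    using \<open>finite B\<close> by (intro exI[of _ "g ` B"]) (simp add: img complex_L2.span_span)
  ultimately show ?thesis by (simp add: cdimension_def)
qed

context grid
begin

text \<open>Membership in the adjoint is the weak equation tested on the domain, where
  \<open>z\<close> turns into \<open>cnj z\<close> on moving out of the second argument. Weak
  solutions are classical, which gives one inclusion; Green's formula on the half-line gives the
  other.\<close>

lemma deficiency_space_eq:
  "{G. (G, cscale_L2 z G) \<in> adjoint_graph (H_operator x \<Lambda>)} = (\<lambda>c. L2_class (sol c)) ` {c. summable (m c)}"
proof -
  have key: "cinner_L2 (L2_class (\<lambda>t. - f2 t)) (L2_class g) = cinner_L2 (L2_class f) (cscale_L2 z (L2_class g)) \<longleftrightarrow>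
      (LINT t:{0<..}|lborel. cdot (f2 t) (g t) + cnj z * cdot (f t) (g t)) = 0"
    if f: "square_integrable {0<..} f" "square_integrable {0<..} f2" and g: "square_integrable {0<..} g" for f f2 g
  proof -
    have "cinner_L2 (L2_class (\<lambda>t. - f2 t)) (L2_class g) = (LINT t:{0<..}|lborel. cdot (- f2 t) (g t))"
      by (rule cinner_L2.abs_eq) (intro L2_eq_refl square_integrable_uminus f g)+
    also have "\<dots> = - (LINT t:{0<..}|lborel. cdot (f2 t) (g t))"
      by (simp add: cdot_def sum_negf set_lebesgue_integral_def)
    finally have 1: "cinner_L2 (L2_class (\<lambda>t. - f2 t)) (L2_class g) = - (LINT t:{0<..}|lborel. cdot (f2 t) (g t))" .
    have 2: "cinner_L2 (L2_class f) (L2_class g) = (LINT t:{0<..}|lborel. cdot (f t) (g t))"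
      by (rule cinner_L2.abs_eq) (intro L2_eq_refl f g)+
    have "(LINT t:{0<..}|lborel. cdot (f2 t) (g t) + cnj z * cdot (f t) (g t)) =
        (LINT t:{0<..}|lborel. cdot (f2 t) (g t)) + (LINT t:{0<..}|lborel. cnj z * cdot (f t) (g t))"
      by (intro set_integral_add(2) set_integrable_mult_right set_integrable_cdot f g)
    also have "\<dots> = (LINT t:{0<..}|lborel. cdot (f2 t) (g t)) + cnj z * (LINT t:{0<..}|lborel. cdot (f t) (g t))"
      by (simp only: set_integral_mult_right)
    finally show ?thesis unfolding cinner_L2_scale_right 1 2 by (simp add: neg_eq_iff_add_eq_0)
  qed
  have adj: "adjoint_graph (H_operator x \<Lambda>) = adjoint_graph (H_minimal x \<Lambda>)"
    unfolding H_operator_def by (rule adjoint_graph_closure)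
  show ?thesis
    unfolding adj
  proof (intro equalityI subsetI)
    fix G assume "G \<in> {G. (G, cscale_L2 z G) \<in> adjoint_graph (H_minimal x \<Lambda>)}"
    hence G: "cinner_L2 TF G = cinner_L2 F (cscale_L2 z G)" if "(F, TF) \<in> H_minimal x \<Lambda>" for F TF
      using that by (auto simp: adjoint_graph_def)
    obtain g where g: "square_integrable {0<..} g" "G = L2_class g" by (rule L2_class_cases)
    have "\<exists>c. AE t in lborel. t \<in> {0<..} \<longrightarrow> g t = sol c t"
    proof (rule weak_solution_is_sol[OF g(1)])
      fix f f1 f2
      assume f: "H_domain x \<Lambda> f f1 f2" "square_integrable {0<..} f" "square_integrable {0<..} f2"
      hence "(L2_class f, L2_class (\<lambda>t. - f2 t)) \<in> H_minimal x \<Lambda>" by (auto simp: H_minimal_def)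
      from G[OF this] show "(LINT t:{0<..}|lborel. cdot (f2 t) (g t) + cnj z * cdot (f t) (g t)) = 0"
        unfolding g(2) key[OF f(2,3) g(1)] .
    qed
    then obtain c where c: "AE t in lborel. t \<in> {0<..} \<longrightarrow> g t = sol c t" by blast
    have "square_integrable {0<..} (sol c)"
      unfolding square_integrable_def
    proof
      have [measurable]: "sol c \<in> borel_measurable borel" by (rule measurable_sol)
      show "set_borel_measurable lborel {0<..} (sol c)"
        unfolding set_borel_measurable_def by measurable
      have i: "integrable lborel (\<lambda>t. indicator {0<..} t *\<^sub>R (norm (g t))\<^sup>2)"
        using g(1) by (simp add: square_integrable_def set_integrable_def)
      have "(\<lambda>t. indicator {0<..} t *\<^sub>R (norm (sol c t))\<^sup>2) \<in> borel_measurable lborel" by measurable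
      moreover have "AE t in lborel. indicator {0<..} t *\<^sub>R (norm (g t))\<^sup>2 = indicator {0<..} t *\<^sub>R (norm (sol c t))\<^sup>2"
        using c by eventually_elim (auto simp: indicator_def)
      ultimately show "set_integrable lborel {0<..} (\<lambda>t. (norm (sol c t))\<^sup>2)"
        unfolding set_integrable_def
        using integrable_cong_AE[OF borel_measurable_integrable[OF i]] i by blast
    qed
    hence "summable (m c)" "G = L2_class (sol c)"
      using sol_square_integrable_iff L2_class_eq_iff[OF g(1)] c g(2) by auto
    thus "G \<in> (\<lambda>c. L2_class (sol c)) ` {c. summable (m c)}" by blast
  next
    fix G assume "G \<in> (\<lambda>c. L2_class (sol c)) ` {c. summable (m c)}"
    then obtain c where G: "G = L2_class (sol c)" and "summable (m c)" by blast
    hence c: "square_integrable {0<..} (sol c)" by (simp add: sol_square_integrable_iff)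
    have "cinner_L2 TF G = cinner_L2 F (cscale_L2 z G)" if "(F, TF) \<in> H_minimal x \<Lambda>" for F TF
      using that key[OF _ _ c] green_domain[OF _ _ _ c] unfolding H_minimal_def G by auto
    thus "G \<in> {G. (G, cscale_L2 z G) \<in> adjoint_graph (H_minimal x \<Lambda>)}"
      by (auto simp: adjoint_graph_def)
  qed
qed

lemma m_0_zero_imp: "m c 0 = 0 \<Longrightarrow> c = 0"
  using solution_value_bounds(1)[OF x_less[of 0] norm_z piece_solves, of c 0] x_less[of 0]
  by (simp add: m_def piece_left mult_le_0_iff)

lemma cdimension_deficiency_space:
  assumes D: "vec.subspace {c. summable (m c)}"
  shows "cdimension {G. (G, cscale_L2 z G) \<in> adjoint_graph (H_operator x \<Lambda>)} = enat (vec.dim {c. summable (m c)})"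
  unfolding deficiency_space_eq
proof (rule cdimension_linear_image[OF D])
  have refl: "L2_eq (sol c) (sol c)" if "c \<in> {c. summable (m c)}" for c
    using that by (intro L2_eq_refl) (simp add: sol_square_integrable_iff)
  show "L2_class (sol (c + c')) = L2_class (sol c) + L2_class (sol c')"
    if "c \<in> {c. summable (m c)}" "c' \<in> {c. summable (m c)}" for c c'
  proof -
    have "sol (c + c') = (\<lambda>t. sol c t + sol c' t)" by (rule ext) (rule sol_linear)
    thus ?thesis using plus_L2.abs_eq[OF refl[OF that(1)] refl[OF that(2)]] by simp
  qed
  show "L2_class (sol (a *s c)) = cscale_L2 a (L2_class (sol c))" if "c \<in> {c. summable (m c)}" for a c
  proof -
    have "sol (a *s c) = (\<lambda>t. a *s sol c t)" by (rule ext) (rule sol_linear)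
    thus ?thesis using cscale_L2.abs_eq[OF refl[OF that], of a] by simp
  qed
  fix c assume c: "c \<in> {c. summable (m c)}" "L2_class (sol c) = 0"
  hence "L2_class (sol c) = L2_class (\<lambda>_. 0)" by (simp add: zero_L2_def)
  hence "AE t in lborel. t \<in> {0<..} \<longrightarrow> sol c t = 0"
    using c(1) by (subst (asm) L2_class_eq_iff) (simp_all add: sol_square_integrable_iff)
  moreover have "AE t in lborel. t \<noteq> (0::real)" by (rule AE_lborel_singleton)
  ultimately have "AE t in lborel. indicator {0..<x 1} t *\<^sub>R (norm (sol c t))\<^sup>2 = 0"
    by eventually_elim (auto simp: indicator_def)
  hence "(LINT t:{0..<x 1}|lborel. (norm (sol c t))\<^sup>2) = 0"
    unfolding set_lebesgue_integral_def by (rule integral_eq_zero_AE)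
  thus "c = 0" using sol_integral(2)[of 1 c] m_0_zero_imp by simp
qed

end

section \<open>From the hypotheses to the discretised system\<close>

lemma summable_on_atLeast_1_iff:
  fixes f :: "nat \<Rightarrow> real"
  assumes "\<And>k. k \<ge> 1 \<Longrightarrow> 0 \<le> f k"
  shows "f summable_on {1..} \<longleftrightarrow> summable (\<lambda>k. f (Suc k))"
proof -
  have "{1..} = range Suc"
    by (auto simp: image_iff) (metis Suc_le_D)
  hence "f summable_on {1..} \<longleftrightarrow> (f \<circ> Suc) summable_on UNIV"
    by (simp add: summable_on_reindex)
  also have "\<dots> \<longleftrightarrow> summable (f \<circ> Suc)"
    using assms by (intro summable_on_UNIV_nonneg_real_iff) simp
  finally show ?thesis by (simp add: o_def)
qed

text \<open>The asymptotic bound holds from some \<open>N\<close> on; adding the finitely many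
  earlier quotients to the constant extends it to all \<open>k \<ge> 1\<close>.\<close>

lemma bigo_bound_everywhere:
  fixes f d :: "nat \<Rightarrow> real"
  assumes "f \<in> O(d)" and d: "\<And>k. k \<ge> 1 \<Longrightarrow> 0 < d k"
  shows "\<exists>C\<ge>0. \<forall>k\<ge>1. f k \<le> C * d k"
proof -
  obtain C0 where "C0 > 0" "\<forall>\<^sub>F k in sequentially. norm (f k) \<le> C0 * norm (d k)"
    using assms(1) by (auto elim!: landau_o.bigE)
  then obtain N where N: "\<And>k. k \<ge> N \<Longrightarrow> norm (f k) \<le> C0 * norm (d k)"
    by (auto simp: eventually_sequentially)
  define C where "C = C0 + (\<Sum>k\<in>{1..N}. \<bar>f k\<bar> / d k)"
  have nonneg: "0 \<le> \<bar>f k\<bar> / d k" if "k \<in> {1..N}" for k using d[of k] that by simp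
  have "f k \<le> C * d k" if k: "k \<ge> 1" for k
  proof (cases "k \<le> N")
    case True
    have "\<bar>f k\<bar> / d k \<le> (\<Sum>k\<in>{1..N}. \<bar>f k\<bar> / d k)"
      using True k nonneg by (intro member_le_sum) auto
    hence "\<bar>f k\<bar> / d k \<le> C" using \<open>C0 > 0\<close> by (simp add: C_def)
    thus ?thesis using d[OF k] by (simp add: divide_le_eq)
  next
    case False
    have "C0 * d k \<le> C * d k"
      using d[OF k] sum_nonneg[of "{1..N}" "\<lambda>k. \<bar>f k\<bar> / d k"] nonneg by (intro mult_right_mono) (auto simp: C_def)
    moreover have "f k \<le> C0 * d k" using N[of k] False d[OF k] by simp
    ultimately show ?thesis by linarith
  qed
  moreover have "0 \<le> C" unfolding C_def
    by (rule add_nonneg_nonneg[OF less_imp_le[OF \<open>C0 > 0\<close>] sum_nonneg[OF nonneg]])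
  ultimately show ?thesis by blast
qed

text \<open>The conditions on \<open>z\<close> describe exactly the two points \<open>\<i>\<close>
  and \<open>- \<i>\<close>, so both deficiency indices are obtained at once.\<close>

lemma deficiency_dimension:
  fixes x d :: "nat \<Rightarrow> real" and z :: complex
    and \<Lambda> :: "nat \<Rightarrow> complex ^ ('p1::finite + 'p2::finite) ^ ('p1 + 'p2)"
    and \<Lambda>t :: "nat \<Rightarrow> complex ^ 'p2 ^ 'p2"
    and \<alpha> :: "nat \<Rightarrow> 'p2 \<Rightarrow> real"
  assumes z: "norm z = 1" "\<bar>Im z\<bar> = 1"
    and x: "strict_mono x" "x 0 = 0" "filterlim x at_top sequentially"
    and d: "\<And>k. k \<ge> 1 \<Longrightarrow> d k = x k - x (k - 1)"
    and herm: "\<And>k. k \<ge> 1 \<Longrightarrow> hermitian (\<Lambda> k)"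
    and sq: "(\<lambda>k. (d k)\<^sup>2) summable_on {1..}"
    and decr: "\<And>k. k \<ge> 1 \<Longrightarrow> d (k + 1) \<le> d k"
    and logc: "\<And>k. k \<ge> 1 \<Longrightarrow> d k * d (k + 2) \<ge> (d (k + 1))\<^sup>2"
    and b11: "(\<lambda>k. d (k + 1) *
           opnorm (block11 (\<Lambda> k) + mat (complex_of_real (1 / d k + 1 / d (k + 1))))) summable_on {1..}"
    and b12: "(\<lambda>k. opnorm (block12 (\<Lambda> k))) \<in> O(d)"
    and b22: "\<And>k. k \<ge> 1 \<Longrightarrow> block22 (\<Lambda> k) = diag_real (\<alpha> k) + \<Lambda>t k"
    and \<Lambda>t: "(\<lambda>k. opnorm (\<Lambda>t k)) \<in> O(d)"
    and \<alpha>: "(\<forall>j. \<not> (\<lambda>k. \<bar>\<alpha> k j\<bar> * d k ^ 3) summable_on {1..}) \<or>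
         (\<exists>M>0. \<forall>k\<ge>1. \<forall>j. 4 / (d (k + 1))\<^sup>2 + \<alpha> k j / d (k + 1) \<le> M)"
  shows "cdimension {G. (G, cscale_L2 z G) \<in> adjoint_graph (H_operator x \<Lambda>)} = enat CARD('p1)"
proof -
  \<comment> \<open>Intervals are numbered from 0: \<open>\<delta> k = d (k+1)\<close>, and the
    interaction at the right end of that interval is \<open>\<Lambda> (k+1)\<close>.\<close>
  define \<delta> where "\<delta> k = x (Suc k) - x k" for k
  have d\<delta>: "d (Suc k) = \<delta> k" for k using d[of "Suc k"] by (simp add: \<delta>_def)
  have \<delta>pos: "0 < \<delta> k" for k using x(1) by (simp add: \<delta>_def strict_mono_def)
  have dpos: "0 < d k" if "k \<ge> 1" for k using \<delta>pos[of "k - 1"] d\<delta>[of "k - 1"] that by simp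
  have \<delta>decr: "\<delta> (Suc k) \<le> \<delta> k" for k using decr[of "Suc k"] by (simp add: d\<delta>)
  have \<delta>log: "(\<delta> (k+1))\<^sup>2 \<le> \<delta> k * \<delta> (k+2)" for k using logc[of "Suc k"] by (simp add: d\<delta>)
  have \<delta>le: "\<delta> k \<le> \<delta> 0" for k by (induction k) (auto intro: order_trans[OF \<delta>decr])
  \<comment> \<open>By log-convexity the ratio of consecutive lengths is non-decreasing, so the
    first ratio is a lower bound for all of them.\<close>
  define \<rho> where "\<rho> = \<delta> 1 / \<delta> 0"
  have "0 < \<rho>" using \<delta>pos by (simp add: \<rho>_def)
  have ratio: "\<rho> * \<delta> k \<le> \<delta> (Suc k)" for k
  proof (induction k)
    case 0
    show ?case using \<delta>pos[of 0] by (simp add: \<rho>_def)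
  next
    case (Suc k)
    have "\<delta> k * (\<rho> * \<delta> (Suc k)) = (\<rho> * \<delta> k) * \<delta> (Suc k)" by simp
    also have "\<dots> \<le> \<delta> (Suc k) * \<delta> (Suc k)" using Suc.IH \<delta>pos[of "Suc k"] by (intro mult_right_mono) auto
    also have "\<dots> \<le> \<delta> k * \<delta> (Suc (Suc k))" using \<delta>log[of k] by (simp add: power2_eq_square)
    finally show ?case using \<delta>pos[of k] by simp
  qed
  have x_sum: "x n = (\<Sum>k<n. \<delta> k)" for n
    using sum_lessThan_telescope[of x n] x(2) by (simp add: \<delta>_def)
  \<comment> \<open>The lengths add up to \<open>x_n\<close>, which tends to infinity.\<close>
  have not_sum: "\<not> summable \<delta>"
  proof
    assume "summable \<delta>"
    hence "x \<longlonglongrightarrow> suminf \<delta>" using summable_LIMSEQ[of \<delta>] by (simp add: x_sum[abs_def])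
    thus False using x(3) not_tendsto_and_filterlim_at_infinity[of sequentially x "suminf \<delta>"]
        filterlim_at_top_imp_at_infinity by auto
  qed
  obtain C1 where C1: "0 \<le> C1" "\<And>k. k \<ge> 1 \<Longrightarrow> opnorm (block12 (\<Lambda> k)) \<le> C1 * d k"
    using bigo_bound_everywhere[OF b12 dpos] by blast
  obtain C2 where C2: "0 \<le> C2" "\<And>k. k \<ge> 1 \<Longrightarrow> opnorm (\<Lambda>t k) \<le> C2 * d k"
    using bigo_bound_everywhere[OF \<Lambda>t dpos] by blast
  interpret g: grid x \<Lambda> z
    by unfold_locales (use x z herm in auto)
  have "mesh \<delta> \<rho>"
  proof
    show "summable (\<lambda>k. (\<delta> k)\<^sup>2)"
      using sq by (subst (asm) summable_on_atLeast_1_iff) (simp_all add: d\<delta>)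
  qed (use \<delta>pos \<delta>decr \<open>0 < \<rho>\<close> ratio not_sum in auto)
  then interpret mesh \<delta> \<rho> .
  \<comment> \<open>The factor in the value bounds depends on the length of the interval; as the
    first interval is the longest, its factor serves for all.\<close>
  have value_le: "\<delta> k * (norm v)\<^sup>2 \<le> ((\<delta> 0)\<^sup>2 + 4)\<^sup>2 * g.m c k" if "\<delta> k * (norm v)\<^sup>2 \<le> ((\<delta> k)\<^sup>2 + 4)\<^sup>2 * g.m c k" for c v k
  proof -
    have "((\<delta> k)\<^sup>2 + 4)\<^sup>2 * g.m c k \<le> ((\<delta> 0)\<^sup>2 + 4)\<^sup>2 * g.m c k"
      using \<delta>le[of k] \<delta>pos[of k]
      by (intro mult_right_mono power_mono add_right_mono g.m_nonneg) auto
    with that show ?thesis by linarith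
  qed
  interpret s: solution_system \<delta> \<rho> z "\<lambda>k. \<Lambda> (Suc k)" g.U g.P g.m g.I "((\<delta> 0)\<^sup>2 + 4)\<^sup>2" "C1 + C2"
    "\<lambda>k. \<alpha> (Suc k)" "\<lambda>k. \<Lambda>t (Suc k)"
  proof
    show "(\<delta> (k+1))\<^sup>2 \<le> \<delta> k * \<delta> (k+2)" for k by (rule \<delta>log)
    show "\<bar>Im z\<bar> = 1" by (rule z)
    show "hermitian (\<Lambda> (Suc k))" for k by (rule herm) simp
    show "g.U (b1 + b2) k = g.U b1 k + g.U b2 k" "g.P (b1 + b2) k = g.P b1 k + g.P b2 k" for b1 b2 k
      using g.UP_linear by auto
    show "g.U (r *s b) k = r *s g.U b k" "g.P (r *s b) k = r *s g.P b k" for r b k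
      using g.UP_linear by auto
    show "g.U c 0 = c" "g.P c 0 = 0" for c by simp_all
    show "0 \<le> g.m c k" "g.m (c + c') k \<le> 2 * (g.m c k + g.m c' k)" "g.m (a *s c) k = (norm a)\<^sup>2 * g.m c k" for a c c' k
      by (rule g.m_nonneg g.m_add g.m_scale)+
    show "(norm (g.P c k - (1 / \<delta> k) *\<^sub>R (g.U c (k+1) - g.U c k)))\<^sup>2 \<le> \<delta> k * g.m c k"
      "(norm (g.P c (k+1) - \<Lambda> (Suc k) *v g.U c (k+1) - (1 / \<delta> k) *\<^sub>R (g.U c (k+1) - g.U c k)))\<^sup>2 \<le> \<delta> k * g.m c k" for c k
      using solution_slope_bounds[OF g.x_less[of k] z(1) g.piece_solves[of _ c k]]
      by (simp_all add: g.piece_left g.piece_right g.m_def \<delta>_def)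
    show "0 < ((\<delta> 0)\<^sup>2 + 4)\<^sup>2" by (intro zero_less_power add_nonneg_pos) auto
    show "\<delta> k * (norm (g.U c k))\<^sup>2 \<le> ((\<delta> 0)\<^sup>2 + 4)\<^sup>2 * g.m c k"
      "\<delta> k * (norm (g.U c (k+1)))\<^sup>2 \<le> ((\<delta> 0)\<^sup>2 + 4)\<^sup>2 * g.m c k" for c k
      using solution_value_bounds[OF g.x_less[of k] z(1) g.piece_solves[of _ c k]]
      by (intro value_le; simp add: g.piece_left g.piece_right g.m_def \<delta>_def)+
    show "(g.P c (k+1) - \<Lambda> (Suc k) *v g.U c (k+1)) $ j * cnj (g.U c' (k+1) $ j)
      - g.U c (k+1) $ j * cnj ((g.P c' (k+1) - \<Lambda> (Suc k) *v g.U c' (k+1)) $ j)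
      - (g.P c k $ j * cnj (g.U c' k $ j) - g.U c k $ j * cnj (g.P c' k $ j)) = (cnj z - z) * g.I c c' k j" for c c' k j
      using solution_green[OF g.x_less[of k] g.piece_solves[of _ c k] g.piece_solves[of _ c' k], of j]
      by (simp only: g.piece_left g.piece_right g.I_def Suc_eq_plus1[symmetric])
    show "norm (g.I c c' k j) \<le> g.m c k + g.m c' k" for c c' k j by (rule g.I_le)
    show "(\<Sum>j\<in>UNIV. g.I c c k j) = of_real (g.m c k)" for c k by (rule g.I_sum)
    show "0 \<le> C1 + C2" using C1 C2 by simp
    show "summable (\<lambda>k. \<delta> (k+1) * opnorm (block11 (\<Lambda> (Suc k)) + mat (complex_of_real (1 / \<delta> k + 1 / \<delta> (k+1)))))"
      using b11 by (subst (asm) summable_on_atLeast_1_iff) (auto simp: d\<delta> opnorm_nonneg less_imp_le[OF dpos])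
    show "opnorm (block12 (\<Lambda> (Suc k))) \<le> (C1 + C2) * \<delta> k" for k
      using C1(2)[of "Suc k"] mult_nonneg_nonneg[OF C2(1) less_imp_le[OF \<delta>pos[of k]]]
      unfolding d\<delta> distrib_right by linarith
    show "opnorm (\<Lambda>t (Suc k)) \<le> (C1 + C2) * \<delta> k" for k
      using C2(2)[of "Suc k"] mult_nonneg_nonneg[OF C1(1) less_imp_le[OF \<delta>pos[of k]]]
      unfolding d\<delta> distrib_right by linarith
    show "block22 (\<Lambda> (Suc k)) = diag_real (\<alpha> (Suc k)) + \<Lambda>t (Suc k)" for k by (rule b22) simp
    have "(\<lambda>k. \<bar>\<alpha> k j\<bar> * d k ^ 3) summable_on {1..} \<longleftrightarrow> summable (\<lambda>k. \<bar>\<alpha> (Suc k) j\<bar> * \<delta> k ^ 3)" for j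
      by (subst summable_on_atLeast_1_iff) (auto simp: d\<delta> less_imp_le[OF dpos])
    moreover have "\<forall>k j. 4 / (\<delta> (k + 1))\<^sup>2 + \<alpha> (Suc k) j / \<delta> (k + 1) \<le> M"
      if "\<forall>k\<ge>1. \<forall>j. 4 / (d (k + 1))\<^sup>2 + \<alpha> k j / d (k + 1) \<le> M" for M
      using that[rule_format, of "Suc _"] by (simp add: d\<delta>)
    ultimately show "(\<forall>j. \<not> summable (\<lambda>k. \<bar>\<alpha> (Suc k) j\<bar> * \<delta> k ^ 3)) \<or>
         (\<exists>M>0. \<forall>k j. 4 / (\<delta> (k + 1))\<^sup>2 + \<alpha> (Suc k) j / \<delta> (k + 1) \<le> M)"
      using \<alpha> by blast
  qed
  have "s.D = {c. summable (g.m c)}" by (simp add: s.D_def)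
  thus ?thesis
    using g.cdimension_deficiency_space s.subspace_D s.dim_D by simp
qed

theorem mainTheorem8:
  fixes x d :: "nat \<Rightarrow> real"
    and \<Lambda> :: "nat \<Rightarrow> complex ^ ('p1::finite + 'p2::finite) ^ ('p1 + 'p2)"
    and \<Lambda>t :: "nat \<Rightarrow> complex ^ 'p2 ^ 'p2"
    and \<alpha> :: "nat \<Rightarrow> 'p2 \<Rightarrow> real"
  assumes "strict_mono x" and "x 0 = 0" and "filterlim x at_top sequentially"
    and "\<And>k. k \<ge> 1 \<Longrightarrow> d k = x k - x (k - 1)"
    and "bdd_above (d ` {1..})"
    and "\<And>k. k \<ge> 1 \<Longrightarrow> hermitian (\<Lambda> k)"
    and "(\<lambda>k. (d k)\<^sup>2) summable_on {1..}"
    and "\<And>k. k \<ge> 1 \<Longrightarrow> d (k + 1) \<le> d k"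
    and "\<And>k. k \<ge> 1 \<Longrightarrow> d k * d (k + 2) \<ge> (d (k + 1))\<^sup>2"
    and "(\<lambda>k. d (k + 1) *
           opnorm (block11 (\<Lambda> k) + mat (complex_of_real (1 / d k + 1 / d (k + 1))))) summable_on {1..}"
    and "(\<lambda>k. opnorm (block12 (\<Lambda> k))) \<in> O(d)"
    and "\<And>k. k \<ge> 1 \<Longrightarrow> block22 (\<Lambda> k) = diag_real (\<alpha> k) + \<Lambda>t k"
    and "(\<lambda>k. opnorm (\<Lambda>t k)) \<in> O(d)"
    and "(\<forall>j. \<not> (\<lambda>k. \<bar>\<alpha> k j\<bar> * d k ^ 3) summable_on {1..}) \<or>
         (\<exists>M>0. \<forall>k\<ge>1. \<forall>j. 4 / (d (k + 1))\<^sup>2 + \<alpha> k j / d (k + 1) \<le> M)"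
  shows "deficiency_plus (H_operator x \<Lambda>) = enat CARD('p1) \<and>
         deficiency_minus (H_operator x \<Lambda>) = enat CARD('p1)"
  unfolding deficiency_plus_def deficiency_minus_def
  by (intro conjI deficiency_dimension[where d = d and \<alpha> = \<alpha> and \<Lambda>t = \<Lambda>t]; (rule assms; assumption)?; simp?)

end
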